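(* Let $(M^5,[g],I)$ be a scalar negative (directed) almost Einstein manifold in Riemannian signature with scale singularity set $\Sigma\ne\emptyset$. Then the induced conformal structure $(\Sigma^4,[g_\Sigma])$ is Bach flat.
   Context: For a Riemannian metric $g$ on a connected manifold $M^d$ let $P^g$ be the Schouten tensor, $\mathrm{Ric}^g=(d-2)P^g+J^gg$, $J^g=\mathrm{tr}_gP^g$, $\Delta^g=-\nabla^a\nabla_a$. A directed almost Einstein structure on $(M,[g])$ is a not identically zero $s\in C^\infty(M)$ (for a choice $g\in[g]$; replacing $g$ by $e^{2\omega}g$ replaces $s$ by $e^\omega s$) such that the trace-free part of $\nabla^g\nabla^gs+sP^g$ is zero. Equivalently, it is a non-zero parallel section $I=(s,\nabla_as,\frac1d(\Delta s-Js))$ of the standard conformal tractor bundle. Its scale singularity set is $\Sigma=\{s=0\}$. $S(I)=S(g,s)=\frac2ds(J^g-\Delta^g)s-|ds|_g^2$ is constant; the structure is scalar negative if $S(I)<0$, in which case $\Sigma$, if non-empty, is a hypersurface. $[g_\Sigma]$ is the conformal class on $\Sigma$ of the pullbacks of metrics in $[g]$. The Bach tensor of a metric is $B_{ab}=\nabla^cA_{acb}+P^{dc}C_{dacb}$, with $C$ the Weyl tensor and $A_{abc}=\nabla_bP_{ca}-\nabla_cP_{ba}$ the Cotton tensor. In dimension 4 its vanishing is conformally invariant, and Bach flat means $B_{ab}=0$. *)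

theory Defs
  imports "HOL-Analysis.Analysis"
begin

section \<open>Smooth functions on open subsets of Euclidean space\<close>

definition pd :: "'n \<Rightarrow> (real^'n::finite \<Rightarrow> real) \<Rightarrow> real^'n \<Rightarrow> real" where
  "pd i f u = frechet_derivative f (at u) (axis i 1)"

text \<open>For open \<open>S\<close> this is \<open>C\<^sup>\<infinity>\<close>: all iterated partial derivatives exist and are (totally)
  differentiable, hence continuous, on \<open>S\<close>.\<close>

definition smooth_on :: "(real^'n::finite) set \<Rightarrow> (real^'n \<Rightarrow> real) \<Rightarrow> bool" where
  "smooth_on S f \<longleftrightarrow> (\<forall>is. \<forall>u\<in>S. foldr pd is f differentiable (at u))"

definition smooth_map_on :: "(real^'n::finite) set \<Rightarrow> (real^'n \<Rightarrow> real^'m::finite) \<Rightarrow> bool" where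
  "smooth_map_on S F \<longleftrightarrow> (\<forall>k. smooth_on S (\<lambda>u. F u $ k))"


section \<open>Smooth manifolds\<close>

text \<open>A chart is a pair of a domain and a coordinate map; the values of the coordinate map outside
  the domain are irrelevant. A manifold of dimension \<open>CARD('n)\<close> is a topology on its set of points
  together with a (not necessarily maximal) smooth atlas.\<close>

type_synonym ('a, 'n) chart = "'a set \<times> ('a \<Rightarrow> real^'n)"

abbreviation chart_inv :: "('a, 'n::finite) chart \<Rightarrow> real^'n \<Rightarrow> 'a" where
  "chart_inv C \<equiv> inv_into (fst C) (snd C)"

abbreviation chart_image :: "('a, 'n::finite) chart \<Rightarrow> (real^'n) set" where
  "chart_image C \<equiv> snd C ` fst C"

text \<open>Transition map from the coordinates of \<open>C\<close> to those of \<open>D\<close>. The two charts may belong to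
  different manifolds, in which case this is the coordinate expression of the inclusion map.\<close>

abbreviation transition :: "('a, 'n::finite) chart \<Rightarrow> ('a, 'm::finite) chart \<Rightarrow> real^'n \<Rightarrow> real^'m" where
  "transition C D \<equiv> snd D \<circ> chart_inv C"

definition is_chart :: "'a topology \<Rightarrow> ('a, 'n::finite) chart \<Rightarrow> bool" where
  "is_chart T C \<longleftrightarrow> openin T (fst C) \<and> open (chart_image C) \<and>
     homeomorphic_map (subtopology T (fst C)) (top_of_set (chart_image C)) (snd C)"

definition smooth_manifold :: "'a topology \<Rightarrow> ('a, 'n::finite) chart set \<Rightarrow> bool" where
  "smooth_manifold T A \<longleftrightarrow>
     Hausdorff_space T \<and> second_countable T \<and>
     (\<forall>C\<in>A. is_chart T C) \<and> (\<Union>C\<in>A. fst C) = topspace T \<and>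
     (\<forall>C\<in>A. \<forall>D\<in>A. smooth_map_on (snd C ` (fst C \<inter> fst D)) (transition C D))"

definition smooth_function :: "('a, 'n::finite) chart set \<Rightarrow> ('a \<Rightarrow> real) \<Rightarrow> bool" where
  "smooth_function A f \<longleftrightarrow> (\<forall>C\<in>A. smooth_on (chart_image C) (f \<circ> chart_inv C))"

text \<open>The charts which a subset \<open>S\<close> of a manifold inherits as an embedded submanifold of dimension
  \<open>CARD('m)\<close>: local homeomorphisms, for the subspace topology, whose inverses are smooth immersions
  into the ambient manifold. The subset \<open>S\<close> is an embedded submanifold iff these charts make it a
  smooth manifold, and they then form its maximal atlas.\<close>

definition submanifold_atlas ::
    "'a topology \<Rightarrow> ('a, 'n::finite) chart set \<Rightarrow> 'a set \<Rightarrow> ('a, 'm::finite) chart set" where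
  "submanifold_atlas T A S =
     {D. is_chart (subtopology T S) D \<and>
         (\<forall>C\<in>A. smooth_map_on (snd D ` (fst D \<inter> fst C)) (transition D C) \<and>
            (\<forall>p\<in>fst D \<inter> fst C. inj ((*v) (jacobian (transition D C) (at (snd D p))))))}"


section \<open>Riemannian metrics and conformal structures\<close>

text \<open>A metric is given by its matrix of components in each chart, as a function of the
  coordinates; only the values on the image of the chart are relevant.\<close>

type_synonym ('a, 'n) metric = "('a, 'n) chart \<Rightarrow> real^'n \<Rightarrow> real^'n^'n"

definition riemannian_metric :: "('a, 'n::finite) chart set \<Rightarrow> ('a, 'n) metric \<Rightarrow> bool" where
  "riemannian_metric A g \<longleftrightarrow>
     (\<forall>C\<in>A. (\<forall>i j. smooth_on (chart_image C) (\<lambda>u. g C u $ i $ j)) \<and>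
        (\<forall>u\<in>chart_image C. transpose (g C u) = g C u \<and> (\<forall>v. v \<noteq> 0 \<longrightarrow> v \<bullet> (g C u *v v) > 0))) \<and>
     (\<forall>C\<in>A. \<forall>D\<in>A. \<forall>p\<in>fst C \<inter> fst D.
        let J = jacobian (transition C D) (at (snd C p)) in
        g C (snd C p) = transpose J ** g D (snd D p) ** J)"

definition conformally_related ::
    "('a, 'n::finite) chart set \<Rightarrow> ('a, 'n) metric \<Rightarrow> ('a, 'n) metric \<Rightarrow> bool" where
  "conformally_related A g g' \<longleftrightarrow>
     (\<exists>\<omega>. smooth_function A \<omega> \<and>
        (\<forall>C\<in>A. \<forall>p\<in>fst C. g' C (snd C p) = exp (2 * \<omega> p) *\<^sub>R g C (snd C p)))"

definition conformal_class ::
    "('a, 'n::finite) chart set \<Rightarrow> ('a, 'n) metric \<Rightarrow> ('a, 'n) metric set" where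
  "conformal_class A g = {g'. riemannian_metric A g' \<and> conformally_related A g g'}"

definition conformal_structure ::
    "('a, 'n::finite) chart set \<Rightarrow> ('a, 'n) metric set \<Rightarrow> bool" where
  "conformal_structure A c \<longleftrightarrow> (\<exists>g. riemannian_metric A g \<and> c = conformal_class A g)"

text \<open>\<open>h\<close> is the pullback of \<open>g\<close> along the inclusion of the submanifold with atlas \<open>B\<close> into the
  manifold with atlas \<open>A\<close>.\<close>

definition is_pullback_metric ::
    "('a, 'n::finite) chart set \<Rightarrow> ('a, 'm::finite) chart set \<Rightarrow>
     ('a, 'n) metric \<Rightarrow> ('a, 'm) metric \<Rightarrow> bool" where
  "is_pullback_metric A B g h \<longleftrightarrow>
     (\<forall>D\<in>B. \<forall>C\<in>A. \<forall>p\<in>fst D \<inter> fst C.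
        let J = jacobian (transition D C) (at (snd D p)) in
        h D (snd D p) = transpose J ** g C (snd C p) ** J)"

definition induced_conformal_class ::
    "('a, 'n::finite) chart set \<Rightarrow> ('a, 'm::finite) chart set \<Rightarrow>
     ('a, 'n) metric set \<Rightarrow> ('a, 'm) metric set" where
  "induced_conformal_class A B c =
     \<Union>{conformal_class B h | h. riemannian_metric B h \<and> (\<exists>g\<in>c. is_pullback_metric A B g h)}"


section \<open>Curvature in local coordinates\<close>

text \<open>Here \<open>G\<close> is the matrix of components of a metric on an open subset of \<open>\<real>\<^sup>n\<close>. Tensors are
  families of component functions, with all indices lowered unless stated otherwise.\<close>

definition ginv :: "(real^'n::finite \<Rightarrow> real^'n^'n) \<Rightarrow> 'n \<Rightarrow> 'n \<Rightarrow> real^'n \<Rightarrow> real" where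
  "ginv G a b u = matrix_inv (G u) $ a $ b"

text \<open>\<open>christoffel G c a b\<close> is \<open>\<Gamma>\<^sup>c\<^sub>a\<^sub>b\<close>.\<close>

definition christoffel ::
    "(real^'n::finite \<Rightarrow> real^'n^'n) \<Rightarrow> 'n \<Rightarrow> 'n \<Rightarrow> 'n \<Rightarrow> real^'n \<Rightarrow> real" where
  "christoffel G c a b u = (1/2) * (\<Sum>e\<in>UNIV. ginv G c e u *
     (pd a (\<lambda>v. G v $ b $ e) u + pd b (\<lambda>v. G v $ a $ e) u - pd e (\<lambda>v. G v $ a $ b) u))"

text \<open>\<open>cov2 G T c a b\<close> is \<open>\<nabla>\<^sub>c T\<^sub>a\<^sub>b\<close> and \<open>cov3 G T d a b c\<close> is \<open>\<nabla>\<^sub>d T\<^sub>a\<^sub>b\<^sub>c\<close>.\<close>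

definition cov2 ::
    "(real^'n::finite \<Rightarrow> real^'n^'n) \<Rightarrow> ('n \<Rightarrow> 'n \<Rightarrow> real^'n \<Rightarrow> real) \<Rightarrow>
     'n \<Rightarrow> 'n \<Rightarrow> 'n \<Rightarrow> real^'n \<Rightarrow> real" where
  "cov2 G T c a b u = pd c (T a b) u
     - (\<Sum>e\<in>UNIV. christoffel G e c a u * T e b u)
     - (\<Sum>e\<in>UNIV. christoffel G e c b u * T a e u)"

definition cov3 ::
    "(real^'n::finite \<Rightarrow> real^'n^'n) \<Rightarrow> ('n \<Rightarrow> 'n \<Rightarrow> 'n \<Rightarrow> real^'n \<Rightarrow> real) \<Rightarrow>
     'n \<Rightarrow> 'n \<Rightarrow> 'n \<Rightarrow> 'n \<Rightarrow> real^'n \<Rightarrow> real" where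
  "cov3 G T d a b c u = pd d (T a b c) u
     - (\<Sum>e\<in>UNIV. christoffel G e d a u * T e b c u)
     - (\<Sum>e\<in>UNIV. christoffel G e d b u * T a e c u)
     - (\<Sum>e\<in>UNIV. christoffel G e d c u * T a b e u)"

text \<open>\<open>riemann_up G a b c d\<close> is \<open>R\<^sub>a\<^sub>b\<^sup>c\<^sub>d\<close>, with the sign convention
  \<open>(\<nabla>\<^sub>a\<nabla>\<^sub>b - \<nabla>\<^sub>b\<nabla>\<^sub>a) V\<^sup>c = R\<^sub>a\<^sub>b\<^sup>c\<^sub>d V\<^sup>d\<close>. The Ricci tensor is its trace over the first and third
  index, so round spheres have positive Ricci curvature.\<close>

definition riemann_up ::
    "(real^'n::finite \<Rightarrow> real^'n^'n) \<Rightarrow> 'n \<Rightarrow> 'n \<Rightarrow> 'n \<Rightarrow> 'n \<Rightarrow> real^'n \<Rightarrow> real" where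
  "riemann_up G a b c d u =
     pd a (christoffel G c b d) u - pd b (christoffel G c a d) u
     + (\<Sum>e\<in>UNIV. christoffel G c a e u * christoffel G e b d u)
     - (\<Sum>e\<in>UNIV. christoffel G c b e u * christoffel G e a d u)"

definition riemann ::
    "(real^'n::finite \<Rightarrow> real^'n^'n) \<Rightarrow> 'n \<Rightarrow> 'n \<Rightarrow> 'n \<Rightarrow> 'n \<Rightarrow> real^'n \<Rightarrow> real" where
  "riemann G a b c d u = (\<Sum>e\<in>UNIV. G u $ c $ e * riemann_up G a b e d u)"

definition ricci :: "(real^'n::finite \<Rightarrow> real^'n^'n) \<Rightarrow> 'n \<Rightarrow> 'n \<Rightarrow> real^'n \<Rightarrow> real" where
  "ricci G a b u = (\<Sum>c\<in>UNIV. riemann_up G c a c b u)"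

definition trace_wrt ::
    "(real^'n::finite \<Rightarrow> real^'n^'n) \<Rightarrow> ('n \<Rightarrow> 'n \<Rightarrow> real^'n \<Rightarrow> real) \<Rightarrow> real^'n \<Rightarrow> real" where
  "trace_wrt G T u = (\<Sum>a\<in>UNIV. \<Sum>b\<in>UNIV. ginv G a b u * T a b u)"

text \<open>\<open>schouten_trace\<close> (\<open>J\<close>) and \<open>schouten\<close> (\<open>P\<close>) are the solution of \<open>Ric = (d - 2) P + J g\<close>,
  \<open>J = tr P\<close> in dimension \<open>d \<ge> 3\<close>; see the lemmas below.\<close>

definition schouten_trace :: "(real^'n::finite \<Rightarrow> real^'n^'n) \<Rightarrow> real^'n \<Rightarrow> real" where
  "schouten_trace G u = trace_wrt G (ricci G) u / (2 * (real CARD('n) - 1))"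

definition schouten :: "(real^'n::finite \<Rightarrow> real^'n^'n) \<Rightarrow> 'n \<Rightarrow> 'n \<Rightarrow> real^'n \<Rightarrow> real" where
  "schouten G a b u =
     (ricci G a b u - schouten_trace G u * G u $ a $ b) / (real CARD('n) - 2)"

lemma ricci_eq_schouten:
  fixes G :: "real^'n::finite \<Rightarrow> real^'n^'n"
  assumes "CARD('n) \<ge> 3"
  shows "ricci G a b u =
     (real CARD('n) - 2) * schouten G a b u + schouten_trace G u * G u $ a $ b"
  using assms by (simp add: schouten_def)

lemma schouten_trace_eq:
  fixes G :: "real^'n::finite \<Rightarrow> real^'n^'n"
  assumes "CARD('n) \<ge> 3" and "invertible (G u)" and "transpose (G u) = G u"
  shows "trace_wrt G (schouten G) u = schouten_trace G u"
proof -
  let ?d = "real CARD('n)"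
  have sym: "G u $ a $ b = G u $ b $ a" for a b
    using arg_cong[OF assms(3), of "\<lambda>M. M $ b $ a"] by (simp add: transpose_def)
  have "matrix_inv (G u) ** G u = mat 1"
    using assms(2) unfolding invertible_def matrix_inv_def by (rule someI2_ex) simp
  then have "(matrix_inv (G u) ** G u) $ a $ a = 1" for a
    by (simp add: mat_def)
  then have "(\<Sum>b\<in>UNIV. matrix_inv (G u) $ a $ b * G u $ b $ a) = 1" for a
    by (simp add: matrix_matrix_mult_def)
  then have d: "(\<Sum>a\<in>UNIV. \<Sum>b\<in>UNIV. ginv G a b u * G u $ a $ b) = ?d"
    by (simp add: ginv_def sym)
  have "trace_wrt G (schouten G) u = (\<Sum>a\<in>UNIV. \<Sum>b\<in>UNIV.
      (ginv G a b u * ricci G a b u - schouten_trace G u * (ginv G a b u * G u $ a $ b)) / (?d - 2))"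
    by (simp add: trace_wrt_def schouten_def algebra_simps)
  also have "\<dots> = (trace_wrt G (ricci G) u - schouten_trace G u * ?d) / (?d - 2)"
    unfolding sum_divide_distrib[symmetric] sum_subtractf sum_distrib_left[symmetric] d trace_wrt_def ..
  also have "trace_wrt G (ricci G) u = 2 * (?d - 1) * schouten_trace G u"
    using assms(1) by (simp add: schouten_trace_def)
  also have "(2 * (?d - 1) * schouten_trace G u - schouten_trace G u * ?d) / (?d - 2) =
      schouten_trace G u"
    using assms(1) by (simp add: field_simps)
  finally show ?thesis .
qed

text \<open>\<open>C\<^sub>a\<^sub>b\<^sub>c\<^sub>d = R\<^sub>a\<^sub>b\<^sub>c\<^sub>d - 2 g\<^sub>c\<^sub>[\<^sub>a P\<^sub>b\<^sub>]\<^sub>d - 2 g\<^sub>d\<^sub>[\<^sub>b P\<^sub>a\<^sub>]\<^sub>c\<close>\<close>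

definition weyl ::
    "(real^'n::finite \<Rightarrow> real^'n^'n) \<Rightarrow> 'n \<Rightarrow> 'n \<Rightarrow> 'n \<Rightarrow> 'n \<Rightarrow> real^'n \<Rightarrow> real" where
  "weyl G a b c d u = riemann G a b c d u
     - (G u $ c $ a * schouten G b d u - G u $ c $ b * schouten G a d u)
     - (G u $ d $ b * schouten G a c u - G u $ d $ a * schouten G b c u)"

text \<open>\<open>A\<^sub>a\<^sub>b\<^sub>c = \<nabla>\<^sub>b P\<^sub>c\<^sub>a - \<nabla>\<^sub>c P\<^sub>b\<^sub>a\<close>\<close>

definition cotton ::
    "(real^'n::finite \<Rightarrow> real^'n^'n) \<Rightarrow> 'n \<Rightarrow> 'n \<Rightarrow> 'n \<Rightarrow> real^'n \<Rightarrow> real" where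
  "cotton G a b c u = cov2 G (schouten G) b c a u - cov2 G (schouten G) c b a u"

text \<open>\<open>B\<^sub>a\<^sub>b = \<nabla>\<^sup>c A\<^sub>a\<^sub>c\<^sub>b + P\<^sup>d\<^sup>c C\<^sub>d\<^sub>a\<^sub>c\<^sub>b\<close>\<close>

definition bach :: "(real^'n::finite \<Rightarrow> real^'n^'n) \<Rightarrow> 'n \<Rightarrow> 'n \<Rightarrow> real^'n \<Rightarrow> real" where
  "bach G a b u =
     (\<Sum>c\<in>UNIV. \<Sum>e\<in>UNIV. ginv G c e u * cov3 G (cotton G) e a c b u)
     + (\<Sum>d\<in>UNIV. \<Sum>c\<in>UNIV. (\<Sum>e\<in>UNIV. \<Sum>f\<in>UNIV. ginv G d e u * ginv G c f u * schouten G e f u)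
          * weyl G d a c b u)"

text \<open>Bach flatness of a conformal structure of dimension 4, where it does not matter whether the
  condition is imposed on one or on all metrics of the class.\<close>

definition bach_flat :: "('a, 4) chart set \<Rightarrow> ('a, 4) metric set \<Rightarrow> bool" where
  "bach_flat A c \<longleftrightarrow> (\<forall>g\<in>c. \<forall>C\<in>A. \<forall>u\<in>chart_image C. \<forall>a b. bach (g C) a b u = 0)"


section \<open>Almost Einstein structures\<close>

definition hessian ::
    "(real^'n::finite \<Rightarrow> real^'n^'n) \<Rightarrow> (real^'n \<Rightarrow> real) \<Rightarrow> 'n \<Rightarrow> 'n \<Rightarrow> real^'n \<Rightarrow> real" where
  "hessian G f a b u = pd a (pd b f) u - (\<Sum>c\<in>UNIV. christoffel G c a b u * pd c f u)"

text \<open>The sign convention is \<open>\<Delta> = -\<nabla>\<^sup>a\<nabla>\<^sub>a\<close>.\<close>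

definition laplacian ::
    "(real^'n::finite \<Rightarrow> real^'n^'n) \<Rightarrow> (real^'n \<Rightarrow> real) \<Rightarrow> real^'n \<Rightarrow> real" where
  "laplacian G f u = - trace_wrt G (hessian G f) u"

definition trace_free_part ::
    "(real^'n::finite \<Rightarrow> real^'n^'n) \<Rightarrow> ('n \<Rightarrow> 'n \<Rightarrow> real^'n \<Rightarrow> real) \<Rightarrow>
     'n \<Rightarrow> 'n \<Rightarrow> real^'n \<Rightarrow> real" where
  "trace_free_part G T a b u = T a b u - trace_wrt G T u * G u $ a $ b / real CARD('n)"

text \<open>\<open>s\<close> represents the structure in the scale \<open>g\<close>; in the scale \<open>exp (2 * \<omega>) * g\<close> it is
  represented by \<open>exp \<omega> * s\<close>.\<close>

definition almost_einstein ::
    "'a topology \<Rightarrow> ('a, 'n::finite) chart set \<Rightarrow> ('a, 'n) metric \<Rightarrow> ('a \<Rightarrow> real) \<Rightarrow> bool" where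
  "almost_einstein T A g s \<longleftrightarrow>
     smooth_function A s \<and> (\<exists>p\<in>topspace T. s p \<noteq> 0) \<and>
     (\<forall>C\<in>A. \<forall>u\<in>chart_image C. \<forall>a b.
        let f = s \<circ> chart_inv C in
        trace_free_part (g C)
          (\<lambda>a b u. hessian (g C) f a b u + f u * schouten (g C) a b u) a b u = 0)"

text \<open>The function \<open>S(g, s) = (2/d) s (J - \<Delta>) s - |ds|\<^sup>2\<close> in a chart. It is constant on a connected
  manifold if \<open>s\<close> is almost Einstein, and it does not depend on the scale.\<close>

definition S_local ::
    "(real^'n::finite \<Rightarrow> real^'n^'n) \<Rightarrow> (real^'n \<Rightarrow> real) \<Rightarrow> real^'n \<Rightarrow> real" where
  "S_local G f u =
     2 / real CARD('n) * f u * (schouten_trace G u * f u - laplacian G f u)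
     - trace_wrt G (\<lambda>a b u. pd a f u * pd b f u) u"

definition scalar_negative ::
    "('a, 'n::finite) chart set \<Rightarrow> ('a, 'n) metric \<Rightarrow> ('a \<Rightarrow> real) \<Rightarrow> bool" where
  "scalar_negative A g s \<longleftrightarrow>
     (\<forall>C\<in>A. \<forall>u\<in>chart_image C. S_local (g C) (s \<circ> chart_inv C) u < 0)"

definition scale_singularity_set :: "'a topology \<Rightarrow> ('a \<Rightarrow> real) \<Rightarrow> 'a set" where
  "scale_singularity_set T s = {p \<in> topspace T. s p = 0}"

end

theory Submission
  imports Defs
begin

text \<open>
  Write \<open>n = ds\<close> and \<open>\<nabla>n = - s P - \<rho> g\<close>. Commuting derivatives gives \<open>d\<rho> = P n\<close> and
  \<open>C\<^sub>a\<^sub>b\<^sub>c\<^sub>d n\<^sup>d + s A\<^sub>c\<^sub>a\<^sub>b = 0\<close>, and the divergence of the latter is, by the Bianchi identity,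
  \<open>s B\<^sub>c\<^sub>b + (d - 3) A\<^sub>b\<^sub>c\<^sub>d n\<^sup>d - A\<^sub>c\<^sub>b\<^sub>d n\<^sup>d = 0\<close>. For \<open>d = 5\<close> this forces \<open>A\<^sub>b\<^sub>c\<^sub>d n\<^sup>d = 0\<close> on \<open>s = 0\<close>,
  and its normal derivative there determines \<open>n\<^sup>e n\<^sup>d \<nabla>\<^sub>e A\<^sub>b\<^sub>c\<^sub>d\<close> as \<open>- |n|\<^sup>2 B\<^sub>b\<^sub>c\<close>.

  A conformal change realises any given metric of the induced class and makes \<open>\<rho> = 0\<close> on
  \<open>\<Sigma>\<close>, which is then totally geodesic. As \<open>C n = 0\<close> on \<open>\<Sigma>\<close>, the tensors \<open>P\<close>, \<open>A\<close>, \<open>C\<close> and \<open>\<nabla>A\<close> of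
  \<open>\<Sigma>\<close> are the restrictions of the ambient ones, so the Bach tensor of \<open>\<Sigma>\<close> differs from the
  restriction of \<open>B\<close> only by the normal contraction of \<open>\<nabla>A\<close>, and the two terms cancel.
\<close>

section \<open>Calculus of smooth functions\<close>

text \<open>The dimension enters through two coefficients. On the zero set the divergence identity
  is a linear system for A(n) and its transpose with determinant (d - 3)^2 - 1, here 3, so A(n) = 0.
  Its normal derivative carries the factor d - 4 in front of the normal contraction of \<nabla>A,
  because that contraction is symmetric. With d - 4 = 1, it meets the Bach tensor in exactly the
  ratio in which the trace over the tangent space of \<Sigma> combines the two. The symmetry is the
  delicate point. By the cyclic identity the skew part of A(n) is A contracted with n in its first
  slot, and the equation gives the vanishing of this only after multiplication by s, which cannot be
  cancelled on \<Sigma>. Differentiating the product along n recovers the value and the normal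
  derivative there. The second obstacle is that a metric of the induced class differs from a
  pullback by a factor known on \<Sigma> only. Extending it requires a smooth local left inverse of
  the inclusion, hence the inverse function theorem with a smooth inverse.\<close>

lemma pd_has_derivative:
  assumes "(f has_derivative f') (at u)"
  shows "pd i f u = f' (axis i 1)"
  using frechet_derivative_at[OF assms] by (simp add: pd_def)

lemma has_derivative_pd:
  fixes f :: "real^'n::finite \<Rightarrow> real"
  assumes "f differentiable (at u)"
  shows "(f has_derivative (\<lambda>h. \<Sum>i\<in>UNIV. pd i f u * h $ i)) (at u)"
proof -
  have d: "(f has_derivative frechet_derivative f (at u)) (at u)"
    using assms frechet_derivative_works by blast
  then have lin: "linear (frechet_derivative f (at u))"
    by (rule has_derivative_linear)
  have "frechet_derivative f (at u) h = (\<Sum>i\<in>UNIV. pd i f u * h $ i)" for h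
  proof -
    have "frechet_derivative f (at u) h = frechet_derivative f (at u) (\<Sum>i\<in>UNIV. h $ i *\<^sub>R axis i 1)"
      by (simp add: basis_expansion[of h, unfolded scalar_mult_eq_scaleR])
    also have "\<dots> = (\<Sum>i\<in>UNIV. pd i f u * h $ i)"
      by (simp add: linear_sum[OF lin] linear_cmul[OF lin] pd_def mult.commute)
    finally show ?thesis .
  qed
  with d show ?thesis
    by (metis (no_types, lifting) ext)
qed

lemma pd_cong_open:
  assumes "open S" "u \<in> S" "\<And>x. x \<in> S \<Longrightarrow> f x = g x"
  shows "pd i f u = pd i g u"
proof -
  have "(f has_derivative D) (at u) \<longleftrightarrow> (g has_derivative D) (at u)" for D
    using assms has_derivative_transform_within_open[OF _ assms(1,2)] by metis
  then show ?thesis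
    by (simp add: pd_def frechet_derivative_def)
qed

lemma differentiable_cong_open:
  assumes "open S" "u \<in> S" "\<And>x. x \<in> S \<Longrightarrow> f x = g x" "f differentiable (at u)"
  shows "g differentiable (at u)"
  using assms has_derivative_transform_within_open unfolding differentiable_def by metis

lemma pd_const [simp]: "pd i (\<lambda>x. k) u = 0"
  by (rule pd_has_derivative[OF has_derivative_const])

lemma pd_add':
  assumes "f differentiable (at u)" "g differentiable (at u)"
  shows "pd i (\<lambda>x. f x + g x) u = pd i f u + pd i g u"
  using pd_has_derivative[OF has_derivative_add[OF has_derivative_pd[OF assms(1)] has_derivative_pd[OF assms(2)]], of i]
  by (simp add: pd_has_derivative[OF has_derivative_pd[OF assms(1)], of i]
      pd_has_derivative[OF has_derivative_pd[OF assms(2)], of i])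

lemma pd_mult':
  assumes "f differentiable (at u)" "g differentiable (at u)"
  shows "pd i (\<lambda>x. f x * g x) u = pd i f u * g u + f u * pd i g u"
  using pd_has_derivative[OF has_derivative_mult[OF has_derivative_pd[OF assms(1)] has_derivative_pd[OF assms(2)]], of i]
  by (simp add: pd_has_derivative[OF has_derivative_pd[OF assms(1)], of i]
      pd_has_derivative[OF has_derivative_pd[OF assms(2)], of i])

lemma differentiable_vec_comp:
  fixes F :: "real^'n::finite \<Rightarrow> real^'m::finite"
  assumes "\<And>k. (\<lambda>x. F x $ k) differentiable (at u)"
  shows "(F has_derivative (\<lambda>h. \<chi> k. \<Sum>i\<in>UNIV. pd i (\<lambda>x. F x $ k) u * h $ i)) (at u)"
proof -
  have "((\<lambda>x. F x \<bullet> b) has_derivative (\<lambda>h. (\<chi> k. \<Sum>i\<in>UNIV. pd i (\<lambda>x. F x $ k) u * h $ i) \<bullet> b)) (at u)"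
    if "b \<in> Basis" for b
  proof -
    obtain k where b: "b = axis k 1"
      using \<open>b \<in> Basis\<close> by (auto simp: Basis_vec_def)
    show ?thesis
      using has_derivative_pd[OF assms[of k]] by (simp add: b inner_axis)
  qed
  then show ?thesis
    using has_derivative_componentwise_within by blast
qed

lemma pd_compose:
  fixes F :: "real^'n::finite \<Rightarrow> real^'m::finite"
  assumes "\<And>k. (\<lambda>x. F x $ k) differentiable (at u)" "f differentiable (at (F u))"
  shows "pd i (\<lambda>x. f (F x)) u = (\<Sum>k\<in>UNIV. pd k f (F u) * pd i (\<lambda>x. F x $ k) u)"
    and "(\<lambda>x. f (F x)) differentiable (at u)"
proof -
  have d: "((\<lambda>x. f (F x)) has_derivative (\<lambda>h. \<Sum>k\<in>UNIV. pd k f (F u) *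
      (\<chi> k. \<Sum>i\<in>UNIV. pd i (\<lambda>x. F x $ k) u * h $ i) $ k)) (at u)"
    using has_derivative_compose[OF differentiable_vec_comp[OF assms(1)] has_derivative_pd[OF assms(2)]] .
  show "pd i (\<lambda>x. f (F x)) u = (\<Sum>k\<in>UNIV. pd k f (F u) * pd i (\<lambda>x. F x $ k) u)"
    using pd_has_derivative[OF d, of i] by (simp add: axis_def if_distrib cong: if_cong)
  show "(\<lambda>x. f (F x)) differentiable (at u)"
    using d differentiable_def by blast
qed

lemma jacobian_nth:
  fixes F :: "real^'n::finite \<Rightarrow> real^'m::finite"
  assumes "\<And>k. (\<lambda>x. F x $ k) differentiable (at u)"
  shows "jacobian F (at u) $ k $ i = pd i (\<lambda>x. F x $ k) u"
  unfolding jacobian_def matrix_def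
  by (simp add: frechet_derivative_at[OF differentiable_vec_comp[OF assms], symmetric]
      axis_def if_distrib cong: if_cong)

text \<open>Finite-order form of \<open>smooth_on\<close>. Closure properties need an induction on
  the order in which the function may change from \<open>f\<close> to \<open>pd i f\<close>; the
  list-based definition offers no such induction directly.\<close>

primrec ck :: "nat \<Rightarrow> (real^'n::finite) set \<Rightarrow> (real^'n \<Rightarrow> real) \<Rightarrow> bool" where
  "ck 0 S f = (\<forall>u\<in>S. f differentiable (at u))"
| "ck (Suc n) S f = ((\<forall>u\<in>S. f differentiable (at u)) \<and> (\<forall>i. ck n S (pd i f)))"

text \<open>\<open>foldr pd\<close> applies the last entry of the list first, so replacing
  \<open>f\<close> by \<open>pd i f\<close> corresponds to splitting the list at its end.\<close>

lemma ck_iff: "ck n S f \<longleftrightarrow> (\<forall>is. length is \<le> n \<longrightarrow> (\<forall>u\<in>S. foldr pd is f differentiable (at u)))"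
proof (induction n arbitrary: f)
  case 0
  then show ?case by simp
next
  case (Suc n)
  have "(\<forall>is. length is \<le> Suc n \<longrightarrow> (\<forall>u\<in>S. foldr pd is f differentiable (at u))) \<longleftrightarrow>
    (\<forall>u\<in>S. f differentiable (at u)) \<and>
    (\<forall>i is. length is \<le> n \<longrightarrow> (\<forall>u\<in>S. foldr pd is (pd i f) differentiable (at u)))" (is "?L \<longleftrightarrow> ?R")
  proof
    assume L: ?L
    have "foldr pd is (pd i f) differentiable (at u)" if "length is \<le> n" "u \<in> S" for i "is" u
      using L[rule_format, of "is @ [i]" u] that by simp
    then show ?R
      using L[rule_format, of "[]"] by auto
  next
    assume R: ?R
    show ?L
    proof (intro allI impI ballI)
      fix "is" :: "'a list" and u
      assume len: "length is \<le> Suc n" and u: "u \<in> S"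
      show "foldr pd is f differentiable (at u)"
      proof (cases "is" rule: rev_cases)
        case Nil
        then show ?thesis using R u by simp
      next
        case (snoc ys y)
        then show ?thesis using R u len by simp
      qed
    qed
  qed
  then show ?case by (simp add: Suc)
qed

lemma smooth_on_iff_ck: "smooth_on S f \<longleftrightarrow> (\<forall>n. ck n S f)"
  unfolding smooth_on_def ck_iff by blast

lemma ck_differentiable: "ck n S f \<Longrightarrow> u \<in> S \<Longrightarrow> f differentiable (at u)"
  by (cases n) auto

lemma ck_Suc: "ck (Suc n) S f \<Longrightarrow> ck n S f"
  by (induction n arbitrary: f) auto

lemma ck_cong:
  assumes "open S" "\<And>x. x \<in> S \<Longrightarrow> f x = g x" "ck n S f"
  shows "ck n S g"
  using assms(2,3)
proof (induction n arbitrary: f g)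
  case 0
  then show ?case using differentiable_cong_open[OF assms(1)] by (metis ck.simps(1))
next
  case (Suc n)
  have "ck n S (pd i g)" for i
    using Suc.IH[of "pd i f" "pd i g"] Suc.prems pd_cong_open[OF assms(1)] by (metis ck.simps(2))
  moreover have "\<forall>u\<in>S. g differentiable (at u)"
    using differentiable_cong_open[OF assms(1)] Suc.prems by (metis ck.simps(2))
  ultimately show ?case by simp
qed

lemma ck_const: "ck n S (\<lambda>x. k)"
proof (induction n arbitrary: k)
  case (Suc n)
  have "pd i (\<lambda>x. k) = (\<lambda>x. 0)" for i :: 'a
    by (rule ext) simp
  with Suc show ?case by simp
qed simp

lemma ck_add:
  assumes "open S" "ck n S f" "ck n S g"
  shows "ck n S (\<lambda>x. f x + g x)"
  using assms(2,3)
proof (induction n arbitrary: f g)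
  case 0
  then show ?case by auto
next
  case (Suc n)
  have "ck n S (pd i (\<lambda>x. f x + g x))" for i
    by (rule ck_cong[OF assms(1) _ Suc.IH[of "pd i f" "pd i g"]])
      (use Suc.prems in \<open>auto simp: pd_add'\<close>)
  then show ?case using Suc.prems by auto
qed

lemma ck_mult:
  assumes "open S" "ck n S f" "ck n S g"
  shows "ck n S (\<lambda>x. f x * g x)"
  using assms(2,3)
proof (induction n arbitrary: f g)
  case 0
  then show ?case by (auto intro: differentiable_mult)
next
  case (Suc n)
  have "ck n S (pd i (\<lambda>x. f x * g x))" for i
  proof (rule ck_cong[OF assms(1) _ ck_add[OF assms(1) Suc.IH[of "pd i f" g] Suc.IH[of f "pd i g"]]])
    show "ck n S f" "ck n S g" using Suc.prems ck_Suc by blast+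
  qed (use Suc.prems in \<open>auto simp: pd_mult'\<close>)
  then show ?case using Suc.prems by (auto intro: differentiable_mult)
qed

lemma ck_sum:
  assumes "open S" "\<And>a. a \<in> A \<Longrightarrow> ck n S (f a)"
  shows "ck n S (\<lambda>x. \<Sum>a\<in>A. f a x)"
  using assms(2) by (induction A rule: infinite_finite_induct) (simp_all add: ck_const ck_add[OF assms(1)])

text \<open>By the chain rule each partial derivative of the composite contains
  \<open>pd k f\<close> after the same \<open>F\<close>. The induction therefore runs over
  \<open>f\<close> with \<open>F\<close> fixed, and \<open>F\<close> is merely lowered by one
  order.\<close>

lemma ck_compose:
  fixes F :: "real^'n::finite \<Rightarrow> real^'m::finite"
  assumes "open S" "open S'" "\<And>x. x \<in> S \<Longrightarrow> F x \<in> S'" "\<And>k. ck n S (\<lambda>x. F x $ k)" "ck n S' f"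
  shows "ck n S (\<lambda>x. f (F x))"
  using assms(4,5)
proof (induction n arbitrary: f)
  case 0
  have "(\<lambda>x. f (F x)) differentiable (at u)" if "u \<in> S" for u
    by (rule pd_compose(2)) (use 0 assms(3)[OF that] that in auto)
  then show ?case by simp
next
  case (Suc n)
  have F: "ck n S (\<lambda>x. F x $ k)" for k
    by (rule ck_Suc[OF Suc.prems(1)])
  have dF: "(\<lambda>x. F x $ k) differentiable (at u)" "f differentiable (at (F u))" if "u \<in> S" for u k
    using ck_differentiable[OF Suc.prems(1) that] ck_differentiable[OF Suc.prems(2) assms(3)[OF that]] by auto
  have "ck n S (pd i (\<lambda>x. f (F x)))" for i
  proof (rule ck_cong[OF assms(1)])
    show "ck n S (\<lambda>x. \<Sum>k\<in>UNIV. pd k f (F x) * pd i (\<lambda>x. F x $ k) x)"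
    proof (rule ck_sum[OF assms(1)], rule ck_mult[OF assms(1)])
      show "ck n S (\<lambda>x. pd k f (F x))" for k
        by (rule Suc.IH[OF F]) (use Suc.prems(2) in simp)
      show "ck n S (pd i (\<lambda>x. F x $ k))" for k
        using Suc.prems(1)[of k] by simp
    qed
    show "(\<Sum>k\<in>UNIV. pd k f (F x) * pd i (\<lambda>x. F x $ k) x) = pd i (\<lambda>x. f (F x)) x" if "x \<in> S" for x
      using pd_compose(1)[OF dF(1) dF(2)] that by simp
  qed
  moreover have "(\<lambda>x. f (F x)) differentiable (at u)" if "u \<in> S" for u
    by (rule pd_compose(2)[OF dF(1) dF(2)]) (use that in auto)
  ultimately show ?case by simp
qed

lemma smooth_on_cong:
  "open S \<Longrightarrow> (\<And>x. x \<in> S \<Longrightarrow> f x = g x) \<Longrightarrow> smooth_on S f \<Longrightarrow> smooth_on S g"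
  unfolding smooth_on_iff_ck using ck_cong by blast

lemma smooth_on_subset: "smooth_on S f \<Longrightarrow> S' \<subseteq> S \<Longrightarrow> smooth_on S' f"
  unfolding smooth_on_def by blast

lemma smooth_on_local:
  assumes "\<And>u. u \<in> S \<Longrightarrow> \<exists>V. u \<in> V \<and> smooth_on V f"
  shows "smooth_on S f"
  using assms unfolding smooth_on_def by blast

lemma smooth_on_const [simp]: "smooth_on S (\<lambda>x. k)"
  by (simp add: smooth_on_iff_ck ck_const)

lemma smooth_on_pd [simp]: "smooth_on S f \<Longrightarrow> smooth_on S (pd i f)"
  unfolding smooth_on_iff_ck using ck.simps(2) by blast

lemma smooth_on_differentiable: "smooth_on S f \<Longrightarrow> u \<in> S \<Longrightarrow> f differentiable (at u)"
  unfolding smooth_on_iff_ck using ck_differentiable by blast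

lemma smooth_on_add: "open S \<Longrightarrow> smooth_on S f \<Longrightarrow> smooth_on S g \<Longrightarrow> smooth_on S (\<lambda>x. f x + g x)"
  unfolding smooth_on_iff_ck using ck_add by blast

lemma smooth_on_mult: "open S \<Longrightarrow> smooth_on S f \<Longrightarrow> smooth_on S g \<Longrightarrow> smooth_on S (\<lambda>x. f x * g x)"
  unfolding smooth_on_iff_ck using ck_mult by blast

lemma smooth_on_minus: "open S \<Longrightarrow> smooth_on S f \<Longrightarrow> smooth_on S (\<lambda>x. - f x)"
  using smooth_on_mult[of S "\<lambda>x. -1" f] by simp

lemma smooth_on_diff: "open S \<Longrightarrow> smooth_on S f \<Longrightarrow> smooth_on S g \<Longrightarrow> smooth_on S (\<lambda>x. f x - g x)"
  using smooth_on_add[of S f "\<lambda>x. - g x"] smooth_on_minus[of S g] by simp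

lemma smooth_on_sum:
  "open S \<Longrightarrow> (\<And>a. a \<in> A \<Longrightarrow> smooth_on S (f a)) \<Longrightarrow> smooth_on S (\<lambda>x. \<Sum>a\<in>A. f a x)"
  unfolding smooth_on_iff_ck by (intro allI ck_sum) auto

lemma smooth_on_prod:
  assumes "open S" "\<And>a. a \<in> A \<Longrightarrow> smooth_on S (f a)"
  shows "smooth_on S (\<lambda>x. \<Prod>a\<in>A. f a x)"
  using assms(2)
  by (induction A rule: infinite_finite_induct) (simp_all add: smooth_on_mult[OF assms(1)])

lemma smooth_on_compose:
  fixes F :: "real^'n::finite \<Rightarrow> real^'m::finite"
  assumes "open S" "open S'" "\<And>x. x \<in> S \<Longrightarrow> F x \<in> S'" "smooth_map_on S F" "smooth_on S' f"
  shows "smooth_on S (\<lambda>x. f (F x))"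
  unfolding smooth_on_iff_ck
proof
  show "ck n S (\<lambda>x. f (F x))" for n
    by (rule ck_compose[OF assms(1,2)]) (use assms(3-5) in \<open>auto simp: smooth_map_on_def smooth_on_iff_ck\<close>)
qed

text \<open>Bootstrapping: the derivative of 1/f is a product of 1/f, \<open>pd i f\<close> and 1/f,
  so order \<open>n\<close> of 1/f gives order \<open>n + 1\<close>. The same scheme serves for
  \<open>exp\<close> and for the inverse function theorem.\<close>

lemma smooth_on_inverse:
  assumes "open S" "smooth_on S f" "\<And>x. x \<in> S \<Longrightarrow> f x \<noteq> 0"
  shows "smooth_on S (\<lambda>x. inverse (f x))"
proof -
  have d: "((\<lambda>x. inverse (f x)) has_derivative
      (\<lambda>h. - (inverse (f u) * (\<Sum>i\<in>UNIV. pd i f u * h $ i) * inverse (f u)))) (at u)" if "u \<in> S" for u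
    using Deriv.has_derivative_inverse[OF _ has_derivative_pd[OF smooth_on_differentiable[OF assms(2) that]]]
      assms(3)[OF that] by simp
  have "pd i (\<lambda>x. inverse (f x)) u = - (inverse (f u) * pd i f u * inverse (f u))" if "u \<in> S" for u i
    using pd_has_derivative[OF d[OF that], of i]
      pd_has_derivative[OF has_derivative_pd[OF smooth_on_differentiable[OF assms(2) that]], of i]
    by simp
  then have p: "-1 * (inverse (f u) * pd i f u * inverse (f u)) = pd i (\<lambda>x. inverse (f x)) u"
    if "u \<in> S" for u i
    using that by simp
  have "ck n S (\<lambda>x. inverse (f x))" for n
  proof (induction n)
    case 0
    then show ?case using d differentiable_def by fastforce
  next
    case (Suc n)
    have "ck n S (pd i (\<lambda>x. inverse (f x)))" for i
    proof (rule ck_cong[OF assms(1) p])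
      have "ck n S (pd i f)"
        using smooth_on_pd[OF assms(2)] by (simp add: smooth_on_iff_ck)
      then show "ck n S (\<lambda>u. -1 * (inverse (f u) * pd i f u * inverse (f u)))"
        by (intro ck_mult[OF assms(1)] ck_const Suc)
    qed
    then show ?case using d differentiable_def by fastforce
  qed
  then show ?thesis by (simp add: smooth_on_iff_ck)
qed

lemma smooth_on_divide:
  assumes "open S" "smooth_on S f" "smooth_on S g" "\<And>x. x \<in> S \<Longrightarrow> g x \<noteq> 0"
  shows "smooth_on S (\<lambda>x. f x / g x)"
  using smooth_on_mult[OF assms(1,2) smooth_on_inverse[OF assms(1,3,4)]] by (simp add: divide_inverse)

lemma pd_exp:
  assumes "f differentiable (at u)"
  shows "pd i (\<lambda>x. exp (f x)) u = exp (f u) * pd i f u" "(\<lambda>x. exp (f x)) differentiable (at u)"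
proof -
  have d: "((\<lambda>x. exp (f x)) has_derivative (\<lambda>h. exp (f u) * (\<Sum>i\<in>UNIV. pd i f u * h $ i))) (at u)"
    using has_derivative_exp[OF has_derivative_pd[OF assms]] by (simp add: mult.commute)
  show "pd i (\<lambda>x. exp (f x)) u = exp (f u) * pd i f u"
    using pd_has_derivative[OF d, of i] pd_has_derivative[OF has_derivative_pd[OF assms], of i] by simp
  show "(\<lambda>x. exp (f x)) differentiable (at u)"
    using d differentiable_def by blast
qed

lemma smooth_on_exp:
  assumes "open S" "smooth_on S f"
  shows "smooth_on S (\<lambda>x. exp (f x))"
proof -
  have d: "f differentiable (at u)" if "u \<in> S" for u
    using smooth_on_differentiable[OF assms(2) that] .
  have "ck n S (\<lambda>x. exp (f x))" for n
  proof (induction n)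
    case 0
    then show ?case using pd_exp(2)[OF d] by simp
  next
    case (Suc n)
    have "ck n S (pd i (\<lambda>x. exp (f x)))" for i
    proof (rule ck_cong[OF assms(1)])
      show "ck n S (\<lambda>x. exp (f x) * pd i f x)"
        using smooth_on_pd[OF assms(2)] by (intro ck_mult assms(1) Suc) (simp add: smooth_on_iff_ck)
    qed (simp add: pd_exp(1)[OF d])
    then show ?case using pd_exp(2)[OF d] by simp
  qed
  then show ?thesis by (simp add: smooth_on_iff_ck)
qed

lemma pd_coord [simp]: "pd i (\<lambda>x. x $ j) u = (if i = j then 1 else 0)"
proof -
  have "((\<lambda>x::real^'a. x $ j) has_derivative (\<lambda>h. h $ j)) (at u)"
    by (simp add: bounded_linear_imp_has_derivative bounded_linear_vec_nth)
  from pd_has_derivative[OF this, of i] show ?thesis by (simp add: axis_def)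
qed

lemma smooth_on_coord [simp]: "smooth_on S (\<lambda>x. x $ j)"
proof -
  have "pd i (\<lambda>x. x $ j) = (\<lambda>u. if i = j then 1 else 0)" for i :: 'a
    by (rule ext) simp
  moreover have "(\<lambda>x. x $ j) differentiable (at u)" for u :: "real^'a"
    by (simp add: bounded_linear_imp_differentiable bounded_linear_vec_nth)
  ultimately have "ck n S (\<lambda>x. x $ j)" for n
    by (cases n) (auto simp: ck_const)
  then show ?thesis by (simp add: smooth_on_iff_ck)
qed

lemma smooth_map_on_compose:
  fixes F :: "real^'n::finite \<Rightarrow> real^'m::finite" and H :: "real^'m \<Rightarrow> real^'k::finite"
  assumes "open S" "open S'" "\<And>x. x \<in> S \<Longrightarrow> F x \<in> S'" "smooth_map_on S F" "smooth_map_on S' H"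
  shows "smooth_map_on S (\<lambda>x. H (F x))"
  using smooth_on_compose[OF assms(1-4)] assms(5) unfolding smooth_map_on_def by blast

lemma smooth_map_on_cong:
  "open S \<Longrightarrow> (\<And>x. x \<in> S \<Longrightarrow> F x = H x) \<Longrightarrow> smooth_map_on S F \<Longrightarrow> smooth_map_on S H"
  unfolding smooth_map_on_def by (metis (no_types, lifting) smooth_on_cong)

lemma smooth_map_on_subset: "smooth_map_on S f \<Longrightarrow> S' \<subseteq> S \<Longrightarrow> smooth_map_on S' f"
  unfolding smooth_map_on_def using smooth_on_subset by blast

lemma smooth_map_on_local:
  assumes "\<And>u. u \<in> S \<Longrightarrow> \<exists>V. u \<in> V \<and> smooth_map_on V f"
  shows "smooth_map_on S f"
  unfolding smooth_map_on_def
proof (intro allI smooth_on_local)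
  show "\<exists>V. u \<in> V \<and> smooth_on V (\<lambda>u. f u $ k)" if "u \<in> S" for u k
    using assms[OF that] unfolding smooth_map_on_def by metis
qed

lemma smooth_map_has_derivative:
  assumes "smooth_map_on S F" "u \<in> S"
  shows "(F has_derivative (\<lambda>h. \<chi> k. \<Sum>i\<in>UNIV. pd i (\<lambda>x. F x $ k) u * h $ i)) (at u)"
  using assms by (intro differentiable_vec_comp) (auto simp: smooth_map_on_def intro: smooth_on_differentiable)

lemma smooth_map_jacobian:
  assumes "smooth_map_on S F" "u \<in> S"
  shows "jacobian F (at u) $ k $ i = pd i (\<lambda>x. F x $ k) u"
  using assms by (intro jacobian_nth) (auto simp: smooth_map_on_def intro: smooth_on_differentiable)

lemma smooth_map_has_derivative_jacobian:
  assumes "smooth_map_on S F" "u \<in> S"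
  shows "(F has_derivative (*v) (jacobian F (at u))) (at u)"
  by (rule has_derivative_eq_rhs[OF smooth_map_has_derivative[OF assms]])
    (simp add: fun_eq_iff vec_eq_iff matrix_vector_mult_def smooth_map_jacobian[OF assms])

lemma smooth_map_continuous_on: "smooth_map_on S F \<Longrightarrow> continuous_on S F"
  by (intro continuous_at_imp_continuous_on ballI)
    (rule has_derivative_continuous[OF smooth_map_has_derivative])

lemma jacobian_compose:
  assumes "smooth_map_on S F" "u \<in> S" "smooth_map_on S' H" "F u \<in> S'"
  shows "jacobian (\<lambda>x. H (F x)) (at u) = jacobian H (at (F u)) ** jacobian F (at u)"
proof -
  have "((\<lambda>x. H (F x)) has_derivative (\<lambda>h. jacobian H (at (F u)) *v (jacobian F (at u) *v h))) (at u)"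
    using has_derivative_compose[OF smooth_map_has_derivative_jacobian[OF assms(1,2)]
        smooth_map_has_derivative_jacobian[OF assms(3,4)]] .
  then have "frechet_derivative (\<lambda>x. H (F x)) (at u) =
      (\<lambda>h. (jacobian H (at (F u)) ** jacobian F (at u)) *v h)"
    using frechet_derivative_at[symmetric] by (fastforce simp: matrix_vector_mul_assoc)
  then show ?thesis
    by (simp add: jacobian_def[of "\<lambda>x. H (F x)"])
qed

lemma jacobian_cong_open:
  assumes "open S" "u \<in> S" "\<And>x. x \<in> S \<Longrightarrow> F x = H x"
  shows "jacobian F (at u) = jacobian H (at u)"
proof -
  have "(F has_derivative D) (at u) \<longleftrightarrow> (H has_derivative D) (at u)" for D
    using assms has_derivative_transform_within_open[OF _ assms(1,2)] by metis
  then show ?thesis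
    by (simp add: jacobian_def frechet_derivative_def)
qed

lemma jacobian_ident: "jacobian (\<lambda>x. x) (at u) = mat 1"
proof -
  have "frechet_derivative (\<lambda>x. x) (at u) = (\<lambda>h. h)"
    using frechet_derivative_at[OF has_derivative_ident] by simp
  then show ?thesis
    by (simp add: jacobian_def matrix_id_mat_1[unfolded id_def])
qed

section \<open>Symmetry of second derivatives\<close>

lemma has_real_derivative_line:
  fixes f :: "real^'n::finite \<Rightarrow> real"
  assumes "f differentiable (at (a + x *\<^sub>R axis i 1))"
  shows "((\<lambda>x. f (a + x *\<^sub>R axis i 1)) has_real_derivative pd i f (a + x *\<^sub>R axis i 1)) (at x)"
proof -
  have "((\<lambda>x. a + x *\<^sub>R axis i 1) has_derivative (\<lambda>h. h *\<^sub>R axis i 1)) (at x)"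
    by (auto intro!: derivative_eq_intros)
  from has_derivative_compose[OF this has_derivative_pd[OF assms]]
  show ?thesis
    by (simp add: has_field_derivative_def axis_def if_distrib cong: if_cong)
qed

text \<open>Mean value theorem in direction \<open>i\<close>, then first-order expansion of
  \<open>pd i f\<close> at \<open>u\<close>. The second difference is symmetric in \<open>i\<close>
  and \<open>j\<close>, so the estimate with exchanged indices compares it with the other mixed
  derivative; \<open>pd_commute\<close> combines the two.\<close>

lemma second_difference_bound:
  fixes f :: "real^'n::finite \<Rightarrow> real"
  assumes "open S" "u \<in> S" "\<And>x. x \<in> S \<Longrightarrow> f differentiable (at x)"
    "pd i f differentiable (at u)" "e > 0"
  shows "\<exists>d>0. \<forall>t. 0 < t \<and> t < d \<longrightarrow>
    \<bar>f (u + t *\<^sub>R axis i 1 + t *\<^sub>R axis j 1) - f (u + t *\<^sub>R axis i 1) - f (u + t *\<^sub>R axis j 1) + f u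
      - t\<^sup>2 * pd j (pd i f) u\<bar> \<le> e * t\<^sup>2"
proof -
  let ?h = "pd i f"
  let ?D = "\<lambda>y. \<Sum>k\<in>UNIV. pd k ?h u * y $ k"
  obtain r where r: "r > 0" "ball u r \<subseteq> S"
    using assms(1,2) open_contains_ball by blast
  \<comment> \<open>The expansion is used at two points, at distances at most 2t and t from
    \<open>u\<close>; the errors add up to \<open>e * t\<close>. The distance 2t also explains the
    halves of \<open>d\<close> and \<open>r\<close> below.\<close>
  have "e / 3 > 0" using assms(5) by simp
  then obtain d where d: "d > 0"
    "\<And>y. norm (y - u) < d \<Longrightarrow> norm (?h y - ?h u - ?D (y - u)) \<le> e / 3 * norm (y - u)"
    using has_derivative_pd[OF assms(4)] unfolding has_derivative_at_alt by blast
  let ?i = "axis i 1 :: real^'n" and ?j = "axis j 1 :: real^'n"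
  have main: "\<bar>f (u + t *\<^sub>R ?i + t *\<^sub>R ?j) - f (u + t *\<^sub>R ?i) - f (u + t *\<^sub>R ?j) + f u - t\<^sup>2 * pd j ?h u\<bar> \<le> e * t\<^sup>2"
    if t: "0 < t" "t < min (d / 2) (r / 2)" for t
  proof -
    have n1: "norm (x *\<^sub>R ?i) \<le> t" if "0 \<le> x" "x \<le> t" for x
      using that by simp
    have n2: "norm (x *\<^sub>R ?i + t *\<^sub>R ?j) \<le> 2 * t" if "0 \<le> x" "x \<le> t" for x
      using norm_triangle_ineq[of "x *\<^sub>R ?i" "t *\<^sub>R ?j"] that t(1) by simp
    have inS: "u + x *\<^sub>R ?i \<in> S" "(u + t *\<^sub>R ?j) + x *\<^sub>R ?i \<in> S" if "0 \<le> x" "x \<le> t" for x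
    proof -
      have "norm (x *\<^sub>R ?i) < r" "norm (x *\<^sub>R ?i + t *\<^sub>R ?j) < r"
        using n1[OF that] n2[OF that] t r(1) by auto
      moreover have "u + v \<in> ball u r" if "norm v < r" for v
        using that by (simp add: dist_norm)
      ultimately have "u + x *\<^sub>R ?i \<in> ball u r" "(u + t *\<^sub>R ?j) + x *\<^sub>R ?i \<in> ball u r"
        by (simp_all add: add.assoc add.commute[of "t *\<^sub>R ?j"])
      then show "u + x *\<^sub>R ?i \<in> S" "(u + t *\<^sub>R ?j) + x *\<^sub>R ?i \<in> S"
        using r(2) by blast+
    qed
    define q where "q x = f ((u + t *\<^sub>R ?j) + x *\<^sub>R ?i) - f (u + x *\<^sub>R ?i)" for x
    have "(q has_real_derivative (?h ((u + t *\<^sub>R ?j) + x *\<^sub>R ?i) - ?h (u + x *\<^sub>R ?i))) (at x)"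
      if "0 \<le> x" "x \<le> t" for x
      unfolding q_def
      by (intro DERIV_diff has_real_derivative_line assms(3) inS that)
    from MVT2[OF t(1) this]
    obtain z where z: "0 < z" "z < t"
      "q t - q 0 = t * (?h ((u + t *\<^sub>R ?j) + z *\<^sub>R ?i) - ?h (u + z *\<^sub>R ?i))"
      by auto
    let ?y1 = "(u + t *\<^sub>R ?j) + z *\<^sub>R ?i" and ?y2 = "u + z *\<^sub>R ?i"
    have y1: "norm (?y1 - u) \<le> 2 * t" and y2: "norm (?y2 - u) \<le> t"
      using n1[of z] n2[of z] z by (simp_all add: algebra_simps)
    have e1: "\<bar>?h ?y1 - ?h u - ?D (?y1 - u)\<bar> \<le> e / 3 * (2 * t)"
      using order_trans[OF d(2)[of ?y1] mult_left_mono[OF y1, of "e/3"]] y1 t assms(5) by simp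
    have e2: "\<bar>?h ?y2 - ?h u - ?D (?y2 - u)\<bar> \<le> e / 3 * t"
      using order_trans[OF d(2)[of ?y2] mult_left_mono[OF y2, of "e/3"]] y2 t assms(5) by simp
    have "?D (?y1 - u) - ?D (?y2 - u) = (\<Sum>k\<in>UNIV. pd k ?h u * (t *\<^sub>R ?j) $ k)"
      by (simp add: sum_subtractf[symmetric] algebra_simps)
    also have "\<dots> = t * pd j ?h u"
      by (simp add: axis_def if_distrib cong: if_cong)
    finally have "\<bar>?h ?y1 - ?h ?y2 - t * pd j ?h u\<bar> \<le> e * t"
      using e1 e2 by linarith
    then have "t * \<bar>?h ?y1 - ?h ?y2 - t * pd j ?h u\<bar> \<le> t * (e * t)"
      using t(1) mult_left_mono by fastforce
    moreover have "\<bar>t * (?h ?y1 - ?h ?y2 - t * pd j ?h u)\<bar> = t * \<bar>?h ?y1 - ?h ?y2 - t * pd j ?h u\<bar>"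
      using t(1) by (simp add: abs_mult)
    ultimately have "\<bar>t * (?h ?y1 - ?h ?y2 - t * pd j ?h u)\<bar> \<le> e * t\<^sup>2"
      by (simp only: power2_eq_square mult.assoc mult.left_commute)
    moreover have "t * (?h ?y1 - ?h ?y2 - t * pd j ?h u) = q t - q 0 - t\<^sup>2 * pd j ?h u"
      by (simp add: z(3) power2_eq_square algebra_simps)
    ultimately show ?thesis
      by (simp add: q_def algebra_simps)
  qed
  show ?thesis
    by (rule exI[of _ "min (d/2) (r/2)"]) (use main d(1) r(1) in auto)
qed

lemma pd_commute:
  fixes f :: "real^'n::finite \<Rightarrow> real"
  assumes "open S" "u \<in> S" "smooth_on S f"
  shows "pd i (pd j f) u = pd j (pd i f) u"
proof (rule ccontr)
  assume ne: "\<not> ?thesis"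
  let ?a = "pd i (pd j f) u" and ?b = "pd j (pd i f) u"
  \<comment> \<open>Two estimates with error \<open>e * t\<^sup>2\<close> each bound the distance of
    \<open>?a\<close> and \<open>?b\<close> by \<open>2 * e\<close>, which is half of that
    distance.\<close>
  define e where "e = \<bar>?a - ?b\<bar> / 4"
  have e: "e > 0" using ne by (simp add: e_def)
  have df: "f differentiable (at x)" "pd k f differentiable (at x)" if "x \<in> S" for x k
    using smooth_on_differentiable[OF assms(3) that]
      smooth_on_differentiable[OF smooth_on_pd[OF assms(3)] that] by auto
  obtain d1 where d1: "d1 > 0" "\<And>t. 0 < t \<Longrightarrow> t < d1 \<Longrightarrow>
    \<bar>f (u + t *\<^sub>R axis i 1 + t *\<^sub>R axis j 1) - f (u + t *\<^sub>R axis i 1) - f (u + t *\<^sub>R axis j 1) + f u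
      - t\<^sup>2 * ?b\<bar> \<le> e * t\<^sup>2"
    using second_difference_bound[OF assms(1,2) df(1) df(2)[OF assms(2)] e, of i j] by auto
  obtain d2 where d2: "d2 > 0" "\<And>t. 0 < t \<Longrightarrow> t < d2 \<Longrightarrow>
    \<bar>f (u + t *\<^sub>R axis j 1 + t *\<^sub>R axis i 1) - f (u + t *\<^sub>R axis j 1) - f (u + t *\<^sub>R axis i 1) + f u
      - t\<^sup>2 * ?a\<bar> \<le> e * t\<^sup>2"
    using second_difference_bound[OF assms(1,2) df(1) df(2)[OF assms(2)] e, of j i] by auto
  define t where "t = min d1 d2 / 2"
  have t: "0 < t" "t < d1" "t < d2" using d1(1) d2(1) by (auto simp: t_def)
  have "\<bar>t\<^sup>2 * ?a - t\<^sup>2 * ?b\<bar> \<le> 2 * e * t\<^sup>2"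
    using d1(2)[OF t(1,2)] d2(2)[OF t(1,3)] by (simp add: add.assoc add.commute[of "t *\<^sub>R axis j 1"])
  then have "t\<^sup>2 * \<bar>?a - ?b\<bar> \<le> t\<^sup>2 * (2 * e)"
    by (simp add: abs_mult right_diff_distrib[symmetric] mult.commute)
  then have "\<bar>?a - ?b\<bar> \<le> 2 * e"
    using t(1) by simp
  then show False using e by (simp add: e_def)
qed


section \<open>Inverse functions\<close>

lemma matrix_inv_mult:
  fixes M :: "real^'n::finite^'n"
  assumes "invertible M"
  shows "M ** matrix_inv M = mat 1" "matrix_inv M ** M = mat 1"
proof -
  have "M ** matrix_inv M = mat 1 \<and> matrix_inv M ** M = mat 1"
    using assms unfolding invertible_def matrix_inv_def by (rule someI_ex)
  then show "M ** matrix_inv M = mat 1" "matrix_inv M ** M = mat 1" by auto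
qed

text \<open>Cramer's rule. It makes the entries of the inverse matrix quotients of determinants, so
  that they depend smoothly on a smooth matrix.\<close>

lemma matrix_inv_nth:
  fixes M :: "real^'n::finite^'n"
  assumes "invertible M"
  shows "matrix_inv M $ a $ b = det (\<chi> i j. if j = a then axis b 1 $ i else M $ i $ j) / det M"
proof -
  have "M *v (matrix_inv M *v axis b 1) = axis b 1"
    by (simp add: matrix_vector_mul_assoc matrix_inv_mult[OF assms])
  moreover have "det M \<noteq> 0"
    using assms by (simp add: invertible_det_nz)
  ultimately have "matrix_inv M *v axis b 1 = (\<chi> k. det (\<chi> i j. if j = k then axis b 1 $ i else M $ i $ j) / det M)"
    using cramer by blast
  then have "(matrix_inv M *v axis b 1) $ a = det (\<chi> i j. if j = a then axis b 1 $ i else M $ i $ j) / det M"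
    by simp
  then show ?thesis
    by (simp add: matrix_vector_mult_def axis_def if_distrib cong: if_cong)
qed

lemma smooth_on_det:
  fixes M :: "real^'n::finite \<Rightarrow> real^'m::finite^'m"
  assumes "open S" "\<And>i j. smooth_on S (\<lambda>u. M u $ i $ j)"
  shows "smooth_on S (\<lambda>u. det (M u))"
  unfolding det_def
  by (intro smooth_on_sum smooth_on_mult smooth_on_prod smooth_on_const assms)

lemma smooth_on_matrix_inv:
  fixes M :: "real^'n::finite \<Rightarrow> real^'m::finite^'m"
  assumes "open S" "\<And>i j. smooth_on S (\<lambda>u. M u $ i $ j)" "\<And>u. u \<in> S \<Longrightarrow> invertible (M u)"
  shows "smooth_on S (\<lambda>u. matrix_inv (M u) $ a $ b)"
proof (rule smooth_on_cong[OF assms(1)])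
  show "smooth_on S (\<lambda>u. det (\<chi> i j. if j = a then axis b 1 $ i else M u $ i $ j) / det (M u))"
  proof (intro smooth_on_divide smooth_on_det assms(1,2))
    show "smooth_on S (\<lambda>u. (\<chi> i j. if j = a then axis b 1 $ i else M u $ i $ j) $ i $ j)" for i j
      using assms(2) by (cases "j = a") simp_all
    show "det (M u) \<noteq> 0" if "u \<in> S" for u
      using assms(3)[OF that] by (simp add: invertible_det_nz)
  qed
qed (simp add: matrix_inv_nth assms(3))

lemma inj_imp_invertible:
  fixes M :: "real^'n::finite^'n"
  assumes "inj ((*v) M)"
  shows "invertible M"
  using assms matrix_left_invertible_injective invertible_left_inverse by blast

lemma invertible_imp_inj:
  fixes M :: "real^'n::finite^'n"
  assumes "invertible M"
  shows "inj ((*v) M)"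
  using assms matrix_left_invertible_injective invertible_left_inverse by blast

text \<open>The inverse function theorem supplies a differentiable \<open>g\<close> whose derivative
  is the inverse Jacobian of \<open>F\<close> at \<open>g y\<close>. This formula bootstraps: if
  \<open>g\<close> has order \<open>n\<close>, then so do its first derivatives.\<close>

lemma inverse_function_smooth:
  fixes F :: "real^'n::finite \<Rightarrow> real^'n"
  assumes "open U" "smooth_map_on U F" "x0 \<in> U" "invertible (jacobian F (at x0))"
  obtains U' V g where "open U'" "U' \<subseteq> U" "x0 \<in> U'" "open V" "F x0 \<in> V" "homeomorphism U' V F g"
    "smooth_map_on V g"
proof -
  define J where "J x = jacobian F (at x)" for x
  define f' where "f' x = Blinfun ((*v) (J x))" for x
  have f'_apply: "blinfun_apply (f' x) = (*v) (J x)" for x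
    unfolding f'_def by (intro bounded_linear_Blinfun_apply) (simp add: matrix_vector_mul_bounded_linear)
  have der: "(F has_derivative blinfun_apply (f' x)) (at x)" if "x \<in> U" for x
    using smooth_map_has_derivative_jacobian[OF assms(2) that] by (simp add: f'_apply J_def)
  have Jnth: "J x $ k $ i = pd i (\<lambda>x. F x $ k) x" if "x \<in> U" for x k i
    using smooth_map_jacobian[OF assms(2) that] by (simp add: J_def)
  have smJ: "smooth_on U (\<lambda>x. J x $ k $ i)" for k i
    by (rule smooth_on_cong[OF assms(1), of "pd i (\<lambda>x. F x $ k)"])
      (use assms(2) Jnth in \<open>auto simp: smooth_map_on_def\<close>)
  have cont: "continuous_on U f'"
  proof (rule continuous_on_blinfun_componentwise)
    fix b :: "real^'n" assume "b \<in> Basis"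
    have "continuous_on U (\<lambda>x. J x $ k $ i)" for k i
      using smooth_on_differentiable[OF smJ] differentiable_imp_continuous_within continuous_at_imp_continuous_on
      by metis
    then show "continuous_on U (\<lambda>x. blinfun_apply (f' x) b)"
      unfolding f'_apply matrix_vector_mult_def
      by (intro continuous_on_vec_lambda continuous_on_sum continuous_on_mult continuous_on_const)
  qed
  define invf where "invf = Blinfun ((*v) (matrix_inv (J x0)))"
  have invf_apply: "blinfun_apply invf = (*v) (matrix_inv (J x0))"
    unfolding invf_def by (intro bounded_linear_Blinfun_apply) (simp add: matrix_vector_mul_bounded_linear)
  have inv0: "invertible (J x0)" using assms(4) by (simp add: J_def)
  have inv: "invf o\<^sub>L f' x0 = id_blinfun"
    by (rule blinfun_eqI) (simp add: invf_apply f'_apply matrix_vector_mul_assoc matrix_inv_mult[OF inv0])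
  obtain U' V g g' where U': "open U'" "U' \<subseteq> U" "x0 \<in> U'" and V: "open V" "F x0 \<in> V"
    and hom: "homeomorphism U' V F g"
    and g': "\<And>y. y \<in> V \<Longrightarrow> (g has_derivative (g' y)) (at y)"
      "\<And>y. y \<in> V \<Longrightarrow> g' y = inv (blinfun_apply (f'(g y)))"
      "\<And>y. y \<in> V \<Longrightarrow> bij (blinfun_apply (f'(g y)))"
    using inverse_function_theorem[OF assms(1) der cont assms(3) inv] by (metis (no_types, lifting))
  have gU: "g y \<in> U'" if "y \<in> V" for y
    using hom that homeomorphism_def by blast
  have invJ: "invertible (J (g y))" if "y \<in> V" for y
    using g'(3)[OF that] by (intro inj_imp_invertible) (simp add: f'_apply bij_is_inj)
  have g'_eq: "g' y = (*v) (matrix_inv (J (g y)))" if "y \<in> V" for y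
    unfolding g'(2)[OF that] f'_apply
    by (rule inv_equality) (simp_all add: matrix_vector_mul_assoc matrix_inv_mult[OF invJ[OF that]])
  have dg: "((\<lambda>y. g y $ k) has_derivative (\<lambda>h. (matrix_inv (J (g y)) *v h) $ k)) (at y)" if "y \<in> V" for y k
    using bounded_linear.has_derivative[OF bounded_linear_vec_nth g'(1)[OF that], of k] g'_eq[OF that] by simp
  have pg: "matrix_inv (J (g y)) $ k $ j = pd j (\<lambda>y. g y $ k) y" if "y \<in> V" for y k j
    using pd_has_derivative[OF dg[OF that], of j k]
    by (simp add: matrix_vector_mult_def axis_def if_distrib cong: if_cong)
  \<comment> \<open>The induction composes the entries of the inverse Jacobian with
    \<open>g\<close>; \<open>W\<close> is an open set on which they are smooth and into which
    \<open>g\<close> maps.\<close>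
  define W where "W = {x \<in> U'. det (J x) \<noteq> 0}"
  have "continuous_on U' (\<lambda>x. det (J x))"
    using smooth_on_subset[OF smooth_on_det[OF assms(1) smJ] U'(2)] smooth_on_differentiable
      differentiable_imp_continuous_within continuous_at_imp_continuous_on by metis
  then have oW: "open W"
    using continuous_open_preimage[of U' "\<lambda>x. det (J x)" "- {0}"] U'(1)
    by (simp add: W_def vimage_def Int_def open_delete Compl_eq_Diff_UNIV)
  have WU: "W \<subseteq> U"
    using U'(2) by (auto simp: W_def)
  have smI: "smooth_on W (\<lambda>x. matrix_inv (J x) $ k $ j)" for k j
    by (rule smooth_on_matrix_inv[OF oW smooth_on_subset[OF smJ WU]])
      (simp add: W_def invertible_det_nz)
  have gW: "g y \<in> W" if "y \<in> V" for y
    using gU[OF that] invJ[OF that] by (simp add: W_def invertible_det_nz)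
  have d0: "(\<lambda>y. g y $ k) differentiable (at y)" if "y \<in> V" for y k
    using dg[OF that] differentiable_def by blast
  have ckg: "ck n V (\<lambda>y. g y $ k)" for n k
  proof (induction n arbitrary: k)
    case 0
    then show ?case using d0 by simp
  next
    case (Suc n)
    have "ck n V (pd j (\<lambda>y. g y $ k))" for j
    proof (rule ck_cong[OF V(1) pg])
      show "ck n V (\<lambda>y. matrix_inv (J (g y)) $ k $ j)"
        using ck_compose[OF V(1) oW gW Suc] smI smooth_on_iff_ck by blast
    qed
    then show ?case using d0 by simp
  qed
  have "smooth_map_on V g"
    using ckg by (simp add: smooth_map_on_def smooth_on_iff_ck)
  with that U' V hom show ?thesis by blast
qed

text \<open>Dimensions are cardinalities of unrelated index types. Splitting the larger space into
  the smaller one and a line therefore needs an identification of the smaller index type with all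
  indices other than \<open>z\<close>.\<close>

lemma obtain_complementary_index:
  assumes "CARD('m::finite) = Suc CARD('n::finite)"
  obtains e :: "'n::finite \<Rightarrow> 'm::finite" where "inj e" "range e = - {z}"
proof -
  have "card (UNIV :: 'n set) = card (- {z})"
    using assms by (simp add: Compl_eq_Diff_UNIV)
  then obtain e where "bij_betw e (UNIV :: 'n set) (- {z})"
    using finite_same_card_bij[of "UNIV :: 'n set" "- {z}"] by auto
  then show ?thesis
    using that by (auto simp: bij_betw_def)
qed

text \<open>The image of the derivative is a proper subspace; a vector \<open>w\<close> outside it
  thickens \<open>F\<close> to \<open>\<Psi> y = F (q y) + (y $ z) *\<^sub>R w\<close>, a local
  diffeomorphism. Dropping the coordinate \<open>z\<close> after the inverse of
  \<open>\<Psi>\<close> gives the left inverse.\<close>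

lemma immersion_left_inverse:
  fixes F :: "real^'n::finite \<Rightarrow> real^'m::finite"
  assumes "CARD('m) = Suc CARD('n)" "open S" "smooth_map_on S F" "x0 \<in> S"
    "inj ((*v) (jacobian F (at x0)))"
  obtains V L S' where "open V" "F x0 \<in> V" "smooth_map_on V L" "open S'" "x0 \<in> S'" "S' \<subseteq> S"
    "\<And>x. x \<in> S' \<Longrightarrow> F x \<in> V \<and> L (F x) = x"
proof -
  \<comment> \<open>An arbitrary index, taken as the coordinate transverse to the image.\<close>
  fix z :: 'm
  obtain e :: "'n \<Rightarrow> 'm" where e: "inj e" "range e = - {z}"
    using obtain_complementary_index[OF assms(1)] by blast
  let ?J = "jacobian F (at x0)"
  have ez: "e i \<noteq> z" for i using e(2) by auto
  have "dim (range ((*v) ?J)) \<le> CARD('n)"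
    using dim_image_le[of "(*v) ?J" UNIV] by (simp add: matrix_vector_mul_linear dim_UNIV)
  then have "dim (range ((*v) ?J)) < DIM(real^'m)"
    using assms(1) by simp
  then have "span (range ((*v) ?J)) \<noteq> UNIV"
    by (metis dim_UNIV dim_span less_irrefl)
  then obtain w where w: "w \<notin> range ((*v) ?J)"
    by (metis UNIV_I span_superset subsetI subset_antisym top_greatest)
  define q where "q y = (\<chi> i. y $ e i)" for y :: "real^'m"
  define \<iota> where "\<iota> x = (\<chi> j. if j = z then 0 else x $ inv e j)" for x :: "real^'n"
  have q\<iota>: "q (\<iota> x) = x" for x
    by (simp add: q_def \<iota>_def vec_eq_iff ez e(1))
  define \<Psi> where "\<Psi> y = F (q y) + (y $ z) *\<^sub>R w" for y
  define U where "U = q -` S"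
  have linq: "linear q"
    by (rule linearI) (simp_all add: q_def vec_eq_iff)
  have "continuous_on UNIV q"
    using linq by (simp add: linear_continuous_on linear_conv_bounded_linear)
  then have oU: "open U"
    unfolding U_def using assms(2) by (simp add: open_vimage)
  have smq: "smooth_map_on U q"
    by (simp add: smooth_map_on_def q_def)
  have sm\<Psi>: "smooth_map_on U \<Psi>"
    unfolding smooth_map_on_def
  proof
    fix k
    have "smooth_on U (\<lambda>y. F (q y) $ k)"
      by (rule smooth_on_compose[OF oU assms(2) _ smq, of "\<lambda>y. F y $ k"])
        (use assms(3) in \<open>auto simp: U_def smooth_map_on_def\<close>)
    then show "smooth_on U (\<lambda>y. \<Psi> y $ k)"
      by (simp add: \<Psi>_def smooth_on_add smooth_on_mult oU)
  qed
  have x0U: "\<iota> x0 \<in> U" by (simp add: U_def q\<iota> assms(4))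
  have "(\<Psi> has_derivative (\<lambda>h. ?J *v q h + (h $ z) *\<^sub>R w)) (at (\<iota> x0))"
  proof -
    have "(q has_derivative q) (at (\<iota> x0))"
      using linq by (simp add: linear_imp_has_derivative)
    from has_derivative_compose[OF this, of F "(*v) ?J"]
    have "((\<lambda>y. F (q y)) has_derivative (\<lambda>h. ?J *v q h)) (at (\<iota> x0))"
      using smooth_map_has_derivative_jacobian[OF assms(3,4)] by (simp add: q\<iota>)
    moreover have "((\<lambda>y. (y $ z) *\<^sub>R w) has_derivative (\<lambda>h. (h $ z) *\<^sub>R w)) (at (\<iota> x0))"
      by (intro bounded_linear_imp_has_derivative bounded_linear_scaleR_const bounded_linear_vec_nth)
    ultimately show ?thesis
      unfolding \<Psi>_def by (rule has_derivative_add)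
  qed
  then have D: "(*v) (jacobian \<Psi> (at (\<iota> x0))) = (\<lambda>h. ?J *v q h + (h $ z) *\<^sub>R w)"
    using has_derivative_unique[OF smooth_map_has_derivative_jacobian[OF sm\<Psi> x0U]] by blast
  have "inj ((*v) (jacobian \<Psi> (at (\<iota> x0))))"
  proof (rule injI)
    fix h h' assume "jacobian \<Psi> (at (\<iota> x0)) *v h = jacobian \<Psi> (at (\<iota> x0)) *v h'"
    then have eq: "?J *v q h + (h $ z) *\<^sub>R w = ?J *v q h' + (h' $ z) *\<^sub>R w"
      by (simp add: D)
    have "?J *v (q h - q h') = (h' $ z - h $ z) *\<^sub>R w"
      using eq by (simp add: matrix_vector_mult_diff_distrib algebra_simps)
    have hz: "h $ z = h' $ z"
    proof (rule ccontr)
      assume "h $ z \<noteq> h' $ z"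
      then have "w = ?J *v ((1 / (h' $ z - h $ z)) *\<^sub>R (q h - q h'))"
        by (simp add: matrix_vector_mult_scaleR \<open>?J *v (q h - q h') = (h' $ z - h $ z) *\<^sub>R w\<close>)
      then show False using w by blast
    qed
    then have "?J *v q h = ?J *v q h'" using eq by simp
    then have qq: "q h = q h'" using assms(5) by (simp add: inj_def)
    show "h = h'"
    proof (unfold vec_eq_iff, intro allI)
      fix j
      show "h $ j = h' $ j"
      proof (cases "j = z")
        case False
        then obtain i where "j = e i" using e(2) by blast
        then show ?thesis using arg_cong[OF qq, of "\<lambda>v. v $ i"] by (simp add: q_def)
      qed (use hz in simp)
    qed
  qed
  then have "invertible (jacobian \<Psi> (at (\<iota> x0)))" by (rule inj_imp_invertible)
  from inverse_function_smooth[OF oU sm\<Psi> x0U this]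
  obtain U' V g where g: "open U'" "U' \<subseteq> U" "\<iota> x0 \<in> U'" "open V" "\<Psi> (\<iota> x0) \<in> V"
    "homeomorphism U' V \<Psi> g" "smooth_map_on V g" by blast
  have \<Psi>\<iota>: "\<Psi> (\<iota> x) = F x" for x
    by (simp add: \<Psi>_def q\<iota>) (simp add: \<iota>_def)
  have "linear \<iota>"
    by (rule linearI) (simp_all add: \<iota>_def vec_eq_iff)
  then have c\<iota>: "continuous_on UNIV \<iota>"
    by (simp add: linear_continuous_on linear_conv_bounded_linear)
  define S' where "S' = \<iota> -` U'"
  show thesis
  proof (rule that[of V "\<lambda>y. q (g y)" S'])
    show "F x0 \<in> V" using g(5) by (simp add: \<Psi>\<iota>)
    show "smooth_map_on V (\<lambda>y. q (g y))"
      using g(7) by (simp add: smooth_map_on_def q_def)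
    show "open S'"
      unfolding S'_def using open_vimage[OF g(1) c\<iota>] .
    show "S' \<subseteq> S" "x0 \<in> S'"
      using g(2,3) q\<iota> by (auto simp: S'_def U_def)
    show "F x \<in> V \<and> q (g (F x)) = x" if "x \<in> S'" for x
    proof -
      have "\<iota> x \<in> U'" using that by (simp add: S'_def)
      then have "\<Psi> (\<iota> x) \<in> V" "g (\<Psi> (\<iota> x)) = \<iota> x"
        using g(6) by (auto simp: homeomorphism_def)
      then show ?thesis by (simp add: \<Psi>\<iota> q\<iota>)
    qed
  qed (use g in auto)
qed

section \<open>Riemannian geometry in local coordinates\<close>

abbreviation sum_UNIV :: "('i::finite \<Rightarrow> real) \<Rightarrow> real" (binder "\<Oplus>" 10) where
  "sum_UNIV f \<equiv> sum f UNIV"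

lemma sum_swap_UNIV: "(\<Oplus>i. \<Oplus>j. f i j) = (\<Oplus>j. \<Oplus>i. f i j)"
  by (rule sum.swap)

text \<open>Associativity of index contraction, the workhorse of the computations below.\<close>

lemma sum_assoc3: "(\<Oplus>f. A f * (\<Oplus>g. B f g * C g)) = (\<Oplus>g. (\<Oplus>f. A f * B f g) * C g)"
  by (simp add: sum_distrib_left sum_distrib_right mult.assoc sum_swap_UNIV[of "\<lambda>g f. A f * (B f g * C g)"])

lemma sum_delta_mult [simp]:
  fixes X :: "'i::finite \<Rightarrow> real"
  shows "(\<Oplus>e. (if a = e then 1 else 0) * X e) = X a" "(\<Oplus>e. (if e = a then 1 else 0) * X e) = X a"
    "(\<Oplus>e. X e * (if a = e then 1 else 0)) = X a" "(\<Oplus>e. X e * (if e = a then 1 else 0)) = X a"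
  by (simp_all add: if_distrib[of "\<lambda>x. x * _"] if_distrib[of "\<lambda>x. _ * x"] cong: if_cong)

text \<open>Fixing the open set once lets the rules for smoothness and for \<open>pd\<close> act as
  simplification rules without an openness premise.\<close>

locale smooth_region =
  fixes W :: "(real^'n::finite) set"
  assumes open_W: "open W"
begin

abbreviation sm :: "(real^'n \<Rightarrow> real) \<Rightarrow> bool" where "sm \<equiv> smooth_on W"

lemma sm_add [simp]: "sm f \<Longrightarrow> sm g \<Longrightarrow> sm (\<lambda>x. f x + g x)" by (rule smooth_on_add[OF open_W])
lemma sm_mult [simp]: "sm f \<Longrightarrow> sm g \<Longrightarrow> sm (\<lambda>x. f x * g x)" by (rule smooth_on_mult[OF open_W])
lemma sm_minus [simp]: "sm f \<Longrightarrow> sm (\<lambda>x. - f x)" by (rule smooth_on_minus[OF open_W])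
lemma sm_diff [simp]: "sm f \<Longrightarrow> sm g \<Longrightarrow> sm (\<lambda>x. f x - g x)" by (rule smooth_on_diff[OF open_W])
lemma sm_sum [simp]: "(\<And>a. sm (f a)) \<Longrightarrow> sm (\<lambda>x. \<Sum>a\<in>A. f a x)" by (rule smooth_on_sum[OF open_W])
lemma sm_divide [simp]: "sm f \<Longrightarrow> sm (\<lambda>x. f x / k)" by (simp add: divide_inverse)

lemma sm_cong: "(\<And>x. x \<in> W \<Longrightarrow> f x = g x) \<Longrightarrow> sm f \<Longrightarrow> sm g"
  by (rule smooth_on_cong[OF open_W])

lemma pd_cong: "u \<in> W \<Longrightarrow> (\<And>x. x \<in> W \<Longrightarrow> f x = g x) \<Longrightarrow> pd i f u = pd i g u"
  by (rule pd_cong_open[OF open_W])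

context
  fixes u assumes u: "u \<in> W"
begin

lemma pd_add [simp]: "sm f \<Longrightarrow> sm g \<Longrightarrow> pd i (\<lambda>x. f x + g x) u = pd i f u + pd i g u"
  using smooth_on_differentiable u by (intro pd_add') blast+

lemma pd_mult [simp]: "sm f \<Longrightarrow> sm g \<Longrightarrow> pd i (\<lambda>x. f x * g x) u = pd i f u * g u + f u * pd i g u"
  using smooth_on_differentiable u by (intro pd_mult') blast+

lemma pd_minus [simp]: "sm f \<Longrightarrow> pd i (\<lambda>x. - f x) u = - pd i f u"
  using pd_mult[of "\<lambda>x. -1" f] by simp

lemma pd_diff [simp]: "sm f \<Longrightarrow> sm g \<Longrightarrow> pd i (\<lambda>x. f x - g x) u = pd i f u - pd i g u"
  using pd_add[of f "\<lambda>x. - g x"] by simp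

lemma pd_divide [simp]: "sm f \<Longrightarrow> pd i (\<lambda>x. f x / k) u = pd i f u / k"
  using pd_mult[of f "\<lambda>x. inverse k"] by (simp add: divide_inverse)

lemma pd_sum [simp]:
  "finite A \<Longrightarrow> (\<And>a. sm (f a)) \<Longrightarrow> pd i (\<lambda>x. \<Sum>a\<in>A. f a x) u = (\<Sum>a\<in>A. pd i (f a) u)"
  by (induction A rule: finite_induct) simp_all

lemma pd_swap: "sm f \<Longrightarrow> pd i (pd j f) u = pd j (pd i f) u"
  by (rule pd_commute[OF open_W u])

end
end

locale metric_region = smooth_region W for W :: "(real^'n::finite) set" +
  fixes G :: "real^'n \<Rightarrow> real^'n^'n"
  assumes sm_G [simp]: "\<And>a b. smooth_on W (\<lambda>u. G u $ a $ b)"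
    and G_sym: "\<And>u a b. u \<in> W \<Longrightarrow> G u $ a $ b = G u $ b $ a"
    and G_inv: "\<And>u. u \<in> W \<Longrightarrow> invertible (G u)"
begin

text \<open>\<open>Rm a b c d\<close> is \<open>R\<^sub>a\<^sub>b\<^sup>c\<^sub>d\<close> and \<open>Pm a b\<close> is \<open>P\<^sub>b\<^sup>a\<close>; in \<open>\<Gamma>l\<close> and \<open>Rl\<close> all indices are lowered.\<close>

abbreviation gi where "gi \<equiv> ginv G"
abbreviation \<Gamma> where "\<Gamma> \<equiv> christoffel G"
abbreviation \<Gamma>l where "\<Gamma>l d a b u \<equiv> (\<Oplus>e. G u $ d $ e * \<Gamma> e a b u)"
abbreviation Rm where "Rm \<equiv> riemann_up G"
abbreviation Rl where "Rl \<equiv> riemann G"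
abbreviation Ric where "Ric \<equiv> ricci G"
abbreviation P where "P \<equiv> schouten G"
abbreviation J where "J \<equiv> schouten_trace G"
abbreviation Cot where "Cot \<equiv> cotton G"
abbreviation Pm where "Pm a b u \<equiv> (\<Oplus>k. gi a k u * P b k u)"

lemma sm_gi [simp]: "sm (gi a b)"
  unfolding ginv_def[abs_def] by (rule smooth_on_matrix_inv[OF open_W sm_G G_inv])

lemma sm_christoffel [simp]: "sm (\<Gamma> c a b)"
  unfolding christoffel_def[abs_def] by simp

lemma sm_Rm [simp]: "sm (Rm a b c d)"
  unfolding riemann_up_def[abs_def] by simp

lemma sm_Rl [simp]: "sm (Rl a b c d)"
  unfolding riemann_def[abs_def] by simp

lemma sm_Ric [simp]: "sm (Ric a b)"
  unfolding ricci_def[abs_def] by simp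

lemma sm_trace [simp]: "(\<And>a b. sm (T a b)) \<Longrightarrow> sm (trace_wrt G T)"
  unfolding trace_wrt_def[abs_def] by simp

lemma sm_J [simp]: "sm J"
  unfolding schouten_trace_def[abs_def] by simp

lemma sm_P [simp]: "sm (P a b)"
  unfolding schouten_def[abs_def] by simp

lemma sm_cov2 [simp]: "(\<And>a b. sm (T a b)) \<Longrightarrow> sm (cov2 G T c a b)"
  unfolding cov2_def[abs_def] by simp

lemma sm_cov3 [simp]: "(\<And>a b c. sm (T a b c)) \<Longrightarrow> sm (cov3 G T d a b c)"
  unfolding cov3_def[abs_def] by simp

lemma sm_Cot [simp]: "sm (Cot a b c)"
  unfolding cotton_def[abs_def] by simp

context
  fixes u assumes u: "u \<in> W"
begin

lemma gi_G: "(\<Oplus>b. gi a b u * G u $ b $ c) = (if a = c then 1 else 0)"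
  using arg_cong[OF matrix_inv_mult(2)[OF G_inv[OF u]], of "\<lambda>M. M $ a $ c"]
  by (simp add: matrix_matrix_mult_def mat_def ginv_def)

lemma G_gi: "(\<Oplus>b. G u $ a $ b * gi b c u) = (if a = c then 1 else 0)"
  using arg_cong[OF matrix_inv_mult(1)[OF G_inv[OF u]], of "\<lambda>M. M $ a $ c"]
  by (simp add: matrix_matrix_mult_def mat_def ginv_def)

lemma raise_lower: "(\<Oplus>c. gi a c u * (\<Oplus>e. G u $ c $ e * X e)) = X a"
  by (simp add: sum_assoc3 gi_G)

lemma lower_raise: "(\<Oplus>c. G u $ a $ c * (\<Oplus>e. gi c e u * X e)) = X a"
  by (simp add: sum_assoc3 G_gi)

lemma gi_sym: "gi a b u = gi b a u"
proof -
  have "gi a b u = (\<Oplus>c. gi a c u * (\<Oplus>e. gi b e u * G u $ e $ c))"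
    by (simp add: gi_G)
  also have "\<dots> = (\<Oplus>c. gi a c u * (\<Oplus>e. G u $ c $ e * gi b e u))"
    by (simp add: G_sym[OF u] mult.commute)
  also have "\<dots> = gi b a u"
    by (rule raise_lower)
  finally show ?thesis .
qed

lemma pd_G_sym: "pd c (\<lambda>x. G x $ a $ b) u = pd c (\<lambda>x. G x $ b $ a) u"
  by (rule pd_cong[OF u]) (rule G_sym)

lemma christoffel_sym: "\<Gamma> c a b u = \<Gamma> c b a u"
  unfolding christoffel_def by (simp add: pd_G_sym[of _ a b] add.commute)

lemma christoffel_lower:
  "\<Gamma>l d a b u = 1/2 * (pd a (\<lambda>v. G v $ b $ d) u + pd b (\<lambda>v. G v $ a $ d) u - pd d (\<lambda>v. G v $ a $ b) u)"
proof -
  have "\<Gamma>l d a b u = 1/2 * (\<Oplus>e. G u $ d $ e * (\<Oplus>k. gi e k u *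
     (pd a (\<lambda>v. G v $ b $ k) u + pd b (\<lambda>v. G v $ a $ k) u - pd k (\<lambda>v. G v $ a $ b) u)))"
    unfolding christoffel_def by (simp add: sum_distrib_left mult.left_commute)
  then show ?thesis unfolding lower_raise .
qed

lemma pd_G: "pd c (\<lambda>x. G x $ a $ b) u = \<Gamma>l a c b u + \<Gamma>l b c a u"
  unfolding christoffel_lower using pd_G_sym[of c a b] pd_G_sym[of a c b] pd_G_sym[of b a c] by (simp add: field_simps)

lemma metric_compatible: "cov2 G (\<lambda>a b v. G v $ a $ b) c a b u = 0"
  unfolding cov2_def pd_G by (simp add: mult.commute G_sym[OF u])

text \<open>The quantity \<open>D\<close> is \<open>\<nabla>\<^sub>c g\<^sup>a\<^sup>b\<close>.
  Differentiating the constant product of the inverse metric and the metric, and using the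
  derivative of \<open>G\<close>, shows that \<open>D\<close> contracted with \<open>G\<close>
  vanishes; \<open>G\<close> is invertible.\<close>

lemma pd_gi: "pd c (gi a b) u = - (\<Oplus>e. \<Gamma> a c e u * gi e b u) - (\<Oplus>e. \<Gamma> b c e u * gi a e u)"
proof -
  define D where "D b = pd c (gi a b) u + (\<Oplus>e. \<Gamma> a c e u * gi e b u) + (\<Oplus>e. \<Gamma> b c e u * gi a e u)" for b
  have "(\<Oplus>b. D b * G u $ b $ d) = 0" for d
  proof -
    \<comment> \<open>Under a derivative the identity is needed at every point of \<open>W\<close>,
      not only at the fixed \<open>u\<close>; hence the version of \<open>gi_G\<close> exported from
      the context.\<close>
    have "pd c (\<lambda>x. \<Oplus>b. gi a b x * G x $ b $ d) u = pd c (\<lambda>x. if a = d then 1 else 0) u"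
      by (rule pd_cong[OF u]) (rule metric_region.gi_G[OF metric_region_axioms])
    then have "(\<Oplus>b. pd c (gi a b) u * G u $ b $ d) + (\<Oplus>b. gi a b u * pd c (\<lambda>x. G x $ b $ d) u) = 0"
      using u by (simp add: sum.distrib)
    moreover have "(\<Oplus>b. gi a b u * pd c (\<lambda>x. G x $ b $ d) u) =
      (\<Oplus>b. gi a b u * \<Gamma>l b c d u) + (\<Oplus>b. gi a b u * \<Gamma>l d c b u)"
      by (simp add: pd_G distrib_left sum.distrib)
    moreover have "(\<Oplus>b. gi a b u * \<Gamma>l b c d u) = \<Gamma> a c d u"
      by (rule raise_lower)
    moreover have "(\<Oplus>b. (\<Oplus>e. \<Gamma> a c e u * gi e b u) * G u $ b $ d) = \<Gamma> a c d u"
      by (simp add: sum_assoc3[symmetric] gi_G)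
    moreover have "(\<Oplus>b. (\<Oplus>e. \<Gamma> b c e u * gi a e u) * G u $ b $ d) = (\<Oplus>b. gi a b u * \<Gamma>l d c b u)"
      using sum_assoc3[of "\<lambda>b. G u $ b $ d" "\<lambda>b e. \<Gamma> b c e u" "\<lambda>e. gi a e u"]
      by (simp add: mult.commute G_sym[OF u])
    ultimately show ?thesis
      by (simp add: D_def distrib_right sum.distrib)
  qed
  then have "(\<Oplus>d. (\<Oplus>b. D b * G u $ b $ d) * gi d b' u) = 0" for b'
    by simp
  then have "D b' = 0" for b'
    by (simp add: sum_assoc3[symmetric] G_gi)
  then show ?thesis
    using D_def[of b] by simp
qed

text \<open>This is \<open>\<nabla>\<^sub>c (g\<^sup>a\<^sup>b T\<^sub>b) = g\<^sup>a\<^sup>b \<nabla>\<^sub>c T\<^sub>b\<close>; further indices of a tensor enter as parameters of \<open>T\<close>.\<close>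

lemma pd_raise:
  assumes "\<And>b. sm (T b)"
  shows "pd c (\<lambda>x. \<Oplus>b. gi a b x * T b x) u =
    (\<Oplus>b. gi a b u * (pd c (T b) u - (\<Oplus>e. \<Gamma> e c b u * T e u))) - (\<Oplus>e. \<Gamma> a c e u * (\<Oplus>b. gi e b u * T b u))"
proof -
  have 1: "(\<Oplus>b. (\<Oplus>e. \<Gamma> a c e u * gi e b u) * T b u) = (\<Oplus>e. \<Gamma> a c e u * (\<Oplus>b. gi e b u * T b u))"
    by (simp add: sum_assoc3)
  have 2: "(\<Oplus>b. (\<Oplus>e. \<Gamma> b c e u * gi a e u) * T b u) = (\<Oplus>b. gi a b u * (\<Oplus>e. \<Gamma> e c b u * T e u))"
    by (simp add: sum_distrib_left sum_distrib_right mult_ac)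
      (subst sum.swap, simp add: mult_ac)
  show ?thesis
    using u assms
    by (simp add: pd_gi algebra_simps sum.distrib sum_subtractf)
      (use 1 2 in \<open>simp add: algebra_simps\<close>)
qed

lemma trace_cov2:
  assumes "\<And>a b. sm (T a b)"
  shows "(\<Oplus>a. \<Oplus>b. gi a b u * cov2 G T c a b u) = pd c (trace_wrt G T) u"
proof -
  have "pd c (trace_wrt G T) u = (\<Oplus>a. pd c (\<lambda>x. \<Oplus>b. gi a b x * T a b x) u)"
    using u assms unfolding trace_wrt_def[abs_def] by simp
  also have "\<dots> = (\<Oplus>a. (\<Oplus>b. gi a b u * (pd c (T a b) u - (\<Oplus>e. \<Gamma> e c b u * T a e u))))
      - (\<Oplus>a. \<Oplus>e. \<Gamma> a c e u * (\<Oplus>b. gi e b u * T a b u))"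
    using assms by (simp add: pd_raise sum_subtractf)
  also have "(\<Oplus>a. \<Oplus>e. \<Gamma> a c e u * (\<Oplus>b. gi e b u * T a b u)) =
      (\<Oplus>a. \<Oplus>b. gi a b u * (\<Oplus>e. \<Gamma> e c a u * T e b u))"
  proof -
    have "(\<Oplus>a. \<Oplus>e. \<Gamma> a c e u * (\<Oplus>b. gi e b u * T a b u)) = (\<Oplus>e. \<Oplus>a. \<Gamma> a c e u * (\<Oplus>b. gi e b u * T a b u))"
      by (rule sum.swap)
    also have "\<dots> = (\<Oplus>a. \<Oplus>e. \<Oplus>b. gi a b u * (\<Gamma> e c a u * T e b u))"
      by (simp add: sum_distrib_left mult_ac)
    also have "\<dots> = (\<Oplus>a. \<Oplus>b. \<Oplus>e. gi a b u * (\<Gamma> e c a u * T e b u))"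
      by (subst sum.swap) rule
    finally show ?thesis by (simp add: sum_distrib_left)
  qed
  finally show ?thesis
    by (simp add: cov2_def right_diff_distrib sum_subtractf)
qed

text \<open>For a vector field \<open>V\<close> with \<open>\<nabla>\<^sub>b V\<^sup>c = Z b c\<close>.\<close>

lemma ricci_identity:
  assumes V: "\<And>c. sm (V c)" and Z: "\<And>b c. sm (Z b c)"
    and dV: "\<And>x b c. x \<in> W \<Longrightarrow> pd b (V c) x = Z b c x - (\<Oplus>e. \<Gamma> c b e x * V e x)"
  shows "(\<Oplus>d. Rm a b c d u * V d u) =
    (pd a (Z b c) u + (\<Oplus>e. \<Gamma> c a e u * Z b e u)) - (pd b (Z a c) u + (\<Oplus>e. \<Gamma> c b e u * Z a e u))"
proof -
  have dd: "pd a (pd b (V c)) u = pd a (Z b c) u - (\<Oplus>e. pd a (\<Gamma> c b e) u * V e u)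
      - (\<Oplus>e. \<Gamma> c b e u * Z a e u) + (\<Oplus>f. (\<Oplus>e. \<Gamma> c b e u * \<Gamma> e a f u) * V f u)" for a b
  proof -
    have "pd a (pd b (V c)) u = pd a (\<lambda>x. Z b c x - (\<Oplus>e. \<Gamma> c b e x * V e x)) u"
      by (rule pd_cong[OF u dV])
    also have "\<dots> = pd a (Z b c) u - (\<Oplus>e. pd a (\<Gamma> c b e) u * V e u)
      - (\<Oplus>e. \<Gamma> c b e u * Z a e u) + (\<Oplus>e. \<Gamma> c b e u * (\<Oplus>f. \<Gamma> e a f u * V f u))"
      using u by (simp add: V Z dV[OF u] sum.distrib sum_subtractf algebra_simps)
    finally show ?thesis by (simp add: sum_assoc3)
  qed
  have "pd a (pd b (V c)) u = pd b (pd a (V c)) u"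
    by (rule pd_swap[OF u V])
  then show ?thesis
    unfolding dd riemann_up_def by (simp add: algebra_simps sum.distrib sum_subtractf)
qed

text \<open>In this form the pair symmetry is visible: the second derivatives of \<open>G\<close>
  are symmetric once partial derivatives commute, and the quadratic part is symmetric by
  \<open>christoffel_form_sym\<close>.\<close>

lemma riemann_lower_formula:
  "Rl a b c d u = 1/2 * (pd a (pd d (\<lambda>v. G v $ b $ c)) u - pd a (pd c (\<lambda>v. G v $ b $ d)) u
      - pd b (pd d (\<lambda>v. G v $ a $ c)) u + pd b (pd c (\<lambda>v. G v $ a $ d)) u)
    - (\<Oplus>e. \<Gamma>l e a c u * \<Gamma> e b d u) + (\<Oplus>e. \<Gamma>l e b c u * \<Gamma> e a d u)"
proof -
  have 1: "(\<Oplus>e. G u $ c $ e * pd a (\<Gamma> e b d) u) = pd a (\<Gamma>l c b d) u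
      - (\<Oplus>e. \<Gamma>l c a e u * \<Gamma> e b d u) - (\<Oplus>e. \<Gamma>l e a c u * \<Gamma> e b d u)" for a b
    using u by (simp add: pd_G distrib_right sum.distrib)
  have 2: "pd a (\<Gamma>l c b d) u = 1/2 * (pd a (pd b (\<lambda>v. G v $ d $ c)) u + pd a (pd d (\<lambda>v. G v $ b $ c)) u
     - pd a (pd c (\<lambda>v. G v $ b $ d)) u)" for a b
  proof -
    have "pd a (\<Gamma>l c b d) u = pd a (\<lambda>x. 1/2 * (pd b (\<lambda>v. G v $ d $ c) x + pd d (\<lambda>v. G v $ b $ c) x
        - pd c (\<lambda>v. G v $ b $ d) x)) u"
      by (rule pd_cong[OF u]) (rule metric_region.christoffel_lower[OF metric_region_axioms])
    then show ?thesis using u by simp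
  qed
  have 3: "(\<Oplus>e. G u $ c $ e * (\<Oplus>k. \<Gamma> e a k u * \<Gamma> k b d u)) = (\<Oplus>k. \<Gamma>l c a k u * \<Gamma> k b d u)" for a b
    by (rule sum_assoc3)
  have "Rl a b c d u = (\<Oplus>e. G u $ c $ e * pd a (\<Gamma> e b d) u) - (\<Oplus>e. G u $ c $ e * pd b (\<Gamma> e a d) u)
     + (\<Oplus>e. G u $ c $ e * (\<Oplus>k. \<Gamma> e a k u * \<Gamma> k b d u)) - (\<Oplus>e. G u $ c $ e * (\<Oplus>k. \<Gamma> e b k u * \<Gamma> k a d u))"
    unfolding riemann_def riemann_up_def by (simp add: algebra_simps sum.distrib sum_subtractf)
  then show ?thesis
    unfolding 1 2 3 using pd_swap[OF u sm_G[of d c], of a b] by (simp add: algebra_simps)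
qed

lemma christoffel_form_sym: "(\<Oplus>e. \<Gamma>l e a b u * \<Gamma> e c d u) = (\<Oplus>e. \<Gamma>l e c d u * \<Gamma> e a b u)"
proof -
  have "(\<Oplus>e. \<Gamma>l e a b u * \<Gamma> e c d u) = (\<Oplus>e. \<Gamma> e c d u * (\<Oplus>k. G u $ e $ k * \<Gamma> k a b u))"
    by (simp add: mult.commute)
  also have "\<dots> = (\<Oplus>k. (\<Oplus>e. \<Gamma> e c d u * G u $ e $ k) * \<Gamma> k a b u)"
    by (rule sum_assoc3)
  finally show ?thesis by (simp add: G_sym[OF u] mult.commute)
qed

lemma pd_pd_G_sym: "pd a (pd c (\<lambda>x. G x $ d $ e)) u = pd a (pd c (\<lambda>x. G x $ e $ d)) u"
  by (rule pd_cong[OF u]) (rule metric_region.pd_G_sym[OF metric_region_axioms])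

lemma Rl_pair_sym: "Rl a b c d u = Rl c d a b u"
  unfolding riemann_lower_formula
  using christoffel_form_sym[of a d b c] christoffel_sym
    pd_swap[OF u sm_G[of b c], of a d] pd_swap[OF u sm_G[of b d], of a c]
    pd_swap[OF u sm_G[of a c], of b d] pd_swap[OF u sm_G[of a d], of b c]
  by (simp add: pd_pd_G_sym[of _ _ b] pd_pd_G_sym[of _ _ a])

lemma Rl_antisym1: "Rl a b c d u = - Rl b a c d u"
  unfolding riemann_def riemann_up_def by (simp add: sum_negf[symmetric] algebra_simps)

lemma Rl_antisym2: "Rl a b c d u = - Rl a b d c u"
  using Rl_pair_sym[of a b c d] Rl_pair_sym[of a b d c] Rl_antisym1[of c d a b] by simp

lemma Rm_antisym: "Rm a b c d u = - Rm b a c d u"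
  unfolding riemann_up_def by simp

lemma Rm_raise: "Rm a b c d u = (\<Oplus>k. gi c k u * Rl a b k d u)"
  unfolding riemann_def by (rule raise_lower[symmetric])

lemma Ric_sym: "Ric a b u = Ric b a u"
proof -
  have "Ric a b u = (\<Oplus>c. \<Oplus>k. gi c k u * Rl c a k b u)" for a b
    unfolding ricci_def Rm_raise ..
  moreover have "(\<Oplus>c. \<Oplus>k. gi c k u * Rl c a k b u) = (\<Oplus>c. \<Oplus>k. gi c k u * Rl c b k a u)"
    by (subst sum.swap) (simp add: gi_sym Rl_pair_sym[of _ a _ b])
  ultimately show ?thesis by simp
qed

lemma P_sym: "P a b u = P b a u"
  unfolding schouten_def using Ric_sym[of a b] G_sym[OF u, of a b] by simp

lemma Cot_cyclic: "Cot a b c u + Cot b c a u + Cot c a b u = 0"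
proof -
  have "cov2 G P a b c u = cov2 G P a c b u" for a b c
  proof -
    have "pd a (P b c) u = pd a (P c b) u"
      by (rule pd_cong[OF u]) (rule metric_region.P_sym[OF metric_region_axioms])
    then show ?thesis unfolding cov2_def using P_sym[of _ c] P_sym[of b] by simp
  qed
  from this[of a b c] this[of b c a] this[of c a b] show ?thesis
    unfolding cotton_def by simp
qed

lemma Cot_antisym: "Cot a b c u = - Cot a c b u"
  unfolding cotton_def by simp

end
end

text \<open>Matrix product of connection and curvature matrices in the two last indices of the
  curvature. Kept opaque, it reduces the second Bianchi identity to noncommutative algebra with
  \<open>fun_mult_assoc\<close>.\<close>

definition fun_mult :: "('i::finite \<Rightarrow> 'i \<Rightarrow> real) \<Rightarrow> ('i \<Rightarrow> 'i \<Rightarrow> real) \<Rightarrow> 'i \<Rightarrow> 'i \<Rightarrow> real" where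
  "fun_mult X Y c d = (\<Oplus>f. X c f * Y f d)"

lemma fun_mult_assoc: "fun_mult X (fun_mult Y Z) c d = fun_mult (fun_mult X Y) Z c d"
  by (simp add: fun_mult_def sum_assoc3)

lemma sum_rotate: "(\<Oplus>i. \<Oplus>j. \<Oplus>k. f i j k) = (\<Oplus>k. \<Oplus>i. \<Oplus>j. f i j k)"
proof -
  have "(\<Oplus>i. \<Oplus>j. \<Oplus>k. f i j k) = (\<Oplus>i. \<Oplus>k. \<Oplus>j. f i j k)"
    by (intro sum.cong refl sum.swap)
  also have "\<dots> = (\<Oplus>k. \<Oplus>i. \<Oplus>j. f i j k)"
    by (rule sum.swap)
  finally show ?thesis .
qed

lemma sum_pull: "(\<Oplus>d. A d * (\<Oplus>f. C f * B f d)) = (\<Oplus>f. C f * (\<Oplus>d. A d * B f d))"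
  unfolding sum_distrib_left by (subst sum.swap) (simp add: mult.left_commute)

section \<open>Bianchi identities and their traces\<close>

context metric_region
begin

lemma Rm_antisym_fun: "Rm b a c d = (\<lambda>x. - Rm a b c d x)"
  by (rule ext) (simp add: riemann_up_def)

context
  fixes u assumes u: "u \<in> W"
begin

text \<open>The identity dF + [A, F] = 0 for the curvature F = dA + A A of the connection matrices.
  \<open>D\<close> leaves out the Christoffel terms of the form indices \<open>a\<close> and
  \<open>b\<close>: they cancel in the cyclic sum by symmetry of the connection.\<close>

lemma second_bianchi:
  fixes c d
  defines "D \<equiv> \<lambda>e a b. pd e (Rm a b c d) u + (\<Oplus>f. \<Gamma> c e f u * Rm a b f d u) - (\<Oplus>f. Rm a b c f u * \<Gamma> f e d u)"
  shows "D e a b + D a b e + D b e a = 0"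
proof -
  define A where "A i c f = \<Gamma> c i f u" for i c f
  define B where "B i j c f = pd i (\<Gamma> c j f) u" for i j c f
  have D_eq: "D e a b = pd e (pd a (\<Gamma> c b d)) u - pd e (pd b (\<Gamma> c a d)) u
    + fun_mult (B e a) (A b) c d + fun_mult (A a) (B e b) c d
    - fun_mult (B e b) (A a) c d - fun_mult (A b) (B e a) c d
    + fun_mult (A e) (B a b) c d - fun_mult (A e) (B b a) c d
    + fun_mult (A e) (fun_mult (A a) (A b)) c d - fun_mult (A e) (fun_mult (A b) (A a)) c d
    - fun_mult (B a b) (A e) c d + fun_mult (B b a) (A e) c d
    - fun_mult (fun_mult (A a) (A b)) (A e) c d + fun_mult (fun_mult (A b) (A a)) (A e) c d" for e a b
    using u unfolding D_def riemann_up_def[abs_def] fun_mult_def A_def B_def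
    by (simp add: algebra_simps sum.distrib sum_subtractf)
  have s: "pd i (pd j (\<Gamma> c k d)) u = pd j (pd i (\<Gamma> c k d)) u" for i j k
    by (rule pd_swap[OF u]) simp
  show ?thesis
    unfolding D_eq fun_mult_assoc using s[of e a b] s[of e b a] s[of a b e] by simp
qed

text \<open>\<open>second_bianchi\<close> traced over \<open>e\<close> and the upper index. The
  Christoffel terms of \<open>a\<close> and \<open>b\<close>, absent there, come out of the two
  other cyclic terms through the skew-symmetry of the curvature; these are the steps
  \<open>1\<close> and \<open>2\<close>.\<close>

lemma divergence_Rm:
  "(\<Oplus>e. pd e (Rm a b e d) u + (\<Oplus>f. \<Gamma> e e f u * Rm a b f d u) - (\<Oplus>f. \<Gamma> f e d u * Rm a b e f u)
      - (\<Oplus>f. \<Gamma> f e a u * Rm f b e d u) - (\<Oplus>f. \<Gamma> f e b u * Rm a f e d u))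
    = cov2 G Ric a b d u - cov2 G Ric b a d u"
proof -
  have pd_Ric: "(\<Oplus>e. pd a (Rm b e e d) u) = - pd a (Ric b d) u" "(\<Oplus>e. pd a (Rm e b e d) u) = pd a (Ric b d) u" for a b
    using u unfolding ricci_def[abs_def] Rm_antisym_fun[of b] by (simp_all add: sum_negf)
  have Ric_\<Gamma>: "(\<Oplus>e. \<Oplus>f. Rm e b e f u * \<Gamma> f a d u) = (\<Oplus>f. \<Gamma> f a d u * Ric b f u)" for a b
    unfolding ricci_def by (subst sum.swap) (simp add: sum_distrib_left mult.commute)
  have 0: "(\<Oplus>e. pd e (Rm a b e d) u + (\<Oplus>f. \<Gamma> e e f u * Rm a b f d u) - (\<Oplus>f. Rm a b e f u * \<Gamma> f e d u))
    + (\<Oplus>e. pd a (Rm b e e d) u + (\<Oplus>f. \<Gamma> e a f u * Rm b e f d u) - (\<Oplus>f. Rm b e e f u * \<Gamma> f a d u))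
    + (\<Oplus>e. pd b (Rm e a e d) u + (\<Oplus>f. \<Gamma> e b f u * Rm e a f d u) - (\<Oplus>f. Rm e a e f u * \<Gamma> f b d u)) = 0"
    unfolding sum.distrib[symmetric] by (intro sum.neutral ballI second_bianchi)
  have 1: "(\<Oplus>e. \<Oplus>f. \<Gamma> e a f u * Rm b e f d u) = - (\<Oplus>e. \<Oplus>f. \<Gamma> f e a u * Rm f b e d u)" for a b
  proof -
    have "(\<Oplus>e. \<Oplus>f. \<Gamma> e a f u * Rm b e f d u) = (\<Oplus>f. \<Oplus>e. \<Gamma> e a f u * Rm b e f d u)"
      by (rule sum.swap)
    also have "\<dots> = - (\<Oplus>e. \<Oplus>f. \<Gamma> f e a u * Rm f b e d u)"
      by (simp add: sum_negf[symmetric] christoffel_sym[OF u, of _ a] Rm_antisym[OF u, of b])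
    finally show ?thesis .
  qed
  have 2: "(\<Oplus>e. \<Oplus>f. \<Gamma> e b f u * Rm e a f d u) = - (\<Oplus>e. \<Oplus>f. \<Gamma> f e b u * Rm a f e d u)"
  proof -
    have "(\<Oplus>e. \<Oplus>f. \<Gamma> e b f u * Rm e a f d u) = (\<Oplus>f. \<Oplus>e. \<Gamma> e b f u * Rm e a f d u)"
      by (rule sum.swap)
    also have "\<dots> = - (\<Oplus>e. \<Oplus>f. \<Gamma> f e b u * Rm a f e d u)"
      by (simp add: sum_negf[symmetric] christoffel_sym[OF u, of _ b] Rm_antisym[OF u, of _ a])
    finally show ?thesis .
  qed
  have 3: "(\<Oplus>e. \<Oplus>f. Rm b e e f u * \<Gamma> f a d u) = - (\<Oplus>f. \<Gamma> f a d u * Ric b f u)"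
    using Ric_\<Gamma>[of b a] by (simp add: Rm_antisym[OF u, of b] sum_negf)
  have 4: "(\<Oplus>e. \<Oplus>f. Rm a b e f u * \<Gamma> f e d u) = (\<Oplus>e. \<Oplus>f. \<Gamma> f e d u * Rm a b e f u)"
    by (simp add: mult.commute)
  have 5: "(\<Oplus>f. \<Gamma> f a b u * X f) = (\<Oplus>f. \<Gamma> f b a u * X f)" for X
    by (simp add: christoffel_sym[OF u, of _ a])
  show ?thesis
    using 0 unfolding cov2_def sum.distrib sum_subtractf 1[of a b] 2 3 4 pd_Ric Ric_\<Gamma> 5[of "\<lambda>f. Ric f d u"]
    by simp
qed

lemma Rm_contract: "(\<Oplus>b. \<Oplus>d. gi b d u * Rm a b e d u) = (\<Oplus>k. gi e k u * Ric a k u)"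
proof -
  have "Rl a b k d u = Rl b a d k u" for b k d
    using Rl_antisym1[OF u, of a b k d] Rl_antisym2[OF u, of b a k d] by simp
  then have "(\<Oplus>b. \<Oplus>d. gi b d u * Rm a b e d u) = (\<Oplus>b. \<Oplus>d. \<Oplus>k. gi e k u * (gi b d u * Rl b a d k u))"
    by (simp add: Rm_raise[OF u, of a _ e] sum_distrib_left mult.left_commute)
  also have "\<dots> = (\<Oplus>k. \<Oplus>b. \<Oplus>d. gi e k u * (gi b d u * Rl b a d k u))"
    by (rule sum_rotate)
  also have "\<dots> = (\<Oplus>k. gi e k u * Ric a k u)"
    by (simp add: ricci_def Rm_raise[OF u] sum_distrib_left)
  finally show ?thesis .
qed

end

context
  fixes u assumes u: "u \<in> W"
begin

text \<open>Trace of \<open>divergence_Rm\<close> over \<open>b\<close> and \<open>d\<close>. On the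
  left it becomes the divergence of Ricci; on the right it is the gradient of the scalar curvature
  minus the same divergence, hence the factor 2.\<close>

lemma contracted_bianchi: "2 * (\<Oplus>e. \<Oplus>k. gi e k u * cov2 G Ric e a k u) = pd a (trace_wrt G Ric) u"
proof -
  define Ru where "Ru b e c = (\<lambda>x. \<Oplus>d. gi c d x * Rm a b e d x)" for b e c
  define Rc where "Rc a e = (\<lambda>x. \<Oplus>k. gi e k x * Ric a k x)" for a e
  have smRu: "sm (Ru b e c)" for b e c by (simp add: Ru_def)
  have Rc: "(\<Oplus>b. Ru b e b x) = Rc a e x" if "x \<in> W" for e x
    using Rm_contract[OF that, of a e] by (simp add: Ru_def Rc_def)
  have pd_Rc: "(\<Oplus>b. pd e (Ru b e b) u) = pd e (Rc a e) u" for e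
  proof -
    have "pd e (Rc a e) u = pd e (\<lambda>x. \<Oplus>b. Ru b e b x) u"
      by (rule pd_cong[OF u]) (simp add: Rc)
    then show ?thesis using u smRu by simp
  qed
  define X where "X e b d = pd e (Rm a b e d) u + (\<Oplus>f. \<Gamma> e e f u * Rm a b f d u) - (\<Oplus>f. \<Gamma> f e d u * Rm a b e f u)
      - (\<Oplus>f. \<Gamma> f e a u * Rm f b e d u) - (\<Oplus>f. \<Gamma> f e b u * Rm a f e d u)" for e b d
  have inner: "(\<Oplus>b. \<Oplus>d. gi b d u * X e b d) =
    pd e (Rc a e) u + (\<Oplus>f. \<Gamma> e e f u * Rc a f u) - (\<Oplus>f. \<Gamma> f e a u * Rc f e u)" for e
  proof -
    have "(\<Oplus>b. \<Oplus>d. gi b d u * X e b d) =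
        (\<Oplus>b. \<Oplus>d. gi b d u * (pd e (Rm a b e d) u - (\<Oplus>f. \<Gamma> f e d u * Rm a b e f u)))
      + (\<Oplus>b. \<Oplus>d. gi b d u * (\<Oplus>f. \<Gamma> e e f u * Rm a b f d u))
      - (\<Oplus>b. \<Oplus>d. gi b d u * (\<Oplus>f. \<Gamma> f e a u * Rm f b e d u))
      - (\<Oplus>b. \<Oplus>d. gi b d u * (\<Oplus>f. \<Gamma> f e b u * Rm a f e d u))"
      unfolding X_def by (simp add: algebra_simps sum.distrib sum_subtractf)
    moreover have "(\<Oplus>b. \<Oplus>d. gi b d u * (pd e (Rm a b e d) u - (\<Oplus>f. \<Gamma> f e d u * Rm a b e f u))) =
      pd e (Rc a e) u + (\<Oplus>b. \<Oplus>f. \<Gamma> b e f u * Ru b e f u)"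
    proof -
      have "(\<Oplus>d. gi b d u * (pd e (Rm a b e d) u - (\<Oplus>f. \<Gamma> f e d u * Rm a b e f u))) =
        pd e (Ru b e b) u + (\<Oplus>f. \<Gamma> b e f u * Ru b e f u)" for b
        using pd_raise[OF u, of "Rm a b e" e b] by (simp add: Ru_def)
      then show ?thesis unfolding pd_Rc[symmetric] by (simp add: sum.distrib)
    qed
    moreover have pull: "(\<Oplus>b. \<Oplus>d. gi b d u * (\<Oplus>f. C f * B f b d)) = (\<Oplus>f. C f * (\<Oplus>b. \<Oplus>d. gi b d u * B f b d))" for C B
    proof -
      have "(\<Oplus>b. \<Oplus>d. gi b d u * (\<Oplus>f. C f * B f b d)) = (\<Oplus>b. \<Oplus>f. C f * (\<Oplus>d. gi b d u * B f b d))"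
        by (intro sum.cong refl sum_pull)
      also have "\<dots> = (\<Oplus>f. \<Oplus>b. C f * (\<Oplus>d. gi b d u * B f b d))"
        by (rule sum.swap)
      finally show ?thesis by (simp only: sum_distrib_left)
    qed
    moreover have "(\<Oplus>b. \<Oplus>d. gi b d u * (\<Oplus>f. \<Gamma> e e f u * Rm a b f d u)) = (\<Oplus>f. \<Gamma> e e f u * Rc a f u)"
      unfolding Rc_def Rm_contract[OF u, symmetric] by (rule pull)
    moreover have "(\<Oplus>b. \<Oplus>d. gi b d u * (\<Oplus>f. \<Gamma> f e a u * Rm f b e d u)) = (\<Oplus>f. \<Gamma> f e a u * Rc f e u)"
      unfolding Rc_def Rm_contract[OF u, symmetric] by (rule pull)
    moreover have "(\<Oplus>b. \<Oplus>d. gi b d u * (\<Oplus>f. \<Gamma> f e b u * Rm a f e d u)) = (\<Oplus>b. \<Oplus>f. \<Gamma> b e f u * Ru b e f u)"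
    proof -
      have "(\<Oplus>b. \<Oplus>d. gi b d u * (\<Oplus>f. \<Gamma> f e b u * Rm a f e d u)) =
          (\<Oplus>b. \<Oplus>f. \<Gamma> f e b u * (\<Oplus>d. gi b d u * Rm a f e d u))"
        by (intro sum.cong refl sum_pull)
      also have "\<dots> = (\<Oplus>f. \<Oplus>b. \<Gamma> f e b u * (\<Oplus>d. gi b d u * Rm a f e d u))"
        by (rule sum.swap)
      finally show ?thesis by (simp only: Ru_def)
    qed
    ultimately show ?thesis by simp
  qed
  have "(\<Oplus>b. \<Oplus>d. gi b d u * (\<Oplus>e. X e b d)) = (\<Oplus>e. \<Oplus>b. \<Oplus>d. gi b d u * X e b d)"
    unfolding sum_distrib_left by (rule sum_rotate)
  also have "\<dots> = (\<Oplus>e. \<Oplus>k. gi e k u * cov2 G Ric e a k u)"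
  proof (rule sum.cong[OF refl])
    fix e
    show "(\<Oplus>b. \<Oplus>d. gi b d u * X e b d) = (\<Oplus>k. gi e k u * cov2 G Ric e a k u)"
    proof -
      have "pd e (Rc a e) u = (\<Oplus>k. gi e k u * (pd e (Ric a k) u - (\<Oplus>f. \<Gamma> f e k u * Ric a f u)))
          - (\<Oplus>f. \<Gamma> e e f u * Rc a f u)"
        unfolding Rc_def by (rule pd_raise[OF u sm_Ric])
      moreover have "(\<Oplus>f. \<Gamma> f e a u * Rc f e u) = (\<Oplus>k. gi e k u * (\<Oplus>f. \<Gamma> f e a u * Ric f k u))"
        unfolding Rc_def by (rule sum_pull[symmetric])
      ultimately show ?thesis
        unfolding inner cov2_def by (simp add: right_diff_distrib sum_subtractf)
    qed
  qed
  also have "(\<Oplus>b. \<Oplus>d. gi b d u * (\<Oplus>e. X e b d)) =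
      (\<Oplus>b. \<Oplus>d. gi b d u * cov2 G Ric a b d u) - (\<Oplus>b. \<Oplus>d. gi b d u * cov2 G Ric b a d u)"
    unfolding X_def divergence_Rm[OF u] by (simp add: right_diff_distrib sum_subtractf)
  finally show ?thesis
    using trace_cov2[OF u, of Ric a] by simp
qed

text \<open>The core is \<open>div_P\<close>: inserting the Schouten form of Ricci into
  \<open>contracted_bianchi\<close> leaves (d - 2)(div P - dJ) = 0. \<open>trace_Cot\<close> is then
  the difference of div P and the gradient of tr P.\<close>

lemma schouten_bianchi:
  assumes "CARD('n) \<ge> 3"
  shows Ric_P: "Ric a b u = (real CARD('n) - 2) * P a b u + J u * G u $ a $ b"
    and trace_P: "trace_wrt G P u = J u"
    and cov_Ric: "cov2 G Ric c a b u = (real CARD('n) - 2) * cov2 G P c a b u + pd c J u * G u $ a $ b"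
    and div_P: "(\<Oplus>e. \<Oplus>k. gi e k u * cov2 G P e a k u) = pd a J u"
    and trace_Cot: "(\<Oplus>a. \<Oplus>k. gi a k u * Cot k a b u) = 0"
proof -
  have RP: "Ric a b = (\<lambda>x. (real CARD('n) - 2) * P a b x + J x * G x $ a $ b)" for a b
    by (rule ext) (rule ricci_eq_schouten[OF assms])
  show "Ric a b u = (real CARD('n) - 2) * P a b u + J u * G u $ a $ b"
    by (rule ricci_eq_schouten[OF assms])
  have tP: "trace_wrt G P x = J x" if "x \<in> W" for x
    by (rule schouten_trace_eq[where G = G, OF assms G_inv[OF that]]) (simp add: transpose_def vec_eq_iff G_sym[OF that])
  then show "trace_wrt G P u = J u" using u .
  have cR: "cov2 G Ric c a b u = (real CARD('n) - 2) * cov2 G P c a b u + pd c J u * G u $ a $ b" for c a b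
  proof -
    have "cov2 G Ric c a b u = (real CARD('n) - 2) * cov2 G P c a b u + pd c J u * G u $ a $ b
      + J u * cov2 G (\<lambda>a b v. G v $ a $ b) c a b u"
      using u unfolding cov2_def RP by (simp add: algebra_simps sum.distrib sum_distrib_left sum_subtractf)
    then show ?thesis by (simp add: metric_compatible[OF u])
  qed
  then show "cov2 G Ric c a b u = (real CARD('n) - 2) * cov2 G P c a b u + pd c J u * G u $ a $ b" .
  have "trace_wrt G Ric = (\<lambda>x. 2 * (real CARD('n) - 1) * J x)"
    by (rule ext) (use assms in \<open>simp add: schouten_trace_def\<close>)
  then have tR: "pd a (trace_wrt G Ric) u = 2 * (real CARD('n) - 1) * pd a J u" for a
    using u by (simp add: mult.assoc)
  have "(\<Oplus>e. \<Oplus>k. gi e k u * cov2 G Ric e a k u) =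
      (real CARD('n) - 2) * (\<Oplus>e. \<Oplus>k. gi e k u * cov2 G P e a k u) + (\<Oplus>e. pd e J u * (\<Oplus>k. gi e k u * G u $ k $ a))" for a
  proof -
    have "gi e k u * cov2 G Ric e a k u = (real CARD('n) - 2) * (gi e k u * cov2 G P e a k u)
        + pd e J u * (gi e k u * G u $ k $ a)" for e k
      unfolding cR using G_sym[OF u, of a k] by (simp add: algebra_simps)
    then show ?thesis
      by (simp only: sum.distrib sum_distrib_left[symmetric])
  qed
  then have h2: "2 * ((real CARD('n) - 2) * (\<Oplus>e. \<Oplus>k. gi e k u * cov2 G P e a k u) + pd a J u) = 2 * (real CARD('n) - 1) * pd a J u" for a
    using contracted_bianchi[of a] unfolding tR gi_G[OF u] sum_delta_mult by simp
  have "(real CARD('n) - 2) * ((\<Oplus>e. \<Oplus>k. gi e k u * cov2 G P e a k u) - pd a J u) = 0" for a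
    using h2[of a] by (simp add: algebra_simps)
  then have dP: "(\<Oplus>e. \<Oplus>k. gi e k u * cov2 G P e a k u) = pd a J u" for a
    using assms by simp
  then show "(\<Oplus>e. \<Oplus>k. gi e k u * cov2 G P e a k u) = pd a J u" .
  have "pd b (trace_wrt G P) u = pd b J u"
    by (rule pd_cong[OF u tP])
  then show "(\<Oplus>a. \<Oplus>k. gi a k u * Cot k a b u) = 0"
    unfolding cotton_def using dP[of b] trace_cov2[OF u, of P b]
    by (simp add: right_diff_distrib sum_subtractf)
qed

text \<open>The left-hand side is the divergence of \<open>N\<close> written with its first index raised.\<close>

lemma divergence_raise:
  assumes "\<And>k c b. sm (N k c b)"
  defines "M \<equiv> \<lambda>a c b x. \<Oplus>k. gi a k x * N k c b x"
  shows "(\<Oplus>a. pd a (M a c b) u + (\<Oplus>f. \<Gamma> a a f u * M f c b u) - (\<Oplus>f. \<Gamma> f a c u * M a f b u)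
      - (\<Oplus>f. \<Gamma> f a b u * M a c f u)) = (\<Oplus>a. \<Oplus>k. gi a k u * cov3 G N a k c b u)"
proof (rule sum.cong[OF refl])
  fix a
  have 1: "(\<Oplus>f. \<Gamma> f a c u * M a f b u) = (\<Oplus>k. gi a k u * (\<Oplus>f. \<Gamma> f a c u * N k f b u))"
    unfolding M_def sum_distrib_left by (subst sum.swap) (simp add: mult.left_commute)
  have 2: "(\<Oplus>f. \<Gamma> f a b u * M a c f u) = (\<Oplus>k. gi a k u * (\<Oplus>f. \<Gamma> f a b u * N k c f u))"
    unfolding M_def sum_distrib_left by (subst sum.swap) (simp add: mult.left_commute)
  have 3: "pd a (M a c b) u = (\<Oplus>k. gi a k u * (pd a (N k c b) u - (\<Oplus>e. \<Gamma> e a k u * N e c b u)))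
      - (\<Oplus>e. \<Gamma> a a e u * M e c b u)"
    unfolding M_def using assms(1) by (rule pd_raise[OF u])
  show "pd a (M a c b) u + (\<Oplus>f. \<Gamma> a a f u * M f c b u) - (\<Oplus>f. \<Gamma> f a c u * M a f b u)
      - (\<Oplus>f. \<Gamma> f a b u * M a c f u) = (\<Oplus>k. gi a k u * cov3 G N a k c b u)"
    unfolding 1 2 3 cov3_def by (simp add: right_diff_distrib sum_subtractf)
qed

end
end

section \<open>The almost Einstein equation\<close>

text \<open>The trace of \<open>hess\<close> gives \<rho> = (1/d)(\<Delta>f - J f). Thus f, df and
  \<rho> are the three slots of the parallel tractor, and \<rho> is carried as a function of its own
  because its derivative is the next equation of the prolonged system.\<close>

locale almost_einstein_region = metric_region W G for W :: "(real^'n::finite) set" and G +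
  fixes f \<rho> :: "real^'n \<Rightarrow> real"
  assumes sm_f [simp]: "smooth_on W f" and sm_\<rho> [simp]: "smooth_on W \<rho>"
    and hess: "\<And>u a b. u \<in> W \<Longrightarrow> hessian G f a b u = - f u * schouten G a b u - \<rho> u * G u $ a $ b"
    and dim3: "CARD('n) \<ge> 3"
begin

abbreviation n where "n a \<equiv> pd a f"
abbreviation v where "v a u \<equiv> (\<Oplus>b. gi a b u * n b u)"
abbreviation Pv where "Pv b u \<equiv> (\<Oplus>k. P b k u * v k u)"
abbreviation Z where "Z b c u \<equiv> - f u * Pm c b u - \<rho> u * (if b = c then 1 else 0)"

context
  fixes u assumes u: "u \<in> W"
begin

lemma pd_v: "pd b (v c) u = Z b c u - (\<Oplus>e. \<Gamma> c b e u * v e u)"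
proof -
  have "pd b (v c) u = (\<Oplus>k. gi c k u * hessian G f b k u) - (\<Oplus>e. \<Gamma> c b e u * v e u)"
    unfolding hessian_def by (rule pd_raise[OF u]) simp
  moreover have "(\<Oplus>k. gi c k u * hessian G f b k u) = Z b c u"
    by (simp add: hess[OF u] right_diff_distrib sum_subtractf sum_negf sum_distrib_left mult.left_commute
        G_sym[OF u, of b]) (simp add: sum_distrib_left[symmetric] gi_G[OF u])
  ultimately show ?thesis by simp
qed

lemma v_lower: "(\<Oplus>d. G u $ a $ d * v d u) = n a u"
  by (rule lower_raise[OF u])

lemma trace_Pm: "(\<Oplus>a. Pm a a u) = J u"
  using trace_P[OF u dim3] by (simp add: trace_wrt_def)

lemma pd_Pm: "pd a (Pm c b) u + (\<Oplus>e. \<Gamma> c a e u * Pm e b u) = 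
  (\<Oplus>k. gi c k u * (pd a (P b k) u - (\<Oplus>e. \<Gamma> e a k u * P b e u)))"
  using pd_raise[OF u, of "P b" a c] by simp

text \<open>Ricci identity for the gradient \<open>v\<close>, whose covariant derivative is
  \<open>Z\<close>. Differentiating \<open>Z\<close> and antisymmetrising gives products of df and
  P, the Cotton tensor times f, and d\<rho>; the term of \<rho> with a Christoffel symbol is
  symmetric and drops out.\<close>

lemma Rm_v: "(\<Oplus>d. Rm a b c d u * v d u) = - n a u * Pm c b u + n b u * Pm c a u
   - f u * (\<Oplus>k. gi c k u * Cot k a b u) - pd a \<rho> u * (if c = b then 1 else 0) + pd b \<rho> u * (if c = a then 1 else 0)"
proof -
  have 1: "(\<Oplus>d. Rm a b c d u * v d u) =
    (pd a (Z b c) u + (\<Oplus>e. \<Gamma> c a e u * Z b e u)) - (pd b (Z a c) u + (\<Oplus>e. \<Gamma> c b e u * Z a e u))"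
  proof (rule ricci_identity[OF u])
    show "pd b (v c) x = Z b c x - (\<Oplus>e. \<Gamma> c b e x * v e x)" if "x \<in> W" for x b c
      by (rule almost_einstein_region.pd_v[OF almost_einstein_region_axioms that])
  qed simp_all
  have 2: "pd a (Z b c) u + (\<Oplus>e. \<Gamma> c a e u * Z b e u) =
    - n a u * Pm c b u - f u * (\<Oplus>k. gi c k u * (pd a (P b k) u - (\<Oplus>e. \<Gamma> e a k u * P b e u)))
    - pd a \<rho> u * (if c = b then 1 else 0) - \<rho> u * \<Gamma> c a b u" for a b
  proof -
    have "pd a (Z b c) u = - n a u * Pm c b u - f u * pd a (Pm c b) u - pd a \<rho> u * (if c = b then 1 else 0)"
      using u by simp
    moreover have "(\<Oplus>e. \<Gamma> c a e u * Z b e u) = - f u * (\<Oplus>e. \<Gamma> c a e u * Pm e b u) - \<rho> u * \<Gamma> c a b u"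
    proof -
      have "\<Gamma> c a e u * Z b e u = - (f u * (\<Gamma> c a e u * Pm e b u)) - \<rho> u * (\<Gamma> c a e u * (if b = e then 1 else 0))" for e
        by (simp add: algebra_simps)
      then show ?thesis
        by (simp only: sum_subtractf sum_negf sum_distrib_left[symmetric] sum_delta_mult minus_mult_left)
    qed
    ultimately show ?thesis
      unfolding pd_Pm[symmetric] by (simp add: algebra_simps)
  qed
  have 3: "(\<Oplus>k. gi c k u * (pd a (P b k) u - (\<Oplus>e. \<Gamma> e a k u * P b e u)))
    - (\<Oplus>k. gi c k u * (pd b (P a k) u - (\<Oplus>e. \<Gamma> e b k u * P a e u))) = (\<Oplus>k. gi c k u * Cot k a b u)"
  proof -
    have "Cot k a b u = (pd a (P b k) u - (\<Oplus>e. \<Gamma> e a k u * P b e u)) - (pd b (P a k) u - (\<Oplus>e. \<Gamma> e b k u * P a e u))" for k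
      unfolding cotton_def cov2_def by (simp add: christoffel_sym[OF u, of _ a b])
    then show ?thesis by (simp add: right_diff_distrib sum_subtractf)
  qed
  show ?thesis
    unfolding 1 2 3[symmetric] using christoffel_sym[OF u, of c a b] by (simp add: algebra_simps)
qed

text \<open>Trace of \<open>Rm_v\<close>, in which the Cotton tensor is trace-free, compared with
  the Schouten form of Ricci. The outcome is (d - 1)(d\<rho> - P v) = 0.\<close>

lemma pd_\<rho>: "pd b \<rho> u = Pv b u"
proof -
  have "(\<Oplus>d. Ric b d u * v d u) = (\<Oplus>a. \<Oplus>d. Rm a b a d u * v d u)"
    unfolding ricci_def sum_distrib_right by (rule sum.swap)
  also have "\<dots> = - (\<Oplus>a. n a u * Pm a b u) + n b u * (\<Oplus>a. Pm a a u) - f u * (\<Oplus>a. \<Oplus>k. gi a k u * Cot k a b u)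
    - pd b \<rho> u + real CARD('n) * pd b \<rho> u"
    unfolding Rm_v
    by (simp only: sum.distrib sum_subtractf sum_distrib_left[symmetric] sum_delta_mult sum_negf minus_mult_left[symmetric]) simp
  also have "(\<Oplus>a. n a u * Pm a b u) = Pv b u"
    unfolding sum_pull by (simp add: mult.left_commute sum_distrib_left)
      (subst sum.swap, simp add: gi_sym[OF u] mult_ac)
  finally have 1: "(\<Oplus>d. Ric b d u * v d u) = - Pv b u + n b u * J u + (real CARD('n) - 1) * pd b \<rho> u"
    by (simp add: trace_Pm trace_Cot[OF u dim3] algebra_simps)
  have "(\<Oplus>d. Ric b d u * v d u) = (real CARD('n) - 2) * Pv b u + J u * (\<Oplus>d. G u $ b $ d * v d u)"
    unfolding Ric_P[OF u dim3] distrib_right sum.distrib by (simp add: sum_distrib_left mult.assoc)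
  then have "(real CARD('n) - 1) * (pd b \<rho> u - Pv b u) = 0"
    using 1 unfolding v_lower by (simp add: algebra_simps)
  then show ?thesis using dim3 by simp
qed

lemma Rl_v: "(\<Oplus>d. Rl a b c d u * v d u) = - n a u * P b c u + n b u * P a c u - f u * Cot c a b u
    - pd a \<rho> u * G u $ c $ b + pd b \<rho> u * G u $ c $ a"
proof -
  have "(\<Oplus>d. Rl a b c d u * v d u) = (\<Oplus>e. G u $ c $ e * (\<Oplus>d. Rm a b e d u * v d u))"
    unfolding riemann_def by (rule sum_assoc3[symmetric])
  also have "\<dots> = - n a u * (\<Oplus>e. G u $ c $ e * Pm e b u) + n b u * (\<Oplus>e. G u $ c $ e * Pm e a u)
    - f u * (\<Oplus>e. G u $ c $ e * (\<Oplus>k. gi e k u * Cot k a b u))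
    - pd a \<rho> u * (\<Oplus>e. G u $ c $ e * (if e = b then 1 else 0))
    + pd b \<rho> u * (\<Oplus>e. G u $ c $ e * (if e = a then 1 else 0))"
  proof -
    have "G u $ c $ e * (\<Oplus>d. Rm a b e d u * v d u) = - n a u * (G u $ c $ e * Pm e b u) + n b u * (G u $ c $ e * Pm e a u)
    - f u * (G u $ c $ e * (\<Oplus>k. gi e k u * Cot k a b u))
    - pd a \<rho> u * (G u $ c $ e * (if e = b then 1 else 0))
    + pd b \<rho> u * (G u $ c $ e * (if e = a then 1 else 0))" for e
      unfolding Rm_v by (simp add: algebra_simps)
    then show ?thesis
      by (simp only: sum.distrib sum_subtractf sum_distrib_left[symmetric])
  qed
  finally show ?thesis
    by (simp add: lower_raise[OF u])
qed

text \<open>The first two indices of the curvature tensor are exchanged for the last two, so that the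
  divergence of the left-hand side can be taken by the Bianchi identity.\<close>

lemma Rl_v_pair: "(\<Oplus>d. Rl c d k b u * v d u) = - n k u * P b c u + n b u * P k c u - f u * Cot c k b u
    - pd k \<rho> u * G u $ c $ b + pd b \<rho> u * G u $ c $ k"
  using Rl_v[of k b c] Rl_pair_sym[OF u, of c _ k b] by simp

end

text \<open>The contraction of curvature with \<open>v\<close>, by \<open>Rl_v_pair\<close>, as a
  tensor field. Its divergence over \<open>k\<close> is computed in two ways, and the comparison
  yields the Bach identity.\<close>

abbreviation Rv where
  "Rv k c b x \<equiv> - (n k x * P b c x) + n b x * P k c x - f x * Cot c k b x
    - pd k \<rho> x * G x $ c $ b + pd b \<rho> x * G x $ c $ k"

context
  fixes u assumes u: "u \<in> W"
begin

text \<open>On the left the product rule: divergence of curvature (by \<open>divergence_Rm\<close>)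
  contracted with \<open>v\<close>, plus curvature contracted with \<nabla>v. On the right the
  divergence of the expression that the almost Einstein equation gives for the same tensor.\<close>

lemma divergence_Rm_v:
  "(\<Oplus>d. (cov2 G Ric c d b u - cov2 G Ric d c b u) * v d u) + (\<Oplus>a. \<Oplus>d. Rm c d a b u * Z a d u)
    = (\<Oplus>a. \<Oplus>k. gi a k u * cov3 G Rv a k c b u)"
proof -
  define M where "M a c b x = (\<Oplus>k. gi a k x * Rv k c b x)" for a c b x
  have M: "M a c b x = (\<Oplus>d. Rm c d a b x * v d x)" if "x \<in> W" for a c b x
  proof -
    have "M a c b x = (\<Oplus>k. gi a k x * (\<Oplus>d. Rl c d k b x * v d x))"
      unfolding M_def Rl_v_pair[OF that] by simp
    also have "\<dots> = (\<Oplus>d. Rm c d a b x * v d x)"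
      unfolding Rm_raise[OF that] by (rule sum_assoc3)
    finally show ?thesis .
  qed
  have M': "pd a (M a c b) u = (\<Oplus>d. pd a (Rm c d a b) u * v d u) + (\<Oplus>d. Rm c d a b u * Z a d u)
      - (\<Oplus>e. (\<Oplus>d. \<Gamma> d a e u * Rm c d a b u) * v e u)" for a
  proof -
    have "pd a (M a c b) u = pd a (\<lambda>x. \<Oplus>d. Rm c d a b x * v d x) u"
      by (rule pd_cong[OF u M])
    also have "\<dots> = (\<Oplus>d. pd a (Rm c d a b) u * v d u + Rm c d a b u * pd a (v d) u)"
      using u by simp
    also have "\<dots> = (\<Oplus>d. pd a (Rm c d a b) u * v d u) + (\<Oplus>d. Rm c d a b u * Z a d u)
      - (\<Oplus>d. Rm c d a b u * (\<Oplus>e. \<Gamma> d a e u * v e u))"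
      by (simp only: pd_v[OF u] right_diff_distrib sum.distrib sum_subtractf)
    also have "(\<Oplus>d. Rm c d a b u * (\<Oplus>e. \<Gamma> d a e u * v e u)) = (\<Oplus>e. (\<Oplus>d. Rm c d a b u * \<Gamma> d a e u) * v e u)"
      by (rule sum_assoc3)
    also have "\<dots> = (\<Oplus>e. (\<Oplus>d. \<Gamma> d a e u * Rm c d a b u) * v e u)"
      by (simp only: mult.commute[of "Rm c _ a b u"])
    finally show ?thesis .
  qed
  have a: "(\<Oplus>f. X f * (\<Oplus>d. Y f d * v d u)) = (\<Oplus>d. (\<Oplus>f. X f * Y f d) * v d u)" for X Y
    by (rule sum_assoc3)
  have "(\<Oplus>a. \<Oplus>k. gi a k u * cov3 G Rv a k c b u) =
    (\<Oplus>a. pd a (M a c b) u + (\<Oplus>f. \<Gamma> a a f u * M f c b u) - (\<Oplus>f. \<Gamma> f a c u * M a f b u)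
      - (\<Oplus>f. \<Gamma> f a b u * M a c f u))"
    unfolding M_def by (rule divergence_raise[OF u, symmetric]) simp
  also have "\<dots> = (\<Oplus>a. \<Oplus>d. (pd a (Rm c d a b) u + (\<Oplus>f. \<Gamma> a a f u * Rm c d f b u) - (\<Oplus>f. \<Gamma> f a b u * Rm c d a f u)
      - (\<Oplus>f. \<Gamma> f a c u * Rm f d a b u) - (\<Oplus>f. \<Gamma> f a d u * Rm c f a b u)) * v d u)
      + (\<Oplus>a. \<Oplus>d. Rm c d a b u * Z a d u)"
    unfolding M' M[OF u] a by (simp add: left_diff_distrib distrib_right sum.distrib sum_subtractf)
  also have "(\<Oplus>a. \<Oplus>d. (pd a (Rm c d a b) u + (\<Oplus>f. \<Gamma> a a f u * Rm c d f b u) - (\<Oplus>f. \<Gamma> f a b u * Rm c d a f u)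
      - (\<Oplus>f. \<Gamma> f a c u * Rm f d a b u) - (\<Oplus>f. \<Gamma> f a d u * Rm c f a b u)) * v d u)
    = (\<Oplus>d. (\<Oplus>a. pd a (Rm c d a b) u + (\<Oplus>f. \<Gamma> a a f u * Rm c d f b u) - (\<Oplus>f. \<Gamma> f a b u * Rm c d a f u)
      - (\<Oplus>f. \<Gamma> f a c u * Rm f d a b u) - (\<Oplus>f. \<Gamma> f a d u * Rm c f a b u)) * v d u)"
    unfolding sum_distrib_right by (rule sum.swap)
  finally show ?thesis
    unfolding divergence_Rm[OF u] by simp
qed

definition hess\<rho> where "hess\<rho> a b = pd a (pd b \<rho>) u - (\<Oplus>e. \<Gamma> e a b u * pd e \<rho> u)" for a b

lemma cov3_Rv: "cov3 G Rv a k c b u =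
   - hessian G f a k u * P b c u - n k u * cov2 G P a b c u
   + hessian G f a b u * P k c u + n b u * cov2 G P a k c u
   - n a u * Cot c k b u - f u * cov3 G Cot a c k b u
   - hess\<rho> a k * G u $ c $ b + hess\<rho> a b * G u $ c $ k"
proof -
  have G: "pd a (\<lambda>x. G x $ c $ b) u = (\<Oplus>e. \<Gamma> e a c u * G u $ e $ b) + (\<Oplus>e. \<Gamma> e a b u * G u $ c $ e)" for c b
    using metric_compatible[OF u, of a c b] by (simp add: cov2_def)
  show ?thesis
    using u unfolding cov3_def cov2_def hessian_def hess\<rho>_def
    by (simp add: G algebra_simps sum.distrib sum_distrib_left sum_distrib_right sum_subtractf sum_negf)
qed

lemma hess\<rho>_eq: "hess\<rho> a b = (\<Oplus>k. cov2 G P a b k u * v k u) + (\<Oplus>k. P b k u * Z a k u)"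
proof -
  have "pd a (pd b \<rho>) u = pd a (Pv b) u"
    by (rule pd_cong[OF u pd_\<rho>])
  also have "\<dots> = (\<Oplus>k. pd a (P b k) u * v k u + P b k u * pd a (v k) u)"
    using u by simp
  also have "\<dots> = (\<Oplus>k. pd a (P b k) u * v k u) + (\<Oplus>k. P b k u * Z a k u) - (\<Oplus>e. (\<Oplus>k. \<Gamma> k a e u * P b k u) * v e u)"
  proof -
    have "(\<Oplus>k. P b k u * (\<Oplus>e. \<Gamma> k a e u * v e u)) = (\<Oplus>e. (\<Oplus>k. P b k u * \<Gamma> k a e u) * v e u)"
      by (rule sum_assoc3)
    also have "\<dots> = (\<Oplus>e. (\<Oplus>k. \<Gamma> k a e u * P b k u) * v e u)"
      by (simp only: mult.commute[of "P b _ u"])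
    finally show ?thesis
      unfolding pd_v[OF u] by (simp only: right_diff_distrib[of "P b _ u" _ "\<Oplus>e. _ e * _ e"] sum.distrib sum_subtractf)
  qed
  finally show ?thesis
    unfolding hess\<rho>_def cov2_def pd_\<rho>[OF u]
      sum_assoc3[of "\<lambda>e. \<Gamma> e a b u" "\<lambda>e k. P e k u" "\<lambda>k. v k u"]
    by (simp add: left_diff_distrib sum_subtractf)
qed

end
end

section \<open>Algebra of the Schouten and Weyl tensors\<close>

context metric_region
begin

abbreviation Psq where "Psq b c u \<equiv> (\<Oplus>k. P b k u * Pm k c u)"
abbreviation Pnorm where "Pnorm u \<equiv> (\<Oplus>a. \<Oplus>k. gi a k u * Psq k a u)"

context
  fixes u assumes u: "u \<in> W"
begin

lemma cov2_P_sym: "cov2 G P a b c u = cov2 G P a c b u"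
proof -
  have "pd a (P b c) u = pd a (P c b) u"
    by (rule pd_cong[OF u]) (rule P_sym)
  then show ?thesis unfolding cov2_def using P_sym[OF u, of _ c] P_sym[OF u, of b] by simp
qed

lemma trace_G: "(\<Oplus>a. \<Oplus>k. gi a k u * G u $ a $ k) = real CARD('n)"
  using gi_G[OF u] by (simp add: G_sym[OF u, of a k for a k])

lemma sum_raise_snd: "(\<Oplus>a. \<Oplus>k. gi a k u * (X k * Y a)) = (\<Oplus>a. (\<Oplus>k. gi a k u * X k) * Y a)"
  by (simp add: sum_distrib_right mult.assoc)

lemma sum_raise_fst: "(\<Oplus>a. \<Oplus>k. gi a k u * (X a * Y k)) = (\<Oplus>k. (\<Oplus>a. gi k a u * X a) * Y k)"
  by (subst sum.swap) (simp add: sum_distrib_right mult.assoc gi_sym[OF u])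

lemma Psq_sym: "Psq b c u = Psq c b u"
proof -
  have "Psq b c u = (\<Oplus>k. \<Oplus>l. gi k l u * (P b k u * P c l u))"
    by (simp add: sum_distrib_left mult.left_commute)
  also have "\<dots> = (\<Oplus>k. (\<Oplus>a. gi k a u * P b a u) * P c k u)"
    by (rule sum_raise_fst)
  also have "\<dots> = Psq c b u"
    by (simp add: mult.commute)
  finally show ?thesis .
qed

text \<open>Rewrites the Weyl term of the Bach tensor in the quantities which the divergence of
  curvature produces. \<open>U\<close> is the Schouten tensor with both indices raised.\<close>

lemma schouten_weyl:
  assumes "CARD('n) \<ge> 3"
  shows "(\<Oplus>d. \<Oplus>a. (\<Oplus>e. \<Oplus>k. gi d e u * gi a k u * P e k u) * weyl G d c a b u) =
    - (\<Oplus>a. \<Oplus>d. Rm c d a b u * Pm d a u) + 2 * Psq b c u - J u * P b c u - Pnorm u * G u $ c $ b"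
proof -
  define U where "U d a = (\<Oplus>e. \<Oplus>k. gi d e u * gi a k u * P e k u)" for d a
  have U1: "U d a = (\<Oplus>k. gi a k u * Pm d k u)" for d a
    unfolding U_def sum_distrib_left by (subst sum.swap) (simp add: mult_ac P_sym[OF u])
  have U2: "U d a = (\<Oplus>e. gi d e u * Pm a e u)" for d a
    unfolding U_def sum_distrib_left by (simp add: mult_ac P_sym[OF u])
  have a1: "(\<Oplus>a. U d a * X a) = (\<Oplus>k. Pm d k u * (\<Oplus>a. gi k a u * X a))" for d X
  proof -
    have "(\<Oplus>a. U d a * X a) = (\<Oplus>a. (\<Oplus>k. Pm d k u * gi k a u) * X a)"
      unfolding U1 by (simp only: gi_sym[OF u, of _ a for a] mult.commute)
    then show ?thesis by (simp only: sum_assoc3)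
  qed
  have U_sym: "U d a = U a d" for d a
    unfolding U1[of d a] U2[of a d] ..
  have Rl': "Rl d c a b u = - Rl c d a b u" for d a
    by (rule Rl_antisym1[OF u])
  have 1: "(\<Oplus>d. \<Oplus>a. U d a * Rl d c a b u) = - (\<Oplus>a. \<Oplus>d. Rm c d a b u * Pm d a u)"
  proof -
    have "(\<Oplus>d. \<Oplus>a. U d a * Rl d c a b u) = - (\<Oplus>d. \<Oplus>a. U d a * Rl c d a b u)"
      unfolding Rl' by (simp add: sum_negf)
    also have "\<dots> = - (\<Oplus>d. \<Oplus>k. Pm d k u * Rm c d k b u)"
      unfolding a1 Rm_raise[OF u, symmetric] ..
    also have "\<dots> = - (\<Oplus>a. \<Oplus>d. Rm c d a b u * Pm d a u)"
      by (subst sum.swap) (simp add: mult.commute)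
    finally show ?thesis .
  qed
  have UG: "(\<Oplus>a. U d a * G u $ a $ x) = Pm d x u" for d x
    unfolding a1 gi_G[OF u] by simp
  have UG': "(\<Oplus>d. U d a * G u $ x $ d) = Pm a x u" for a x
    using UG[of a x] U_sym by (simp add: G_sym[OF u, of x])
  have 2: "(\<Oplus>d. \<Oplus>a. U d a * G u $ a $ d) = J u"
    unfolding UG using trace_P[OF u assms] by (simp add: trace_wrt_def)
  have 3: "(\<Oplus>d. \<Oplus>a. U d a * (G u $ a $ c * P d b u)) = Psq b c u"
    unfolding mult.assoc[symmetric] sum_distrib_right[symmetric] UG by (simp add: mult.commute P_sym[OF u])
  have 4: "(\<Oplus>d. \<Oplus>a. U d a * (G u $ b $ d * P c a u)) = Psq b c u"
  proof -
    have "(\<Oplus>d. \<Oplus>a. U d a * (G u $ b $ d * P c a u)) = (\<Oplus>a. \<Oplus>d. U d a * (G u $ b $ d * P c a u))"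
      by (rule sum.swap)
    also have "\<dots> = Psq c b u"
      unfolding mult.assoc[symmetric] sum_distrib_right[symmetric] UG' by (simp add: mult.commute)
    finally show ?thesis using Psq_sym by simp
  qed
  have 5: "(\<Oplus>d. \<Oplus>a. U d a * P d a u) = Pnorm u"
  proof -
    have "Pnorm u = (\<Oplus>a. \<Oplus>k. \<Oplus>l. gi a k u * (P k l u * Pm l a u))"
      by (simp only: sum_distrib_left)
    also have "\<dots> = (\<Oplus>l. \<Oplus>a. \<Oplus>k. gi a k u * (P k l u * Pm l a u))"
      by (rule sum_rotate)
    also have "\<dots> = (\<Oplus>l. \<Oplus>k. \<Oplus>a. gi a k u * (P k l u * Pm l a u))"
      by (intro sum.cong refl sum.swap)
    also have "\<dots> = (\<Oplus>d. \<Oplus>a. U d a * P d a u)"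
      unfolding U1 sum_distrib_right
      by (intro sum.cong refl) (simp only: gi_sym[OF u, of _ k for k] P_sym[OF u, of _ l for l] mult_ac)
    finally show ?thesis by simp
  qed
  have "(\<Oplus>d. \<Oplus>a. U d a * weyl G d c a b u) = (\<Oplus>d. \<Oplus>a. U d a * Rl d c a b u)
    - (\<Oplus>d. \<Oplus>a. U d a * G u $ a $ d) * P c b u + (\<Oplus>d. \<Oplus>a. U d a * (G u $ a $ c * P d b u))
    - G u $ b $ c * (\<Oplus>d. \<Oplus>a. U d a * P d a u) + (\<Oplus>d. \<Oplus>a. U d a * (G u $ b $ d * P c a u))"
  proof -
    have "U d a * weyl G d c a b u = U d a * Rl d c a b u - P c b u * (U d a * G u $ a $ d)
      + U d a * (G u $ a $ c * P d b u) - G u $ b $ c * (U d a * P d a u) + U d a * (G u $ b $ d * P c a u)" for d a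
      unfolding weyl_def by (simp add: algebra_simps)
    then show ?thesis
      by (simp only: sum.distrib sum_subtractf sum_distrib_left[symmetric] mult.commute[of _ "P c b u"])
  qed
  then show ?thesis
    unfolding 1 2 3 4 5 unfolding U_def
    using P_sym[OF u, of c b] G_sym[OF u, of b c] by simp
qed

end
end

context almost_einstein_region
begin

abbreviation F where "F b c u \<equiv> (\<Oplus>d. Cot b c d u * v d u)"
text \<open>This is \<open>bach G c b u\<close> on \<open>W\<close> with its Weyl term expanded by
  \<open>schouten_weyl\<close>, valid in dimension at least 3.\<close>

abbreviation Bach where "Bach c b u \<equiv> (\<Oplus>a. \<Oplus>k. gi a k u * cov3 G Cot a c k b u)
   - (\<Oplus>a. \<Oplus>d. Rm c d a b u * Pm d a u) + 2 * Psq b c u - J u * P b c u - Pnorm u * G u $ c $ b"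

context
  fixes u assumes u: "u \<in> W"
begin

text \<open>In \<open>divergence_Rm_v\<close> the derivative of Ricci contributes d - 2 copies of
  \<open>F b c\<close> on the left, while n \<nabla>P and the Hessian of \<rho> contribute one on
  the right; d - 3 remain. The terms with \<rho> and dJ cancel, and those with f assemble to
  \<open>Bach\<close>.\<close>

lemma bach_divergence: "(real CARD('n) - 3) * F b c u - F c b u + f u * Bach c b u = 0"
proof -
  have Pm_P: "(\<Oplus>k. gi a k u * P k c u) = Pm a c u" for a c
    by (simp add: P_sym[OF u, of _ c])
  have t1: "(\<Oplus>a. \<Oplus>k. gi a k u * (hessian G f a k u * P b c u)) = - f u * J u * P b c u - \<rho> u * real CARD('n) * P b c u"
  proof -
    have "gi a k u * (hessian G f a k u * P b c u) = - (f u * P b c u) * (gi a k u * P a k u)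
      - (\<rho> u * P b c u) * (gi a k u * G u $ a $ k)" for a k
      unfolding hess[OF u] by (simp add: algebra_simps)
    then have "(\<Oplus>a. \<Oplus>k. gi a k u * (hessian G f a k u * P b c u)) =
      - (f u * P b c u) * trace_wrt G P u - (\<rho> u * P b c u) * (\<Oplus>a. \<Oplus>k. gi a k u * G u $ a $ k)"
      unfolding trace_wrt_def by (simp only: sum_subtractf sum_distrib_left)
    then show ?thesis by (simp add: trace_P[OF u dim3] trace_G[OF u])
  qed
  have t2: "(\<Oplus>a. \<Oplus>k. gi a k u * (n k u * cov2 G P a b c u)) = (\<Oplus>a. cov2 G P a c b u * v a u)"
    unfolding sum_raise_snd[OF u] by (simp add: mult.commute cov2_P_sym[OF u, of _ b])
  have t3: "(\<Oplus>a. \<Oplus>k. gi a k u * (hessian G f a b u * P k c u)) = - f u * Psq b c u - \<rho> u * P b c u"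
  proof -
    have "(\<Oplus>a. \<Oplus>k. gi a k u * (hessian G f a b u * P k c u)) = (\<Oplus>a. (\<Oplus>k. gi a k u * P k c u) * hessian G f a b u)"
      using sum_raise_snd[OF u, of "\<lambda>k. P k c u" "\<lambda>a. hessian G f a b u"] by (simp add: mult.commute)
    also have "\<dots> = (\<Oplus>a. - f u * (P b a u * Pm a c u) - \<rho> u * (G u $ b $ a * Pm a c u))"
      unfolding Pm_P hess[OF u] by (simp add: algebra_simps P_sym[OF u, of _ b] G_sym[OF u, of _ b])
    also have "\<dots> = - f u * Psq b c u - \<rho> u * (\<Oplus>a. G u $ b $ a * Pm a c u)"
      by (simp only: sum_subtractf sum_distrib_left)
    finally show ?thesis unfolding lower_raise[OF u] using P_sym[OF u, of b c] by simp
  qed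
  have t4: "(\<Oplus>a. \<Oplus>k. gi a k u * (n b u * cov2 G P a k c u)) = n b u * pd c J u"
    using div_P[OF u dim3, of c] unfolding mult.left_commute[of _ "n b u"] sum_distrib_left[symmetric]
    by (simp add: cov2_P_sym[OF u, of _ _ c])
  have t5: "(\<Oplus>a. \<Oplus>k. gi a k u * (n a u * Cot c k b u)) = - F c b u"
    unfolding sum_raise_fst[OF u] by (simp add: Cot_antisym[OF u, of c _ b] sum_negf[symmetric] mult.commute)
  have t6: "(\<Oplus>a. \<Oplus>k. gi a k u * (f u * cov3 G Cot a c k b u)) = f u * (\<Oplus>a. \<Oplus>k. gi a k u * cov3 G Cot a c k b u)"
    unfolding mult.left_commute[of _ "f u"] sum_distrib_left ..
  have PZ: "(\<Oplus>k. P b k u * Z a k u) = - f u * Psq b a u - \<rho> u * P b a u" for a b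
  proof -
    have "P b k u * Z a k u = - f u * (P b k u * Pm k a u) - \<rho> u * (P b k u * (if a = k then 1 else 0))" for k
      by (simp add: algebra_simps)
    then show ?thesis
      by (simp only: sum_subtractf sum_distrib_left[symmetric] sum_delta_mult)
  qed
  have tr\<rho>: "(\<Oplus>a. \<Oplus>k. gi a k u * hess\<rho> u a k) = (\<Oplus>l. pd l J u * v l u) - f u * Pnorm u - \<rho> u * J u"
  proof -
    have "gi a k u * hess\<rho> u a k = gi a k u * (\<Oplus>l. cov2 G P a l k u * v l u)
      - f u * (gi a k u * Psq k a u) - \<rho> u * (gi a k u * P a k u)" for a k
      unfolding hess\<rho>_eq[OF u] PZ cov2_P_sym[OF u, of a k] P_sym[OF u, of k a] by (simp add: algebra_simps)
    then have "(\<Oplus>a. \<Oplus>k. gi a k u * hess\<rho> u a k) = (\<Oplus>a. \<Oplus>k. gi a k u * (\<Oplus>l. cov2 G P a l k u * v l u))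
      - f u * Pnorm u - \<rho> u * trace_wrt G P u"
      unfolding trace_wrt_def by (simp only: sum_subtractf sum_distrib_left)
    also have "(\<Oplus>a. \<Oplus>k. gi a k u * (\<Oplus>l. cov2 G P a l k u * v l u)) =
      (\<Oplus>l. (\<Oplus>a. \<Oplus>k. gi a k u * cov2 G P a l k u) * v l u)"
    proof -
      have "(\<Oplus>a. \<Oplus>k. gi a k u * (\<Oplus>l. cov2 G P a l k u * v l u)) =
        (\<Oplus>a. \<Oplus>k. \<Oplus>l. gi a k u * cov2 G P a l k u * v l u)"
        by (simp only: sum_distrib_left mult.assoc)
      also have "\<dots> = (\<Oplus>l. \<Oplus>a. \<Oplus>k. gi a k u * cov2 G P a l k u * v l u)"
        by (rule sum_rotate)
      finally show ?thesis by (simp only: sum_distrib_right)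
    qed
    finally show ?thesis
      unfolding div_P[OF u dim3] trace_P[OF u dim3] .
  qed
  have t7: "(\<Oplus>a. \<Oplus>k. gi a k u * (hess\<rho> u a k * G u $ c $ b)) =
    ((\<Oplus>l. pd l J u * v l u) - f u * Pnorm u - \<rho> u * J u) * G u $ c $ b"
    unfolding mult.assoc[symmetric] sum_distrib_right[symmetric] tr\<rho> ..
  have t8: "(\<Oplus>a. \<Oplus>k. gi a k u * (hess\<rho> u a b * G u $ c $ k)) =
    (\<Oplus>k. cov2 G P c k b u * v k u) - f u * Psq b c u - \<rho> u * P b c u"
  proof -
    have "(\<Oplus>a. \<Oplus>k. gi a k u * (hess\<rho> u a b * G u $ c $ k)) = (\<Oplus>a. hess\<rho> u a b * (\<Oplus>k. gi a k u * G u $ k $ c))"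
      by (simp add: sum_distrib_left mult.left_commute G_sym[OF u, of c])
    also have "\<dots> = hess\<rho> u c b"
      unfolding gi_G[OF u] by simp
    finally show ?thesis
      unfolding hess\<rho>_eq[OF u] PZ cov2_P_sym[OF u, of c b] by simp
  qed
  have R: "(\<Oplus>a. \<Oplus>k. gi a k u * cov3 G Rv a k c b u) =
    - (\<Oplus>a. \<Oplus>k. gi a k u * (hessian G f a k u * P b c u)) - (\<Oplus>a. \<Oplus>k. gi a k u * (n k u * cov2 G P a b c u))
    + (\<Oplus>a. \<Oplus>k. gi a k u * (hessian G f a b u * P k c u)) + (\<Oplus>a. \<Oplus>k. gi a k u * (n b u * cov2 G P a k c u))
    - (\<Oplus>a. \<Oplus>k. gi a k u * (n a u * Cot c k b u)) - (\<Oplus>a. \<Oplus>k. gi a k u * (f u * cov3 G Cot a c k b u))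
    - (\<Oplus>a. \<Oplus>k. gi a k u * (hess\<rho> u a k * G u $ c $ b)) + (\<Oplus>a. \<Oplus>k. gi a k u * (hess\<rho> u a b * G u $ c $ k))"
    unfolding cov3_Rv[OF u]
    by (simp only: distrib_left right_diff_distrib minus_mult_left[symmetric] mult_minus_right sum.distrib sum_subtractf sum_negf)
  have l1: "(\<Oplus>d. (cov2 G Ric c d b u - cov2 G Ric d c b u) * v d u) =
    (real CARD('n) - 2) * F b c u + pd c J u * n b u - G u $ c $ b * (\<Oplus>d. pd d J u * v d u)"
  proof -
    have "(cov2 G Ric c d b u - cov2 G Ric d c b u) * v d u = (real CARD('n) - 2) * (Cot b c d u * v d u)
      + pd c J u * (G u $ b $ d * v d u) - G u $ c $ b * (pd d J u * v d u)" for d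
      unfolding cov_Ric[OF u dim3] cotton_def by (simp add: algebra_simps G_sym[OF u, of d b])
    then have "(\<Oplus>d. (cov2 G Ric c d b u - cov2 G Ric d c b u) * v d u) = (real CARD('n) - 2) * F b c u
      + pd c J u * (\<Oplus>d. G u $ b $ d * v d u) - G u $ c $ b * (\<Oplus>d. pd d J u * v d u)"
      by (simp only: sum_subtractf sum.distrib sum_distrib_left)
    then show ?thesis unfolding v_lower[OF u] .
  qed
  have l2: "(\<Oplus>a. \<Oplus>d. Rm c d a b u * Z a d u) = - f u * (\<Oplus>a. \<Oplus>d. Rm c d a b u * Pm d a u)
    + \<rho> u * ((real CARD('n) - 2) * P c b u + J u * G u $ c $ b)"
  proof -
    have "Rm c d a b u * Z a d u = - f u * (Rm c d a b u * Pm d a u)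
      - \<rho> u * (Rm c d a b u * (if a = d then 1 else 0))" for a d
      by (simp add: algebra_simps)
    then have "(\<Oplus>a. \<Oplus>d. Rm c d a b u * Z a d u) = - f u * (\<Oplus>a. \<Oplus>d. Rm c d a b u * Pm d a u) - \<rho> u * (\<Oplus>a. Rm c a a b u)"
      by (simp only: sum_subtractf sum_distrib_left[symmetric] sum_delta_mult)
    moreover have "(\<Oplus>a. Rm c a a b u) = - Ric c b u"
      unfolding ricci_def sum_negf[symmetric] by (intro sum.cong refl Rm_antisym[OF u])
    ultimately show ?thesis by (simp add: Ric_P[OF u dim3]) (simp add: algebra_simps)
  qed
  have F': "F b c u = (\<Oplus>k. cov2 G P c k b u * v k u) - (\<Oplus>k. cov2 G P k c b u * v k u)"
    unfolding cotton_def by (simp only: left_diff_distrib sum_subtractf)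
  show ?thesis
    using divergence_Rm_v[OF u, of c b] P_sym[OF u, of c b] F'
    unfolding R l1 l2 t1 t2 t3 t4 t5 t6 t7 t8 by (simp only: left_diff_distrib right_diff_distrib distrib_left distrib_right) simp
qed

end
end

section \<open>Consequences on the zero set in dimension five\<close>

context almost_einstein_region
begin

abbreviation N where "N u \<equiv> (\<Oplus>e. v e u * n e u)"
abbreviation dv where "dv X u \<equiv> (\<Oplus>e. v e u * pd e X u)"
abbreviation K where "K b c u \<equiv> (\<Oplus>e. \<Oplus>d. v e u * v d u * cov3 G Cot e b c d u)"

lemma sm_v [simp]: "sm (v a)"
  by simp

text \<open>\<open>Rl_v\<close> contracted once more with \<open>v\<close>: the curvature side
  vanishes by skew-symmetry, and the Schouten terms cancel against d\<rho> = P v. The factor f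
  stays, since the identity is meant to hold up to the zero set.\<close>

lemma normal_cotton: "u \<in> W \<Longrightarrow> f u * (\<Oplus>d. Cot d b c u * v d u) = 0"
proof -
  assume u: "u \<in> W"
  have s: "(\<Oplus>a. \<Oplus>d. Rl b c a d u * v d u * v a u) = 0"
  proof -
    have "(\<Oplus>a. \<Oplus>d. Rl b c a d u * v d u * v a u) = (\<Oplus>d. \<Oplus>a. Rl b c a d u * v d u * v a u)"
      by (rule sum.swap)
    also have "\<dots> = - (\<Oplus>a. \<Oplus>d. Rl b c a d u * v d u * v a u)"
      unfolding sum_negf[symmetric]
      by (intro sum.cong refl, subst Rl_antisym2[OF u]) (simp only: mult_ac mult_minus_left mult_minus_right)
    finally show ?thesis by simp
  qed
  have "(\<Oplus>d. Rl b c a d u * v d u) * v a u = - n b u * (P c a u * v a u) + n c u * (P b a u * v a u)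
    - f u * (Cot a b c u * v a u) - pd b \<rho> u * (G u $ c $ a * v a u) + pd c \<rho> u * (G u $ b $ a * v a u)" for a
    unfolding Rl_v[OF u] by (simp only: G_sym[OF u, of a]) (simp only: ring_distribs mult_ac mult_minus_left mult_minus_right)
  then have "0 = - n b u * Pv c u + n c u * Pv b u - f u * (\<Oplus>a. Cot a b c u * v a u)
    - pd b \<rho> u * (\<Oplus>a. G u $ c $ a * v a u) + pd c \<rho> u * (\<Oplus>a. G u $ b $ a * v a u)"
    using s unfolding sum_distrib_right[symmetric] by (simp only: sum.distrib sum_subtractf sum_distrib_left)
  then show ?thesis
    unfolding v_lower[OF u] pd_\<rho>[OF u] by (simp add: mult.commute)
qed

context
  fixes u assumes u: "u \<in> W" and fu: "f u = 0" and N0: "N u \<noteq> 0" and dim5: "CARD('n) = 5"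
begin

text \<open>For d = 5 and f = 0, \<open>bach_divergence\<close> says that twice \<open>F b c\<close>
  is \<open>F c b\<close>; the same with the indices exchanged forces both to vanish.\<close>

lemma F_zero: "F b c u = 0"
  using bach_divergence[OF u, of b c] bach_divergence[OF u, of c b] dim5 fu by simp

lemma dv_linear: "sm X \<Longrightarrow> sm Y \<Longrightarrow> dv (\<lambda>x. X x - Y x) u = dv X u - dv Y u"
  using u by (simp only: pd_diff right_diff_distrib sum_subtractf)

text \<open>By \<open>Cot_cyclic\<close> the skew part of \<open>F\<close> is minus the contraction
  of the Cotton tensor with \<open>v\<close> in the first slot, to which
  \<open>normal_cotton\<close> applies.\<close>

lemma dv_F_sym: "dv (F b c) u = dv (F c b) u"
proof -
  define Y where "Y x = (\<Oplus>d. Cot d b c x * v d x)" for x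
  have smY: "sm Y" unfolding Y_def by simp
  have FY: "F b c x - F c b x = - Y x" if "x \<in> W" for x
  proof -
    have "Cot b c d x * v d x - Cot c b d x * v d x = - (Cot d b c x * v d x)" for d
    proof -
      have c: "Cot b c d x - Cot c b d x = - Cot d b c x"
        using Cot_cyclic[OF that, of b c d] Cot_antisym[OF that, of c d b] by simp
      show ?thesis unfolding left_diff_distrib[symmetric] c by (rule mult_minus_left)
    qed
    then show ?thesis unfolding Y_def by (simp only: sum_subtractf[symmetric] sum_negf[symmetric])
  qed
  \<comment> \<open>\<open>f * Y = 0\<close> is differentiated twice along \<open>v\<close> to obtain \<open>dv Y = 0\<close> where \<open>f = 0\<close>.\<close>
  have 1: "n e x * Y x + f x * pd e Y x = 0" if "x \<in> W" for x e
  proof -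
    have "pd e (\<lambda>x. f x * Y x) x = pd e (\<lambda>x. 0) x"
      by (rule pd_cong[OF that]) (use normal_cotton in \<open>simp add: Y_def\<close>)
    then show ?thesis using that smY by simp
  qed
  have 2: "N x * Y x + f x * dv Y x = 0" if "x \<in> W" for x
  proof -
    have "N x * Y x + f x * dv Y x = (\<Oplus>e. v e x * (n e x * Y x + f x * pd e Y x))"
      by (simp only: sum_distrib_left sum_distrib_right distrib_left sum.distrib mult_ac)
    then show ?thesis by (simp only: 1[OF that]) simp
  qed
  have Y0: "Y u = 0"
    using 2[OF u] fu N0 by simp
  define N' D' where "N' = (\<lambda>x. N x)" and "D' = (\<lambda>x. dv Y x)"
  have smN': "sm N'" and smD': "sm D'"
    unfolding N'_def D'_def using smY by simp_all
  have "N u * pd e Y u + n e u * dv Y u = 0" for e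
  proof -
    have "pd e (\<lambda>x. N' x * Y x + f x * D' x) u = pd e (\<lambda>x. 0) u"
      by (rule pd_cong[OF u]) (use 2 in \<open>simp only: N'_def D'_def\<close>)
    then have "N' u * pd e Y u + n e u * D' u = 0"
      using u smY smN' smD' Y0 fu by simp
    then show ?thesis by (simp only: N'_def D'_def)
  qed
  then have "(\<Oplus>e. v e u * (N u * pd e Y u + n e u * dv Y u)) = 0"
    by simp
  moreover have "(\<Oplus>e. v e u * (N' u * pd e Y u + n e u * D' u)) = N' u * dv Y u + N u * D' u"
    by (simp only: sum_distrib_left sum_distrib_right distrib_left sum.distrib mult_ac)
  ultimately have dY: "dv Y u = 0"
    using N0 by (simp only: N'_def D'_def) simp
  have "dv (F b c) u - dv (F c b) u = dv (\<lambda>x. F b c x - F c b x) u"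
    by (rule dv_linear[symmetric]) simp_all
  also have "\<dots> = (\<Oplus>e. v e u * pd e (\<lambda>x. - Y x) u)"
    by (intro sum.cong refl arg_cong2[of _ _ _ _ "(*)"] pd_cong[OF u]) (rule FY)
  also have "\<dots> = - dv Y u"
    by (simp only: pd_minus[OF u smY] mult_minus_right sum_negf)
  finally show ?thesis using dY by simp
qed

text \<open>Derivative of \<open>bach_divergence\<close> along \<open>v\<close> where f = 0:
  coefficients 2 and -1 in front of the normal derivatives of \<open>F b c\<close> and
  \<open>F c b\<close>, which agree by \<open>dv_F_sym\<close>. The factor 2 - 1 = 1 is special to d
  = 5.\<close>

lemma normal_derivative_bach: "N u * Bach c b u + dv (F b c) u = 0"
proof -
  define B' where "B' = (\<lambda>x. Bach c b x)"
  define F1 F2 where "F1 = F b c" and "F2 = F c b"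
  have smB': "sm B'" unfolding B'_def by simp
  have sm12: "sm F1" "sm F2" unfolding F1_def F2_def by simp_all
  have "pd e (\<lambda>x. 2 * F1 x - F2 x + f x * B' x) u = pd e (\<lambda>x. 0) u" for e
    by (rule pd_cong[OF u])
      (use bach_divergence[of _ b c] dim5 in \<open>simp only: F1_def F2_def B'_def\<close>, simp)
  then have e: "2 * pd e F1 u - pd e F2 u + n e u * B' u = 0" for e
    using u smB' sm12 fu by simp
  have "(\<Oplus>e. v e u * (2 * pd e F1 u - pd e F2 u + n e u * B' u)) = 2 * dv F1 u - dv F2 u + N u * B' u"
    by (simp only: sum_distrib_left sum_distrib_right distrib_left right_diff_distrib sum.distrib sum_subtractf mult_ac)
  then have "2 * dv F1 u - dv F2 u + N u * B' u = 0"
    by (simp only: e) simp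
  moreover have "dv F1 u = dv F2 u"
    unfolding F1_def F2_def by (rule dv_F_sym)
  ultimately have "N u * B' u + dv F1 u = 0" by simp
  then show ?thesis by (simp only: F1_def B'_def)
qed

text \<open>With f = \<rho> = 0 the covariant derivative of \<open>v\<close> vanishes at
  \<open>u\<close>, so the derivative falls on the Cotton tensor alone. The Christoffel corrections
  for \<open>b\<close> and \<open>c\<close> are contractions of \<open>F\<close>, zero by
  \<open>F_zero\<close>.\<close>

lemma dv_F:
  assumes "\<rho> u = 0"
  shows "dv (F b c) u = K b c u"
proof -
  have pdF: "pd e (F b c) u = (\<Oplus>d. v d u * cov3 G Cot e b c d u)" for e
  proof -
    have Z0: "pd e (v d) u = - (\<Oplus>k. \<Gamma> d e k u * v k u)" for d
      unfolding pd_v[OF u] using fu assms by simp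
    have "pd e (F b c) u = (\<Oplus>d. pd e (Cot b c d) u * v d u) + (\<Oplus>d. Cot b c d u * pd e (v d) u)"
      using u by (simp only: pd_sum pd_mult sm_mult sm_Cot sm_v finite sum.distrib)
    also have "(\<Oplus>d. Cot b c d u * pd e (v d) u) = - (\<Oplus>k. (\<Oplus>d. Cot b c d u * \<Gamma> d e k u) * v k u)"
      unfolding Z0 by (simp only: mult_minus_right sum_negf sum_assoc3[symmetric])
    finally have 1: "pd e (F b c) u = (\<Oplus>d. pd e (Cot b c d) u * v d u)
      - (\<Oplus>k. (\<Oplus>d. Cot b c d u * \<Gamma> d e k u) * v k u)" by simp
    have 2: "(\<Oplus>d. (\<Oplus>k. \<Gamma> k e b u * Cot k c d u) * v d u) = 0"
      unfolding sum_assoc3[symmetric] by (simp only: F_zero) simp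
    have 3: "(\<Oplus>d. (\<Oplus>k. \<Gamma> k e c u * Cot b k d u) * v d u) = 0"
      unfolding sum_assoc3[symmetric] by (simp only: F_zero) simp
    have "(\<Oplus>d. v d u * cov3 G Cot e b c d u) = (\<Oplus>d. pd e (Cot b c d) u * v d u)
      - (\<Oplus>d. (\<Oplus>k. \<Gamma> k e b u * Cot k c d u) * v d u) - (\<Oplus>d. (\<Oplus>k. \<Gamma> k e c u * Cot b k d u) * v d u)
      - (\<Oplus>k. (\<Oplus>d. Cot b c d u * \<Gamma> d e k u) * v k u)"
    proof -
      have "v d u * cov3 G Cot e b c d u = pd e (Cot b c d) u * v d u
      - (\<Oplus>k. \<Gamma> k e b u * Cot k c d u) * v d u - (\<Oplus>k. \<Gamma> k e c u * Cot b k d u) * v d u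
      - (\<Oplus>k. Cot b c k u * \<Gamma> k e d u) * v d u" for d
        unfolding cov3_def mult.commute[of "Cot b c _ u" "\<Gamma> _ e d u"] by (simp only: right_diff_distrib left_diff_distrib mult.commute[of "v d u"])
      then show ?thesis by (simp only: sum_subtractf)
    qed
    then show ?thesis using 1 2 3 by simp
  qed
  show ?thesis
  proof (unfold pdF, rule sum.cong[OF refl])
    fix e
    show "v e u * (\<Oplus>d. v d u * cov3 G Cot e b c d u) = (\<Oplus>d. v e u * v d u * cov3 G Cot e b c d u)"
      by (subst sum_distrib_left) (simp only: mult.assoc)
  qed
qed

lemma bach_zero_set:
  assumes "\<rho> u = 0"
  shows "N u * Bach c b u + K b c u = 0" "K b c u = K c b u"
  using normal_derivative_bach[of c b] dv_F_sym[of b c] unfolding dv_F[OF assms] by simp_all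

lemma Rl_v_zero: "(\<Oplus>d. Rl a b c d u * v d u) = - n a u * P b c u + n b u * P a c u
    - Pv a u * G u $ c $ b + Pv b u * G u $ c $ a"
  unfolding Rl_v[OF u] pd_\<rho>[OF u] using fu by simp

lemma weyl_v_zero: "(\<Oplus>d. weyl G a b c d u * v d u) = 0"
proof -
  have "weyl G a b c d u * v d u = Rl a b c d u * v d u - G u $ c $ a * (P b d u * v d u) + G u $ c $ b * (P a d u * v d u)
    - P a c u * (G u $ b $ d * v d u) + P b c u * (G u $ a $ d * v d u)" for d
    unfolding weyl_def G_sym[OF u, of d] by (simp only: ring_distribs mult_ac mult_minus_left mult_minus_right)
  then have "(\<Oplus>d. weyl G a b c d u * v d u) = (\<Oplus>d. Rl a b c d u * v d u) - G u $ c $ a * Pv b u + G u $ c $ b * Pv a u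
    - P a c u * (\<Oplus>d. G u $ b $ d * v d u) + P b c u * (\<Oplus>d. G u $ a $ d * v d u)"
    by (simp only: sum.distrib sum_subtractf sum_distrib_left)
  then show ?thesis
    unfolding v_lower[OF u] Rl_v_zero by simp
qed

end
end

section \<open>Curvature of the zero set\<close>

text \<open>The situation after the normalising conformal change: f and \<rho> both vanish along
  \<phi>, so the Hessian of f does as well. The zero set, umbilic in every scale, is totally
  geodesic in this one.\<close>

locale umbilic_hypersurface = almost_einstein_region W G f \<rho> + S: metric_region V H
  for W :: "(real^'m::finite) set" and G f \<rho>
    and V :: "(real^'k::finite) set" and H :: "real^'k \<Rightarrow> real^'k^'k" +
  fixes \<phi> :: "real^'k \<Rightarrow> real^'m"
  assumes \<phi>_smooth: "smooth_map_on V \<phi>"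
    and \<phi>_in: "\<And>x. x \<in> V \<Longrightarrow> \<phi> x \<in> W"
    and f_\<phi>: "\<And>x. x \<in> V \<Longrightarrow> f (\<phi> x) = 0"
    and \<rho>_\<phi>: "\<And>x. x \<in> V \<Longrightarrow> \<rho> (\<phi> x) = 0"
    and N_\<phi>: "\<And>x. x \<in> V \<Longrightarrow> N (\<phi> x) \<noteq> 0"
    and H_pullback: "\<And>x a b. x \<in> V \<Longrightarrow> H x $ a $ b =
      (\<Oplus>i. (\<Oplus>j. G (\<phi> x) $ i $ j * pd b (\<lambda>x. \<phi> x $ j) x) * pd a (\<lambda>x. \<phi> x $ i) x)"
    and dim_m: "CARD('m) = 5" and dim_k: "CARD('k) = 4"
begin

abbreviation X where "X i a \<equiv> pd a (\<lambda>x. \<phi> x $ i)"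

text \<open>Pullback of one index along \<open>\<phi>\<close>.\<close>

definition C where "C x a T = (\<Oplus>i. T i * X i a x)"

lemma sm_X [simp]: "smooth_on V (X i a)"
  using \<phi>_smooth by (simp add: smooth_map_on_def)

lemma C_add: "C x a (\<lambda>i. S i + T i) = C x a S + C x a T"
  by (simp add: C_def distrib_right sum.distrib)

lemma C_diff: "C x a (\<lambda>i. S i - T i) = C x a S - C x a T"
  by (simp add: C_def left_diff_distrib sum_subtractf)

lemma C_mult: "C x a (\<lambda>i. r * T i) = r * C x a T"
  by (simp add: C_def sum_distrib_left mult.assoc)

lemma C_mult': "C x a (\<lambda>i. T i * r) = C x a T * r"
  using C_mult[of x a r T] by (simp add: mult.commute)

lemma C_divide: "C x a (\<lambda>i. T i / r) = C x a T / r"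
  using C_mult'[of x a T "inverse r"] by (simp add: divide_inverse)

lemma C_sum: "C x a (\<lambda>i. \<Oplus>e. T e i) = (\<Oplus>e. C x a (\<lambda>i. T e i))"
  unfolding C_def sum_distrib_right by (rule sum.swap)

lemma C_zero: "C x a (\<lambda>i. 0) = 0"
  by (simp add: C_def)

lemma C_swap: "C x a (\<lambda>i. C x b (\<lambda>j. T i j)) = C x b (\<lambda>j. C x a (\<lambda>i. T i j))"
  unfolding C_def sum_distrib_right by (subst sum.swap) (simp add: mult_ac)

lemma sm_C [simp]: "(\<And>i. smooth_on V (T i)) \<Longrightarrow> smooth_on V (\<lambda>x. C x a (\<lambda>i. T i x))"
  unfolding C_def by simp

lemma sm_\<phi> [simp]: "sm t \<Longrightarrow> smooth_on V (\<lambda>x. t (\<phi> x))"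
  by (rule smooth_on_compose[OF S.open_W open_W \<phi>_in \<phi>_smooth])

lemma pd_\<phi>: "x \<in> V \<Longrightarrow> sm t \<Longrightarrow> pd c (\<lambda>x. t (\<phi> x)) x = C x c (\<lambda>k. pd k t (\<phi> x))"
  unfolding C_def
proof (rule pd_compose(1))
  show "(\<lambda>x. \<phi> x $ k) differentiable (at x)" if "x \<in> V" for k
    using \<phi>_smooth that by (auto simp: smooth_map_on_def intro: smooth_on_differentiable)
  show "t differentiable (at (\<phi> x))" if "x \<in> V" "sm t"
    using smooth_on_differentiable[OF that(2) \<phi>_in[OF that(1)]] .
qed

context
  fixes x assumes x: "x \<in> V"
begin

lemma H_C: "H x $ a $ b = C x a (\<lambda>i. C x b (\<lambda>j. G (\<phi> x) $ i $ j))"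
  unfolding C_def H_pullback[OF x] ..

lemma n_X: "C x a (\<lambda>i. n i (\<phi> x)) = 0"
proof -
  have "pd a (\<lambda>x. f (\<phi> x)) x = pd a (\<lambda>x. 0) x"
    by (rule S.pd_cong[OF x f_\<phi>])
  then show ?thesis by (simp add: pd_\<phi>[OF x])
qed

lemma pd_X_sym: "pd a (X i b) x = pd b (X i a) x"
  by (rule S.pd_swap[OF x]) (use \<phi>_smooth in \<open>simp add: smooth_map_on_def\<close>)

lemma v_G: "(\<Oplus>j. v j (\<phi> x) * G (\<phi> x) $ i $ j) = n i (\<phi> x)"
  using v_lower[OF \<phi>_in[OF x], of i] by (simp only: mult.commute)

lemma v_n: "(\<Oplus>j. v j (\<phi> x) * n j (\<phi> x)) \<noteq> 0"
  by (rule N_\<phi>[OF x])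

text \<open>The principle by which identities along the hypersurface are verified:
  \<open>trace_tangential\<close> and \<open>gauss_formula\<close> are checked separately in
  tangential and normal directions.\<close>

lemma orthogonal_zero:
  fixes w :: "'m \<Rightarrow> real"
  assumes t: "\<And>c. C x c (\<lambda>i. \<Oplus>j. G (\<phi> x) $ i $ j * w j) = 0"
    and nw: "(\<Oplus>i. n i (\<phi> x) * w i) = 0"
  shows "w i = 0"
proof -
  fix z :: 'm
  obtain e :: "'k \<Rightarrow> 'm" where e: "inj e" "range e = - {z}"
    using obtain_complementary_index[where 'n='k and 'm='m, of z] dim_m dim_k by auto
  have sum_m: "(\<Oplus>r. Q r) = (\<Oplus>c. Q (e c)) + Q z" for Q :: "'m \<Rightarrow> real"
  proof -
    have U: "UNIV = insert z (range e)" and z: "z \<notin> range e"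
      using e(2) by auto
    have "(\<Oplus>r. Q r) = sum Q (insert z (range e))"
      by (rule arg_cong[OF U])
    also have "\<dots> = Q z + sum Q (range e)"
      using z by simp
    finally show ?thesis by (simp add: sum.reindex[OF e(1)])
  qed
  have ez: "e c \<noteq> z" for c using e(2) by auto
  \<comment> \<open>The coordinate vectors, lowered, and \<open>n\<close> are the rows of a square matrix with independent rows.\<close>
  define row where "row r i = (if r = z then n i (\<phi> x) else (\<Oplus>j. G (\<phi> x) $ j $ i * X j (inv e r) x))" for r i
  define M :: "real^'m^'m" where "M = (\<chi> r i. row r i)"
  have row_e: "row (e c) i = C x c (\<lambda>j. G (\<phi> x) $ j $ i)" and row_z: "row z i = n i (\<phi> x)" for c i
    by (simp_all add: row_def ez e(1) C_def)
  have "inj ((*v) (transpose M))"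
  proof (rule linear_injective_0[OF matrix_vector_mul_linear, THEN iffD2], intro allI impI)
    fix y assume "transpose M *v y = 0"
    then have "(transpose M *v y) $ i = 0" for i by simp
    then have y: "(\<Oplus>c. row (e c) i * y $ e c) + row z i * y $ z = 0" for i
      by (simp add: matrix_vector_mult_def transpose_def M_def sum_m)
    \<comment> \<open>In a linear relation between the rows, pairing with \<open>v\<close> isolates
      the coefficient of n, because |n|^2 is nonzero. Pairing with the tangent vectors then leaves
      their Gram matrix \<open>H\<close>, which is invertible.\<close>
    have "(\<Oplus>i. v i (\<phi> x) * row (e c) i) = 0" for c
    proof -
      have "(\<Oplus>i. v i (\<phi> x) * row (e c) i) = C x c (\<lambda>j. \<Oplus>i. v i (\<phi> x) * G (\<phi> x) $ j $ i)"
        unfolding row_e C_sum C_mult ..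
      then show ?thesis unfolding v_G n_X .
    qed
    moreover have "(\<Oplus>i. v i (\<phi> x) * ((\<Oplus>c. row (e c) i * y $ e c) + row z i * y $ z)) =
        (\<Oplus>c. (\<Oplus>i. v i (\<phi> x) * row (e c) i) * y $ e c) + (\<Oplus>i. v i (\<phi> x) * row z i) * y $ z"
      unfolding sum_assoc3[symmetric] by (simp only: distrib_left sum.distrib sum_distrib_right mult.assoc)
    ultimately have "(\<Oplus>i. v i (\<phi> x) * row z i) * y $ z = 0"
      unfolding y by simp
    then have yz: "y $ z = 0" using v_n unfolding row_z mult_eq_0_iff by blast
    have "(\<Oplus>c. H x $ b $ c * y $ e c) = 0" for b
    proof -
      have "C x b (\<lambda>i. \<Oplus>c. row (e c) i * y $ e c) = 0"
        using y yz by (simp add: C_zero)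
      moreover have "C x b (\<lambda>i. row (e c) i) = H x $ b $ c" for c
        unfolding row_e H_C by (subst C_swap, subst (2) C_swap) (simp add: G_sym[OF \<phi>_in[OF x]])
      ultimately show ?thesis unfolding C_sum C_mult' by simp
    qed
    then have "H x *v (\<chi> c. y $ e c) = 0"
      by (simp add: matrix_vector_mult_def vec_eq_iff)
    then have "(\<chi> c. y $ e c) = 0"
      using invertible_imp_inj[OF S.G_inv[OF x]] linear_injective_0[OF matrix_vector_mul_linear[of "H x"]] by blast
    then have "y $ e c = 0" for c
      by (simp add: vec_eq_iff)
    with yz show "y = 0"
      by (metis (no_types, lifting) e(2) ComplI rangeE singletonD vec_eq_iff zero_index)
  qed
  then have "invertible M"
    using inj_imp_invertible[of "transpose M"] by (simp add: invertible_det_nz)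
  moreover have "M *v (\<chi> i. w i) = 0"
  proof (unfold vec_eq_iff, intro allI)
    fix r
    have "(\<Oplus>i. row r i * w i) = 0"
    proof (cases "r = z")
      case False
      then obtain c where r: "r = e c" using e(2) by blast
      have "(\<Oplus>i. row (e c) i * w i) = C x c (\<lambda>j. \<Oplus>i. G (\<phi> x) $ j $ i * w i)"
        unfolding row_e C_sum C_mult' ..
      then show ?thesis unfolding r using t by simp
    qed (simp add: row_z nw)
    then show "(M *v (\<chi> i. w i)) $ r = 0 $ r"
      by (simp add: M_def matrix_vector_mult_def)
  qed
  ultimately have "(\<chi> i. w i) = 0"
    using invertible_imp_inj linear_injective_0[OF matrix_vector_mul_linear[of M]] by blast
  then show ?thesis by (simp add: vec_eq_iff)
qed

text \<open>The inverse induced metric pushed forward, \<open>E\<close>, is the ambient inverse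
  metric minus v v / |n|^2. Both sides agree against tangent vectors, where \<open>H\<close> inverts
  its own inverse, and against n.\<close>

lemma trace_tangential:
  "(\<Oplus>a. \<Oplus>b. S.gi a b x * C x a (\<lambda>i. C x b (\<lambda>j. T i j))) =
   (\<Oplus>i. \<Oplus>j. gi i j (\<phi> x) * T i j) - (\<Oplus>i. \<Oplus>j. v i (\<phi> x) * v j (\<phi> x) * T i j) / N (\<phi> x)"
proof -
  let ?u = "\<phi> x"
  note u = \<phi>_in[OF x]
  define E where "E i j = (\<Oplus>a. X i a x * (\<Oplus>b. S.gi a b x * X j b x))" for i j
  define v' where "v' = (\<lambda>j. v j ?u)"
  define N' where "N' = (\<Oplus>j. v' j * n j ?u)"
  have N': "N' \<noteq> 0" unfolding N'_def v'_def by (rule v_n)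
  have "E i j + v' i * v' j / N' - gi i j ?u = 0" for i j
  proof (rule orthogonal_zero[where w = "\<lambda>i. E i j + v' i * v' j / N' - gi i j ?u" for j])
    have GE: "(\<Oplus>i. G ?u $ k $ i * E i j) = (\<Oplus>a. (\<Oplus>i. G ?u $ k $ i * X i a x) * (\<Oplus>b. S.gi a b x * X j b x))" for k
      unfolding E_def by (rule sum_assoc3)
    have Gv: "(\<Oplus>i. G ?u $ k $ i * v' i) = n k ?u" for k
      using v_G[of k] unfolding v'_def by (simp only: mult.commute)
    show "C x c (\<lambda>k. \<Oplus>i. G ?u $ k $ i * (E i j + v' i * v' j / N' - gi i j ?u)) = 0" for c
    proof -
      have "(\<Oplus>i. G ?u $ k $ i * (E i j + v' i * v' j / N' - gi i j ?u)) =
        (\<Oplus>i. G ?u $ k $ i * E i j) + (\<Oplus>i. G ?u $ k $ i * v' i) * (v' j / N') - (\<Oplus>i. G ?u $ k $ i * gi i j ?u)" for k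
        by (simp add: distrib_left right_diff_distrib sum.distrib sum_subtractf sum_distrib_right sum_divide_distrib mult.assoc)
      then have "C x c (\<lambda>k. \<Oplus>i. G ?u $ k $ i * (E i j + v' i * v' j / N' - gi i j ?u)) =
        C x c (\<lambda>k. \<Oplus>i. G ?u $ k $ i * E i j) - C x c (\<lambda>k. if k = j then 1 else 0)"
        unfolding Gv G_gi[OF u] by (simp add: C_add C_diff C_mult' C_divide n_X)
      also have "C x c (\<lambda>k. \<Oplus>i. G ?u $ k $ i * E i j) =
          (\<Oplus>a. C x c (\<lambda>k. \<Oplus>i. G ?u $ k $ i * X i a x) * (\<Oplus>b. S.gi a b x * X j b x))"
        unfolding GE by (subst C_sum) (simp only: C_mult')
      also have "\<dots> = (\<Oplus>a. H x $ c $ a * (\<Oplus>b. S.gi a b x * X j b x))"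
        by (simp only: H_C C_def)
      also have "\<dots> = X j c x"
        by (rule S.lower_raise[OF x])
      also have "C x c (\<lambda>k. if k = j then 1 else 0) = X j c x"
        by (simp add: C_def)
      finally show ?thesis by simp
    qed
    have "(\<Oplus>i. n i ?u * E i j) = (\<Oplus>a. (\<Oplus>i. n i ?u * X i a x) * (\<Oplus>b. S.gi a b x * X j b x))"
      unfolding E_def by (rule sum_assoc3)
    then have "(\<Oplus>i. n i ?u * E i j) = 0"
      using n_X by (simp add: C_def)
    moreover have "(\<Oplus>i. n i ?u * v' i) = N'"
      unfolding N'_def by (simp only: mult.commute)
    moreover have "(\<Oplus>i. n i ?u * gi i j ?u) = v' j"
      unfolding v'_def by (simp only: gi_sym[OF u, of _ j] mult.commute)
    moreover have "(\<Oplus>i. n i ?u * (E i j + v' i * v' j / N' - gi i j ?u)) =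
        (\<Oplus>i. n i ?u * E i j) + (\<Oplus>i. n i ?u * v' i) * (v' j / N') - (\<Oplus>i. n i ?u * gi i j ?u)"
      by (simp add: distrib_left right_diff_distrib sum.distrib sum_subtractf sum_distrib_right sum_divide_distrib mult.assoc)
    ultimately show "(\<Oplus>i. n i ?u * (E i j + v' i * v' j / N' - gi i j ?u)) = 0"
      using N' by simp
  qed
  then have E: "E i j = gi i j ?u - v' i * v' j / N'" for i j
    by (simp add: algebra_simps add_eq_0_iff)
  have "(\<Oplus>a. \<Oplus>b. S.gi a b x * C x a (\<lambda>i. C x b (\<lambda>j. T i j))) =
    (\<Oplus>a. \<Oplus>b. \<Oplus>i. \<Oplus>j. X i a x * (S.gi a b x * X j b x) * T i j)"
    unfolding C_def by (simp add: sum_distrib_left sum_distrib_right mult_ac)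
  also have "\<dots> = (\<Oplus>a. \<Oplus>i. \<Oplus>j. \<Oplus>b. X i a x * (S.gi a b x * X j b x) * T i j)"
    by (intro sum.cong refl sum_rotate[symmetric])
  also have "\<dots> = (\<Oplus>i. \<Oplus>j. \<Oplus>a. \<Oplus>b. X i a x * (S.gi a b x * X j b x) * T i j)"
    by (rule sum_rotate[symmetric])
  also have "\<dots> = (\<Oplus>i. \<Oplus>j. E i j * T i j)"
    unfolding E_def by (simp add: sum_distrib_left sum_distrib_right mult_ac)
  also have "\<dots> = (\<Oplus>i. \<Oplus>j. gi i j ?u * T i j) - (\<Oplus>i. \<Oplus>j. v' i * v' j * T i j) / N'"
    unfolding E by (simp add: left_diff_distrib sum_subtractf sum_divide_distrib)
  finally show ?thesis
    by (simp only: v'_def N'_def)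
qed

end
end

section \<open>Gauss formula and restriction of covariant derivatives\<close>

context umbilic_hypersurface
begin

abbreviation \<Gamma>\<phi> where "\<Gamma>\<phi> i c k x \<equiv> C x c (\<lambda>j. \<Gamma> i j k (\<phi> x))"

lemma pd_C_raw: "x \<in> V \<Longrightarrow> (\<And>i. smooth_on V (T i)) \<Longrightarrow>
  pd c (\<lambda>x. C x a (\<lambda>i. T i x)) x = C x a (\<lambda>i. pd c (T i) x) + (\<Oplus>i. T i x * pd c (X i a) x)"
  unfolding C_def by (simp add: sum.distrib)

context
  fixes x assumes x: "x \<in> V"
begin

text \<open>The ambient covariant derivative, in direction \<open>a\<close>, of the coordinate
  vector field \<open>b\<close> along \<phi>.\<close>

definition Y where "Y i a b = pd a (X i b) x + C x b (\<lambda>k. \<Gamma>\<phi> i a k x)"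

lemma Y_sym: "Y i a b = Y i b a"
  unfolding Y_def pd_X_sym[OF x, of a b i]
  by (subst C_swap) (simp add: christoffel_sym[OF \<phi>_in[OF x]])

text \<open>Derivative of \<open>n_X\<close>. The Hessian of f, which would measure the second
  fundamental form, is zero along \<phi>.\<close>

lemma n_Y: "(\<Oplus>i. n i (\<phi> x) * Y i a b) = 0"
proof -
  have "pd a (\<lambda>x. C x b (\<lambda>i. n i (\<phi> x))) x = pd a (\<lambda>x. 0) x"
    by (rule S.pd_cong[OF x]) (rule n_X)
  then have 1: "C x b (\<lambda>i. C x a (\<lambda>k. pd k (n i) (\<phi> x))) + (\<Oplus>i. n i (\<phi> x) * pd a (X i b) x) = 0"
    by (simp add: pd_C_raw[OF x] pd_\<phi>[OF x])
  have 2: "(\<Oplus>i. n i (\<phi> x) * C x b (\<lambda>k. \<Gamma>\<phi> i a k x)) = C x b (\<lambda>k. C x a (\<lambda>j. \<Oplus>i. \<Gamma> i j k (\<phi> x) * n i (\<phi> x)))"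
    unfolding C_sum C_mult[symmetric] by (simp only: mult.commute)
  have "C x b (\<lambda>i. C x a (\<lambda>k. hessian G f k i (\<phi> x))) = 0"
    unfolding hess[OF \<phi>_in[OF x]] by (simp add: f_\<phi>[OF x] \<rho>_\<phi>[OF x] C_zero)
  then show ?thesis
    unfolding hessian_def Y_def distrib_left sum.distrib 2 C_diff using 1 by simp
qed

text \<open>Inner product of \<open>w\<close> with the tangent vector of index
  \<open>c\<close>.\<close>

definition g\<phi> where "g\<phi> w c = C x c (\<lambda>i. \<Oplus>j. G (\<phi> x) $ i $ j * w j)"

lemma pd_H: "pd a (\<lambda>x. H x $ b $ c) x = g\<phi> (\<lambda>j. Y j a b) c + g\<phi> (\<lambda>j. Y j a c) b"
proof -
  have t: "smooth_on V (\<lambda>x. G (\<phi> x) $ i $ j)" for i j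
    using sm_\<phi>[OF sm_G] .
  have "pd a (\<lambda>x. H x $ b $ c) x = pd a (\<lambda>x. C x b (\<lambda>i. C x c (\<lambda>j. G (\<phi> x) $ i $ j))) x"
    by (rule S.pd_cong[OF x H_C])
  also have "\<dots> = C x b (\<lambda>i. C x c (\<lambda>j. C x a (\<lambda>k. pd k (\<lambda>u. G u $ i $ j) (\<phi> x))))
    + C x b (\<lambda>i. \<Oplus>j. G (\<phi> x) $ i $ j * pd a (X j c) x) + (\<Oplus>i. C x c (\<lambda>j. G (\<phi> x) $ i $ j) * pd a (X i b) x)"
    by (simp add: pd_C_raw[OF x] t pd_\<phi>[OF x, of "\<lambda>u. G u $ _ $ _"] C_add)
  also have "(\<Oplus>i. C x c (\<lambda>j. G (\<phi> x) $ i $ j) * pd a (X i b) x) = C x c (\<lambda>i. \<Oplus>j. G (\<phi> x) $ i $ j * pd a (X j b) x)"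
    unfolding C_mult'[symmetric] C_sum[symmetric] by (simp add: G_sym[OF \<phi>_in[OF x]])
  also have "C x b (\<lambda>i. C x c (\<lambda>j. C x a (\<lambda>k. pd k (\<lambda>u. G u $ i $ j) (\<phi> x)))) =
     C x b (\<lambda>i. \<Oplus>e. G (\<phi> x) $ i $ e * C x c (\<lambda>j. \<Gamma>\<phi> e a j x)) + C x c (\<lambda>j. \<Oplus>e. G (\<phi> x) $ j $ e * C x b (\<lambda>i. \<Gamma>\<phi> e a i x))"
  proof -
    have "C x b (\<lambda>i. C x c (\<lambda>j. C x a (\<lambda>k. pd k (\<lambda>u. G u $ i $ j) (\<phi> x)))) =
       C x b (\<lambda>i. C x c (\<lambda>j. \<Oplus>e. G (\<phi> x) $ i $ e * \<Gamma>\<phi> e a j x))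
       + C x b (\<lambda>i. C x c (\<lambda>j. \<Oplus>e. G (\<phi> x) $ j $ e * \<Gamma>\<phi> e a i x))"
      unfolding pd_G[OF \<phi>_in[OF x]] by (simp add: C_add C_sum C_mult)
    also have "C x b (\<lambda>i. C x c (\<lambda>j. \<Oplus>e. G (\<phi> x) $ j $ e * \<Gamma>\<phi> e a i x)) =
      C x c (\<lambda>j. C x b (\<lambda>i. \<Oplus>e. G (\<phi> x) $ j $ e * \<Gamma>\<phi> e a i x))"
      by (rule C_swap)
    finally show ?thesis by (simp add: C_sum C_mult)
  qed
  finally show ?thesis
    unfolding g\<phi>_def Y_def by (simp add: distrib_left sum.distrib C_add)
qed

text \<open>\<open>Y\<close> has no normal part by \<open>n_Y\<close>. Its tangential part is fixed
  by the Koszul argument: symmetric by \<open>Y_sym\<close> and compatible with \<open>H\<close> by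
  \<open>pd_H\<close>, it has the Christoffel symbols of \<open>H\<close> as components.\<close>

lemma gauss_formula: "pd a (X i b) x = (\<Oplus>c. S.\<Gamma> c a b x * X i c x) - C x b (\<lambda>k. \<Gamma>\<phi> i a k x)"
proof -
  define w where "w i = Y i a b - (\<Oplus>c. S.\<Gamma> c a b x * X i c x)" for i
  have "w i = 0"
  proof (rule orthogonal_zero[OF x])
    have "C x c (\<lambda>i. \<Oplus>j. G (\<phi> x) $ i $ j * (\<Oplus>d. S.\<Gamma> d a b x * X j d x)) = S.\<Gamma>l c a b x" for c
    proof -
      have "(\<Oplus>j. G (\<phi> x) $ i $ j * (\<Oplus>d. S.\<Gamma> d a b x * X j d x)) = (\<Oplus>d. S.\<Gamma> d a b x * C x d (\<lambda>j. G (\<phi> x) $ i $ j))" for i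
        unfolding C_def by (rule sum_pull)
      then show ?thesis
        unfolding H_C[OF x] by (simp add: C_sum C_mult mult.commute)
    qed
    moreover have "S.\<Gamma>l c a b x = g\<phi> (\<lambda>j. Y j a b) c" for c
      unfolding S.christoffel_lower[OF x] pd_H using Y_sym[of _ a b] Y_sym[of _ a c] Y_sym[of _ b c] by simp
    ultimately show "C x c (\<lambda>i. \<Oplus>j. G (\<phi> x) $ i $ j * w j) = 0" for c
      unfolding w_def by (simp add: right_diff_distrib sum_subtractf C_diff g\<phi>_def)
    have "(\<Oplus>i. n i (\<phi> x) * (\<Oplus>c. S.\<Gamma> c a b x * X i c x)) = (\<Oplus>c. S.\<Gamma> c a b x * C x c (\<lambda>i. n i (\<phi> x)))"
      unfolding C_def by (rule sum_pull)
    then show "(\<Oplus>i. n i (\<phi> x) * w i) = 0"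
      unfolding w_def right_diff_distrib sum_subtractf n_Y by (simp add: n_X[OF x])
  qed
  then show ?thesis by (simp add: w_def Y_def)
qed

text \<open>Treats one index at a time, the remaining ones being parameters of \<open>T\<close>. The
  ambient Christoffel term completes the ambient covariant derivative; the intrinsic one is what
  \<open>cov2\<close> and \<open>cov3\<close> of \<open>H\<close> subtract. Total geodesy leaves no
  further term.\<close>

lemma pd_C:
  assumes "\<And>i. smooth_on V (T i)"
  shows "pd c (\<lambda>x. C x a (\<lambda>i. T i x)) x =
    C x a (\<lambda>i. pd c (T i) x - (\<Oplus>l. \<Gamma>\<phi> l c i x * T l x)) + (\<Oplus>e. S.\<Gamma> e c a x * C x e (\<lambda>i. T i x))"
proof -
  have "(\<Oplus>i. T i x * (\<Oplus>e. S.\<Gamma> e c a x * X i e x)) = (\<Oplus>e. S.\<Gamma> e c a x * C x e (\<lambda>i. T i x))"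
    unfolding C_def by (rule sum_pull)
  moreover have "(\<Oplus>i. T i x * C x a (\<lambda>k. \<Gamma>\<phi> i c k x)) = C x a (\<lambda>i. \<Oplus>l. \<Gamma>\<phi> l c i x * T l x)"
    by (simp add: C_sum C_mult C_mult' mult.commute)
  ultimately show ?thesis
    unfolding pd_C_raw[OF x assms] gauss_formula right_diff_distrib sum_subtractf C_diff by simp
qed

lemma cov2_pullback:
  assumes T: "\<And>i j. sm (T i j)"
    and S: "\<And>a b y. y \<in> V \<Longrightarrow> S a b y = C y a (\<lambda>i. C y b (\<lambda>j. T i j (\<phi> y)))"
  shows "cov2 H S c a b x = C x c (\<lambda>k. C x a (\<lambda>i. C x b (\<lambda>j. cov2 G T k i j (\<phi> x))))"
proof -
  have pdC: "pd c (\<lambda>y. C y b (\<lambda>j. T i j (\<phi> y))) x = C x b (\<lambda>j. C x c (\<lambda>k. pd k (T i j) (\<phi> x))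
       - (\<Oplus>l. \<Gamma>\<phi> l c j x * T i l (\<phi> x))) + (\<Oplus>e. S.\<Gamma> e c b x * C x e (\<lambda>j. T i j (\<phi> x)))" for i
    by (subst pd_C) (simp_all add: T pd_\<phi>[OF x])
  have "pd c (S a b) x = pd c (\<lambda>y. C y a (\<lambda>i. C y b (\<lambda>j. T i j (\<phi> y)))) x"
    by (rule S.pd_cong[OF x S])
  also have "\<dots> = C x a (\<lambda>i. pd c (\<lambda>y. C y b (\<lambda>j. T i j (\<phi> y))) x - (\<Oplus>l. \<Gamma>\<phi> l c i x * C x b (\<lambda>j. T l j (\<phi> x))))
      + (\<Oplus>e. S.\<Gamma> e c a x * C x e (\<lambda>i. C x b (\<lambda>j. T i j (\<phi> x))))"
    by (rule pd_C) (simp add: T)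
  also have "\<dots> = C x a (\<lambda>i. C x b (\<lambda>j. C x c (\<lambda>k. cov2 G T k i j (\<phi> x))))
      + (\<Oplus>e. S.\<Gamma> e c a x * S e b x) + (\<Oplus>e. S.\<Gamma> e c b x * S a e x)"
    unfolding pdC cov2_def S[OF x]
    by (simp add: C_add C_diff C_sum C_mult C_mult' algebra_simps)
  finally show ?thesis
    by (simp add: cov2_def[of H] C_swap[of _ c])
qed

lemma cov3_pullback:
  assumes T: "\<And>i j k. sm (T i j k)"
    and S: "\<And>a b c y. y \<in> V \<Longrightarrow> S a b c y = C y a (\<lambda>i. C y b (\<lambda>j. C y c (\<lambda>k. T i j k (\<phi> y))))"
  shows "cov3 H S d a b c x = C x d (\<lambda>l. C x a (\<lambda>i. C x b (\<lambda>j. C x c (\<lambda>k. cov3 G T l i j k (\<phi> x)))))"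
proof -
  have pdC: "pd d (\<lambda>y. C y c (\<lambda>k. T i j k (\<phi> y))) x = C x c (\<lambda>k. C x d (\<lambda>l. pd l (T i j k) (\<phi> x))
       - (\<Oplus>l. \<Gamma>\<phi> l d k x * T i j l (\<phi> x))) + (\<Oplus>e. S.\<Gamma> e d c x * C x e (\<lambda>k. T i j k (\<phi> x)))" for i j
    by (subst pd_C) (simp_all add: T pd_\<phi>[OF x])
  have pdCC: "pd d (\<lambda>y. C y b (\<lambda>j. C y c (\<lambda>k. T i j k (\<phi> y)))) x =
     C x b (\<lambda>j. pd d (\<lambda>y. C y c (\<lambda>k. T i j k (\<phi> y))) x - (\<Oplus>l. \<Gamma>\<phi> l d j x * C x c (\<lambda>k. T i l k (\<phi> x))))
      + (\<Oplus>e. S.\<Gamma> e d b x * C x e (\<lambda>j. C x c (\<lambda>k. T i j k (\<phi> x))))" for i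
    by (rule pd_C) (simp add: T)
  have "pd d (S a b c) x = pd d (\<lambda>y. C y a (\<lambda>i. C y b (\<lambda>j. C y c (\<lambda>k. T i j k (\<phi> y))))) x"
    by (rule S.pd_cong[OF x S])
  also have "\<dots> = C x a (\<lambda>i. pd d (\<lambda>y. C y b (\<lambda>j. C y c (\<lambda>k. T i j k (\<phi> y)))) x
      - (\<Oplus>l. \<Gamma>\<phi> l d i x * C x b (\<lambda>j. C x c (\<lambda>k. T l j k (\<phi> x)))))
      + (\<Oplus>e. S.\<Gamma> e d a x * C x e (\<lambda>i. C x b (\<lambda>j. C x c (\<lambda>k. T i j k (\<phi> x)))))"
    by (rule pd_C) (simp add: T)
  also have "\<dots> = C x a (\<lambda>i. C x b (\<lambda>j. C x c (\<lambda>k. C x d (\<lambda>l. cov3 G T l i j k (\<phi> x)))))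
      + (\<Oplus>e. S.\<Gamma> e d a x * S e b c x) + (\<Oplus>e. S.\<Gamma> e d b x * S a e c x) + (\<Oplus>e. S.\<Gamma> e d c x * S a b e x)"
    unfolding pdCC pdC cov3_def S[OF x]
    by (simp add: C_add C_diff C_sum C_mult C_mult' algebra_simps)
  finally show ?thesis
    by (simp add: cov3_def[of H] C_swap[of _ d])
qed

end

context
  fixes x assumes x: "x \<in> V"
begin

text \<open>Integrability condition of \<open>gauss_formula\<close>: the mixed partial derivatives
  of \<open>X i d\<close> agree. The second derivatives of \<phi> in \<open>D\<close> and the mixed
  products \<open>E a b + E b a\<close> are symmetric and drop out; \<open>M\<close> becomes the
  quadratic part of the ambient curvature.\<close>

lemma gauss_equation:
  "(\<Oplus>e. S.Rm a b e d x * X i e x) = C x d (\<lambda>k. C x a (\<lambda>m. C x b (\<lambda>j. Rm m j i k (\<phi> x))))"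
proof -
  note u = \<phi>_in[OF x]
  define M where "M a b = (\<Oplus>k. (\<Oplus>l. \<Gamma>\<phi> i a l x * \<Gamma>\<phi> l b k x) * X k d x)" for a b
  define D where "D a b = (\<Oplus>j. (C x d (\<lambda>k. \<Gamma> i j k (\<phi> x))) * pd a (X j b) x)" for a b
  define E where "E a b = (\<Oplus>e. S.\<Gamma> e a d x * C x e (\<lambda>k. \<Gamma>\<phi> i b k x))" for a b
  have pd\<Gamma>\<phi>: "pd a (\<Gamma>\<phi> i b k) x = C x b (\<lambda>j. C x a (\<lambda>m. pd m (\<Gamma> i j k) (\<phi> x)))
      + (\<Oplus>j. \<Gamma> i j k (\<phi> x) * pd a (X j b) x)" for a b k
    by (simp add: pd_C_raw[OF x] pd_\<phi>[OF x])
  have DD: "C x d (\<lambda>k. pd a (\<Gamma>\<phi> i b k) x) = C x d (\<lambda>k. C x a (\<lambda>m. C x b (\<lambda>j. pd m (\<Gamma> i j k) (\<phi> x)))) + D a b" for a b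
    unfolding pd\<Gamma>\<phi> D_def by (simp add: C_add C_sum C_mult' C_swap[of x b a])
  have X_C: "C x b (\<lambda>k. \<Gamma>\<phi> l a k x) = (\<Oplus>k. \<Gamma>\<phi> l a k x * X k b x)" for a b l
    unfolding C_def ..
  have dd: "pd a (pd b (X i d)) x = (\<Oplus>e. pd a (S.\<Gamma> e b d) x * X i e x) + (\<Oplus>f. (\<Oplus>e. S.\<Gamma> f a e x * S.\<Gamma> e b d x) * X i f x)
     - E b a - E a b - C x d (\<lambda>k. C x a (\<lambda>m. C x b (\<lambda>j. pd m (\<Gamma> i j k) (\<phi> x)))) - D a b + M b a" for a b
  proof -
    have "pd a (pd b (X i d)) x = pd a (\<lambda>x. (\<Oplus>e. S.\<Gamma> e b d x * X i e x) - C x d (\<lambda>k. \<Gamma>\<phi> i b k x)) x"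
      by (rule S.pd_cong[OF x]) (rule gauss_formula)
    also have "\<dots> = (\<Oplus>e. pd a (S.\<Gamma> e b d) x * X i e x) + (\<Oplus>e. S.\<Gamma> e b d x * pd a (X i e) x)
      - C x d (\<lambda>k. pd a (\<Gamma>\<phi> i b k) x) - (\<Oplus>k. \<Gamma>\<phi> i b k x * pd a (X k d) x)"
      using x by (simp add: sum.distrib pd_C_raw[OF x])
    also have "(\<Oplus>e. S.\<Gamma> e b d x * pd a (X i e) x) = (\<Oplus>f. (\<Oplus>e. S.\<Gamma> f a e x * S.\<Gamma> e b d x) * X i f x) - E b a"
      unfolding gauss_formula[OF x] right_diff_distrib sum_subtractf sum_assoc3 E_def by (simp add: mult.commute)
    also have "(\<Oplus>k. \<Gamma>\<phi> i b k x * pd a (X k d) x) = E a b - M b a"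
    proof -
      have "(\<Oplus>k. \<Gamma>\<phi> i b k x * (\<Oplus>e. S.\<Gamma> e a d x * X k e x)) = E a b"
        unfolding E_def X_C by (rule sum_pull)
      moreover have "(\<Oplus>k. \<Gamma>\<phi> i b k x * (\<Oplus>l. \<Gamma>\<phi> k a l x * X l d x)) = M b a"
        unfolding M_def by (rule sum_assoc3)
      ultimately show ?thesis
        unfolding gauss_formula[OF x] X_C right_diff_distrib sum_subtractf by simp
    qed
    finally show ?thesis unfolding DD by simp
  qed
  have MM: "M a b = C x d (\<lambda>k. C x a (\<lambda>m. C x b (\<lambda>j. \<Oplus>e. \<Gamma> i m e (\<phi> x) * \<Gamma> e j k (\<phi> x))))" for a b
  proof -
    have "M a b = C x d (\<lambda>k. \<Oplus>l. \<Gamma>\<phi> i a l x * \<Gamma>\<phi> l b k x)"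
      unfolding M_def C_def[of x d] ..
    then show ?thesis by (simp add: C_sum C_mult C_mult')
  qed
  have Dsym: "D a b = D b a"
    unfolding D_def by (simp add: pd_X_sym[OF x, of a])
  have s: "pd a (pd b (X i d)) x = pd b (pd a (X i d)) x"
    by (rule S.pd_swap[OF x]) simp
  have L: "(\<Oplus>e. S.Rm a b e d x * X i e x) = (\<Oplus>e. pd a (S.\<Gamma> e b d) x * X i e x) - (\<Oplus>e. pd b (S.\<Gamma> e a d) x * X i e x)
      + (\<Oplus>f. (\<Oplus>e. S.\<Gamma> f a e x * S.\<Gamma> e b d x) * X i f x) - (\<Oplus>f. (\<Oplus>e. S.\<Gamma> f b e x * S.\<Gamma> e a d x) * X i f x)"
    unfolding riemann_up_def by (simp only: left_diff_distrib distrib_right sum.distrib sum_subtractf)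
  have R: "C x d (\<lambda>k. C x a (\<lambda>m. C x b (\<lambda>j. Rm m j i k (\<phi> x)))) =
    C x d (\<lambda>k. C x a (\<lambda>m. C x b (\<lambda>j. pd m (\<Gamma> i j k) (\<phi> x))))
    - C x d (\<lambda>k. C x b (\<lambda>m. C x a (\<lambda>j. pd m (\<Gamma> i j k) (\<phi> x)))) + M a b - M b a"
    unfolding riemann_up_def MM by (simp only: C_add C_diff C_swap[of x b a])
  show ?thesis
    unfolding L R using s Dsym unfolding dd by simp
qed

lemma Rl_pullback:
  "S.Rl a b c d x = C x a (\<lambda>m. C x b (\<lambda>j. C x c (\<lambda>i. C x d (\<lambda>k. Rl m j i k (\<phi> x)))))"
proof -
  have "S.Rl a b c d x = C x c (\<lambda>l. \<Oplus>i. G (\<phi> x) $ l $ i * (\<Oplus>e. S.Rm a b e d x * X i e x))"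
  proof -
    have "(\<Oplus>i. G (\<phi> x) $ l $ i * (\<Oplus>e. S.Rm a b e d x * X i e x)) = (\<Oplus>e. S.Rm a b e d x * C x e (\<lambda>i. G (\<phi> x) $ l $ i))" for l
      unfolding C_def by (rule sum_pull)
    then show ?thesis
      unfolding riemann_def[of H] H_C[OF x] by (simp add: C_sum C_mult mult.commute)
  qed
  also have "\<dots> = C x c (\<lambda>l. C x d (\<lambda>k. C x a (\<lambda>m. C x b (\<lambda>j. Rl m j l k (\<phi> x)))))"
    unfolding gauss_equation riemann_def by (simp add: C_sum C_mult)
  also have "\<dots> = C x a (\<lambda>m. C x b (\<lambda>j. C x c (\<lambda>i. C x d (\<lambda>k. Rl m j i k (\<phi> x)))))"
    by (simp only: C_swap[of x d a] C_swap[of x d b] C_swap[of x c a] C_swap[of x c b])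
  finally show ?thesis .
qed

end
end

context metric_region
begin

lemma weyl_antisym2: "u \<in> W \<Longrightarrow> weyl G a b c d u = - weyl G a b d c u"
  unfolding weyl_def using Rl_antisym2[of u a b c d] by simp

lemma weyl_pair_sym: "u \<in> W \<Longrightarrow> weyl G a b c d u = weyl G c d a b u"
  unfolding weyl_def using Rl_pair_sym[of u a b c d] P_sym[of u b d] P_sym[of u a d] P_sym[of u a c] P_sym[of u b c]
    G_sym[of u a c] G_sym[of u b c] G_sym[of u a d] G_sym[of u b d] by simp

lemma cov3_Cot_antisym: "u \<in> W \<Longrightarrow> cov3 G Cot e a b c u = - cov3 G Cot e a c b u"
proof -
  assume u: "u \<in> W"
  have C: "Cot a c b = (\<lambda>x. - Cot a b c x)" for a b c
    by (rule ext) (simp add: cotton_def)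
  have p: "pd e (Cot a c b) u = - pd e (Cot a b c) u"
    unfolding C[of a b c] using u by simp
  have q: "Cot a c b u = - Cot a b c u" for a b c
    using C[of a c b] by simp
  have r: "(\<Oplus>k. \<Gamma> k e a u * Cot k c b u) = - (\<Oplus>k. \<Gamma> k e a u * Cot k b c u)"
    "(\<Oplus>k. \<Gamma> k e c u * Cot a k b u) = - (\<Oplus>k. \<Gamma> k e c u * Cot a b k u)"
    "(\<Oplus>k. \<Gamma> k e b u * Cot a c k u) = - (\<Oplus>k. \<Gamma> k e b u * Cot a k c u)"
    by (simp_all only: sum_negf[symmetric] mult_minus_right[symmetric] q[symmetric])
  show ?thesis
    unfolding cov3_def p r by simp
qed

end

section \<open>Schouten, Cotton, Weyl and Bach tensors of the hypersurface\<close>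

context umbilic_hypersurface
begin

context
  fixes x assumes x: "x \<in> V"
begin

lemma sum_C: "(\<Oplus>a. A a * C x b (\<lambda>j. T a j)) = C x b (\<lambda>j. \<Oplus>a. A a * T a j)"
  by (simp add: C_sum C_mult)

lemma sum_sum_C: "(\<Oplus>a. \<Oplus>c. A a c * C x b (\<lambda>j. T a c j)) = C x b (\<lambda>j. \<Oplus>a. \<Oplus>c. A a c * T a c j)"
  by (simp add: C_sum C_mult)

text \<open>The normal contribution to be subtracted when the Gauss equation is traced;
  \<open>Rl_v_zero\<close> expresses it through the Schouten tensor.\<close>

lemma v_v_Rl: "(\<Oplus>m. \<Oplus>i. v m (\<phi> x) * v i (\<phi> x) * Rl m j i k (\<phi> x)) =
  N (\<phi> x) * P j k (\<phi> x) - n j (\<phi> x) * Pv k (\<phi> x) - n k (\<phi> x) * Pv j (\<phi> x)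
    + (\<Oplus>m. v m (\<phi> x) * Pv m (\<phi> x)) * G (\<phi> x) $ j $ k"
proof -
  note u = \<phi>_in[OF x]
  have d5: "CARD('m) = 5" by (rule dim_m)
  have R: "Rl m j i k (\<phi> x) = Rl j m k i (\<phi> x)" for m i
    using Rl_antisym1[OF u, of m j i k] Rl_antisym2[OF u, of j m i k] by simp
  have "(\<Oplus>i. v m (\<phi> x) * v i (\<phi> x) * Rl m j i k (\<phi> x)) =
      v m (\<phi> x) * (\<Oplus>i. Rl j m k i (\<phi> x) * v i (\<phi> x))" for m
    unfolding R by (subst sum_distrib_left) (simp only: mult_ac)
  then have "(\<Oplus>m. \<Oplus>i. v m (\<phi> x) * v i (\<phi> x) * Rl m j i k (\<phi> x)) =
      (\<Oplus>m. - n j (\<phi> x) * (P k m (\<phi> x) * v m (\<phi> x)) + (v m (\<phi> x) * n m (\<phi> x)) * P j k (\<phi> x)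
        - Pv j (\<phi> x) * (G (\<phi> x) $ k $ m * v m (\<phi> x)) + (v m (\<phi> x) * Pv m (\<phi> x)) * G (\<phi> x) $ j $ k)"
    unfolding Rl_v_zero[OF u f_\<phi>[OF x] N_\<phi>[OF x] d5]
    by (simp only: P_sym[OF u, of _ k] G_sym[OF u, of _ j]) (simp only: ring_distribs mult_ac mult_minus_left mult_minus_right)
  also have "\<dots> = - n j (\<phi> x) * Pv k (\<phi> x) + N (\<phi> x) * P j k (\<phi> x)
        - Pv j (\<phi> x) * (\<Oplus>m. G (\<phi> x) $ k $ m * v m (\<phi> x)) + (\<Oplus>m. v m (\<phi> x) * Pv m (\<phi> x)) * G (\<phi> x) $ j $ k"
    by (simp only: sum.distrib sum_subtractf sum_distrib_left sum_distrib_right)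
  finally show ?thesis
    unfolding v_lower[OF u] by simp
qed

text \<open>The trace of the ambient Schouten tensor over the tangent space. It turns out to be the
  \<open>J\<close> of the hypersurface.\<close>

definition J_tan where "J_tan = J (\<phi> x) - (\<Oplus>m. v m (\<phi> x) * Pv m (\<phi> x)) / N (\<phi> x)"

lemma trace_P_pullback: "(\<Oplus>a. \<Oplus>b. S.gi a b x * C x a (\<lambda>i. C x b (\<lambda>j. P i j (\<phi> x)))) = J_tan"
proof -
  have "(\<Oplus>i. \<Oplus>j. v i (\<phi> x) * v j (\<phi> x) * P i j (\<phi> x)) = (\<Oplus>m. v m (\<phi> x) * Pv m (\<phi> x))"
  proof (rule sum.cong[OF refl])
    fix i
    show "(\<Oplus>j. v i (\<phi> x) * v j (\<phi> x) * P i j (\<phi> x)) = v i (\<phi> x) * Pv i (\<phi> x)"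
      by (subst (2) sum_distrib_left) (simp only: mult_ac)
  qed
  then show ?thesis
    unfolding trace_tangential[OF x] J_tan_def
    using trace_P[OF \<phi>_in[OF x] dim3] by (simp only: trace_wrt_def)
qed

text \<open>The ambient Ricci tensor contains 3 P, and the normal contribution \<open>v_v_Rl\<close>
  removes one copy. The remaining 2 = 4 - 2 is the Schouten coefficient in dimension 4, so the shape
  already exhibits the restriction of P as the intrinsic Schouten tensor.\<close>

lemma Ric_pullback: "S.Ric b d x = 2 * C x b (\<lambda>j. C x d (\<lambda>k. P j k (\<phi> x))) + J_tan * H x $ b $ d"
proof -
  note u = \<phi>_in[OF x]
  define N' where "N' = N (\<phi> x)"
  define q where "q = (\<Oplus>m. v m (\<phi> x) * Pv m (\<phi> x))"
  have N': "N' \<noteq> 0" unfolding N'_def by (rule N_\<phi>[OF x])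
  have "S.Ric b d x = (\<Oplus>a. \<Oplus>c. S.gi a c x * S.Rl a b c d x)"
    unfolding ricci_def S.Rm_raise[OF x] ..
  also have "\<dots> = (\<Oplus>a. \<Oplus>c. S.gi a c x * C x b (\<lambda>j. C x d (\<lambda>k. C x a (\<lambda>m. C x c (\<lambda>i. Rl m j i k (\<phi> x))))))"
  proof -
    have "C x a (\<lambda>m. C x b (\<lambda>j. C x c (\<lambda>i. C x d (\<lambda>k. Rl m j i k (\<phi> x))))) =
      C x b (\<lambda>j. C x d (\<lambda>k. C x a (\<lambda>m. C x c (\<lambda>i. Rl m j i k (\<phi> x)))))" for a c
      by (simp only: C_swap[of x a b] C_swap[of x a d] C_swap[of x c d])
    then show ?thesis unfolding Rl_pullback[OF x] by (simp only:)
  qed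
  also have "\<dots> = C x b (\<lambda>j. C x d (\<lambda>k. \<Oplus>a. \<Oplus>c. S.gi a c x * C x a (\<lambda>m. C x c (\<lambda>i. Rl m j i k (\<phi> x)))))"
    by (simp only: sum_sum_C)
  also have "\<dots> = C x b (\<lambda>j. C x d (\<lambda>k. Ric j k (\<phi> x) - (N' * P j k (\<phi> x) - n j (\<phi> x) * Pv k (\<phi> x)
      - n k (\<phi> x) * Pv j (\<phi> x) + q * G (\<phi> x) $ j $ k) / N'))"
    unfolding trace_tangential[OF x] v_v_Rl N'_def[symmetric] q_def[symmetric]
    unfolding ricci_def Rm_raise[OF u] ..
  also have "\<dots> = C x b (\<lambda>j. C x d (\<lambda>k. 2 * P j k (\<phi> x) + J_tan * G (\<phi> x) $ j $ k)
       + n j (\<phi> x) * (C x d (\<lambda>k. Pv k (\<phi> x)) / N') + C x d (\<lambda>k. n k (\<phi> x)) * (Pv j (\<phi> x) / N'))"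
  proof -
    have "Ric j k (\<phi> x) - (N' * P j k (\<phi> x) - n j (\<phi> x) * Pv k (\<phi> x)
      - n k (\<phi> x) * Pv j (\<phi> x) + q * G (\<phi> x) $ j $ k) / N' =
      2 * P j k (\<phi> x) + J_tan * G (\<phi> x) $ j $ k + n j (\<phi> x) * (Pv k (\<phi> x) / N') + n k (\<phi> x) * (Pv j (\<phi> x) / N')" for j k
    proof -
      define p where "p k = Pv k (\<phi> x)" for k
      have J_tan: "J_tan = J (\<phi> x) - q / N'" unfolding J_tan_def q_def N'_def ..
      show ?thesis
        unfolding Ric_P[OF u dim3] p_def[symmetric] J_tan using N' dim_m by (simp add: field_simps)
    qed
    then show ?thesis by (simp only: C_add C_mult C_mult' C_divide)
  qed
  also have "\<dots> = 2 * C x b (\<lambda>j. C x d (\<lambda>k. P j k (\<phi> x))) + J_tan * H x $ b $ d"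
    unfolding n_X[OF x] H_C[OF x] by (simp only: C_add C_mult C_mult' n_X[OF x] mult_zero_left add_0_right)
  finally show ?thesis .
qed

lemma P_pullback: "S.P b d x = C x b (\<lambda>j. C x d (\<lambda>k. P j k (\<phi> x)))"
proof -
  have "trace_wrt H S.Ric x = 2 * (\<Oplus>a. \<Oplus>b. S.gi a b x * C x a (\<lambda>i. C x b (\<lambda>j. P i j (\<phi> x))))
    + J_tan * (\<Oplus>a. \<Oplus>b. S.gi a b x * H x $ a $ b)"
  proof -
    have "S.gi a b x * S.Ric a b x = 2 * (S.gi a b x * C x a (\<lambda>i. C x b (\<lambda>j. P i j (\<phi> x))))
      + J_tan * (S.gi a b x * H x $ a $ b)" for a b
      unfolding Ric_pullback by (simp only: ring_distribs mult_ac)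
    then show ?thesis unfolding trace_wrt_def by (simp only: sum.distrib sum_distrib_left)
  qed
  \<comment> \<open>2 from the restricted Schouten tensor and 4 from the trace of \<open>H\<close>;
    \<open>schouten_trace\<close> divides by 2 * (4 - 1) = 6.\<close>
  also have "\<dots> = 6 * J_tan"
    unfolding trace_P_pullback S.trace_G[OF x] using dim_k by simp
  finally have "S.J x = J_tan"
    using dim_k by (simp add: schouten_trace_def)
  then show ?thesis
    using dim_k by (simp add: schouten_def Ric_pullback)
qed

end

context
  fixes x assumes x: "x \<in> V"
begin

lemma Cot_pullback: "S.Cot a b c x = C x a (\<lambda>i. C x b (\<lambda>j. C x c (\<lambda>k. Cot i j k (\<phi> x))))"
proof -
  have "cov2 H S.P c a b x = C x c (\<lambda>k. C x a (\<lambda>i. C x b (\<lambda>j. cov2 G P k i j (\<phi> x))))" for a b c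
    by (rule cov2_pullback[OF x]) (simp_all add: P_pullback)
  then show ?thesis
    unfolding cotton_def by (simp only: C_diff C_swap[of x b a] C_swap[of x c a] C_swap[of x c b])
qed

end

context
  fixes x assumes x: "x \<in> V"
begin

lemma weyl_pullback: "weyl H a b c d x = C x a (\<lambda>i. C x b (\<lambda>j. C x c (\<lambda>k. C x d (\<lambda>l. weyl G i j k l (\<phi> x)))))"
proof -
  have 1: "C x a (\<lambda>i. C x b (\<lambda>j. C x c (\<lambda>k. C x d (\<lambda>l. A k i * B j l)))) =
    C x c (\<lambda>k. C x a (\<lambda>i. A k i)) * C x b (\<lambda>j. C x d (\<lambda>l. B j l))" for A B :: "'m \<Rightarrow> 'm \<Rightarrow> real"
    by (simp only: C_mult C_mult' C_swap[of x a c])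
  have 2: "C x a (\<lambda>i. C x b (\<lambda>j. C x c (\<lambda>k. C x d (\<lambda>l. A k j * B i l)))) =
    C x c (\<lambda>k. C x b (\<lambda>j. A k j)) * C x a (\<lambda>i. C x d (\<lambda>l. B i l))" for A B :: "'m \<Rightarrow> 'm \<Rightarrow> real"
    by (simp only: C_mult C_mult' C_swap[of x b c])
  have 3: "C x a (\<lambda>i. C x b (\<lambda>j. C x c (\<lambda>k. C x d (\<lambda>l. A l j * B i k)))) =
    C x d (\<lambda>l. C x b (\<lambda>j. A l j)) * C x a (\<lambda>i. C x c (\<lambda>k. B i k))" for A B :: "'m \<Rightarrow> 'm \<Rightarrow> real"
    by (simp only: C_mult C_mult' C_swap[of x b d])
  have 4: "C x a (\<lambda>i. C x b (\<lambda>j. C x c (\<lambda>k. C x d (\<lambda>l. A l i * B j k)))) =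
    C x d (\<lambda>l. C x a (\<lambda>i. A l i)) * C x b (\<lambda>j. C x c (\<lambda>k. B j k))" for A B :: "'m \<Rightarrow> 'm \<Rightarrow> real"
    by (simp only: C_mult C_mult' C_swap[of x a d])
  show ?thesis
    unfolding weyl_def Rl_pullback[OF x] P_pullback[OF x] H_C[OF x] C_diff 1 2 3 4 ..
qed

text \<open>Both terms of the Bach tensor are traces over the tangent space. For the Weyl term these
  equal the ambient traces, since the Weyl tensor is annihilated by \<open>v\<close>; for the
  divergence of the Cotton tensor they differ by \<open>K\<close> over |n|^2. The sum vanishes by
  \<open>bach_zero_set\<close>.\<close>

lemma bach_zero: "bach H a b x = 0"
proof -
  note u = \<phi>_in[OF x]
  let ?u = "\<phi> x"
  define N' where "N' = N ?u"
  have N': "N' \<noteq> 0" unfolding N'_def by (rule N_\<phi>[OF x])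
  have zero: "f ?u = 0" "N ?u \<noteq> 0" "CARD('m) = 5" "\<rho> ?u = 0"
    using f_\<phi>[OF x] \<rho>_\<phi>[OF x] dim_m by simp_all (rule N_\<phi>[OF x])
  have cov3: "cov3 H S.Cot e a c b x = C x a (\<lambda>i. C x b (\<lambda>j. C x e (\<lambda>k. C x c (\<lambda>l. cov3 G Cot k i l j ?u))))" for e c
  proof -
    have "cov3 H S.Cot e a c b x = C x e (\<lambda>k. C x a (\<lambda>i. C x c (\<lambda>l. C x b (\<lambda>j. cov3 G Cot k i l j ?u))))"
      by (rule cov3_pullback[OF x]) (simp_all add: Cot_pullback)
    then show ?thesis by (simp only: C_swap[of x e a] C_swap[of x e b] C_swap[of x c b])
  qed
  \<comment> \<open>The contracted slot stands third here and last in \<open>K\<close>, hence the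
    sign, which turns the subtraction in \<open>trace_tangential\<close> into an addition.\<close>
  have K1: "(\<Oplus>k. \<Oplus>l. v k ?u * v l ?u * cov3 G Cot k i l j ?u) = - K i j ?u" for i j
    unfolding sum_negf[symmetric] by (intro sum.cong refl, subst cov3_Cot_antisym[OF u]) (rule mult_minus_right)
  have 1: "(\<Oplus>c. \<Oplus>e. S.gi c e x * cov3 H S.Cot e a c b x) =
    C x a (\<lambda>i. C x b (\<lambda>j. (\<Oplus>k. \<Oplus>l. gi k l ?u * cov3 G Cot k i l j ?u) + K i j ?u / N'))"
  proof -
    have "(\<Oplus>c. \<Oplus>e. S.gi c e x * cov3 H S.Cot e a c b x) = (\<Oplus>e. \<Oplus>c. S.gi e c x * cov3 H S.Cot e a c b x)"
      by (subst sum.swap) (simp only: S.gi_sym[OF x, of _ e for e])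
    also have "\<dots> = C x a (\<lambda>i. C x b (\<lambda>j. \<Oplus>e. \<Oplus>c. S.gi e c x * C x e (\<lambda>k. C x c (\<lambda>l. cov3 G Cot k i l j ?u))))"
      unfolding cov3 by (simp only: sum_sum_C[OF x])
    finally show ?thesis
      unfolding trace_tangential[OF x] K1 N'_def by (simp only: minus_divide_left[symmetric] diff_minus_eq_add)
  qed
  have w4: "(\<Oplus>l. weyl G i j k l ?u * v l ?u) = 0" for i j k
    by (rule weyl_v_zero[OF u zero(1-3)])
  have w3: "(\<Oplus>k. v k ?u * weyl G i j k l ?u) = 0" for i j l
    using w4[of i j l] by (simp add: weyl_antisym2[OF u, of i j _ l] sum_negf mult.commute)
  have w1: "(\<Oplus>i. v i ?u * weyl G i j k l ?u) = 0" for j k l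
    using w3[of k l j] by (simp only: weyl_pair_sym[OF u, of _ j k l])
  have 2: "(\<Oplus>d. \<Oplus>c. (\<Oplus>e. \<Oplus>f. S.gi d e x * S.gi c f x * S.P e f x) * weyl H d a c b x) =
    C x a (\<lambda>i. C x b (\<lambda>j. \<Oplus>k. \<Oplus>l. (\<Oplus>e. \<Oplus>f. gi k e ?u * gi l f ?u * P e f ?u) * weyl G k i l j ?u))"
  proof -
    \<comment> \<open>If one factor is annihilated by \<open>v\<close>, the correction in
      \<open>trace_tangential\<close> vanishes and tangential and ambient contraction agree.\<close>
    have tr: "(\<Oplus>c. \<Oplus>f. S.gi c f x * (C x f (\<lambda>q. A q) * C x c (\<lambda>l. B l))) = (\<Oplus>l. \<Oplus>q. gi l q ?u * (A q * B l))"
      if "(\<Oplus>l. v l ?u * B l) = 0" for A B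
    proof -
      have "(\<Oplus>c. \<Oplus>f. S.gi c f x * (C x f (\<lambda>q. A q) * C x c (\<lambda>l. B l))) =
          (\<Oplus>c. \<Oplus>f. S.gi c f x * C x c (\<lambda>l. C x f (\<lambda>q. A q * B l)))"
        by (simp only: C_mult C_mult')
      moreover have "(\<Oplus>l. \<Oplus>q. v l ?u * v q ?u * (A q * B l)) = 0"
      proof -
        have "(\<Oplus>q. r * w q * (A q * b)) = (r * b) * (\<Oplus>q. w q * A q)" for r b :: real and w
          by (simp only: sum_distrib_left mult_ac)
        then have "(\<Oplus>q. v l ?u * v q ?u * (A q * B l)) = (v l ?u * B l) * (\<Oplus>q. v q ?u * A q)" for l .
        then show ?thesis
          using that by (simp only: sum_distrib_right[symmetric] mult_zero_left)
      qed
      ultimately show ?thesis unfolding trace_tangential[OF x] by simp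
    qed
    have wz: "(\<Oplus>l. v l ?u * C x e (\<lambda>i. B i l)) = 0" if "\<And>i. (\<Oplus>l. v l ?u * B i l) = 0" for e and B :: "'m \<Rightarrow> 'm \<Rightarrow> real"
    proof -
      have "(\<Oplus>l. v l ?u * C x e (\<lambda>i. B i l)) = C x e (\<lambda>i. \<Oplus>l. v l ?u * B i l)"
        by (rule sum_C[OF x])
      then show ?thesis using that by (simp only: C_zero)
    qed
    have "(\<Oplus>d. \<Oplus>c. (\<Oplus>e. \<Oplus>f. S.gi d e x * S.gi c f x * S.P e f x) * weyl H d a c b x) =
      (\<Oplus>d. \<Oplus>e. S.gi d e x * (\<Oplus>c. \<Oplus>f. S.gi c f x * (S.P e f x * weyl H d a c b x)))"
    proof (rule sum.cong[OF refl])
      fix d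
      have "(\<Oplus>c. (\<Oplus>e. \<Oplus>f. S.gi d e x * S.gi c f x * S.P e f x) * weyl H d a c b x) =
        (\<Oplus>c. \<Oplus>e. \<Oplus>f. S.gi d e x * (S.gi c f x * (S.P e f x * weyl H d a c b x)))"
        by (simp only: sum_distrib_right mult.assoc)
      also have "\<dots> = (\<Oplus>e. \<Oplus>c. \<Oplus>f. S.gi d e x * (S.gi c f x * (S.P e f x * weyl H d a c b x)))"
        by (rule sum.swap)
      finally show "(\<Oplus>c. (\<Oplus>e. \<Oplus>f. S.gi d e x * S.gi c f x * S.P e f x) * weyl H d a c b x) =
        (\<Oplus>e. S.gi d e x * (\<Oplus>c. \<Oplus>f. S.gi c f x * (S.P e f x * weyl H d a c b x)))"
        by (simp only: sum_distrib_left)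
    qed
    also have "\<dots> = (\<Oplus>d. \<Oplus>e. S.gi d e x * C x e (\<lambda>p. C x d (\<lambda>k. \<Oplus>l. \<Oplus>q. gi l q ?u *
        (P p q ?u * C x a (\<lambda>i. C x b (\<lambda>j. weyl G k i l j ?u))))))"
    proof (intro sum.cong refl arg_cong2[of _ _ _ _ "(*)"])
      fix d e
      have P': "S.P e f x = C x f (\<lambda>q. C x e (\<lambda>p. P p q ?u))" for f
        unfolding P_pullback[OF x] by (rule C_swap)
      have W': "weyl H d a c b x = C x c (\<lambda>l. C x d (\<lambda>k. C x a (\<lambda>i. C x b (\<lambda>j. weyl G k i l j ?u))))" for c
        unfolding weyl_pullback by (simp only: C_swap[of x _ c])
      have "(\<Oplus>c. \<Oplus>f. S.gi c f x * (S.P e f x * weyl H d a c b x)) =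
        (\<Oplus>l. \<Oplus>q. gi l q ?u * (C x e (\<lambda>p. P p q ?u) * C x d (\<lambda>k. C x a (\<lambda>i. C x b (\<lambda>j. weyl G k i l j ?u)))))"
        unfolding P' W' by (rule tr, (rule wz)+, rule w3)
      then show "(\<Oplus>c. \<Oplus>f. S.gi c f x * (S.P e f x * weyl H d a c b x)) =
        C x e (\<lambda>p. C x d (\<lambda>k. \<Oplus>l. \<Oplus>q. gi l q ?u * (P p q ?u * C x a (\<lambda>i. C x b (\<lambda>j. weyl G k i l j ?u)))))"
        by (simp only: C_sum C_mult C_mult')
    qed
    also have "\<dots> = (\<Oplus>d. \<Oplus>e. S.gi d e x * C x d (\<lambda>k. C x e (\<lambda>p. \<Oplus>l. \<Oplus>q. gi l q ?u *
        (P p q ?u * C x a (\<lambda>i. C x b (\<lambda>j. weyl G k i l j ?u))))))"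
      by (intro sum.cong refl arg_cong2[of _ _ _ _ "(*)"] C_swap)
    also have "\<dots> = (\<Oplus>k. \<Oplus>p. gi k p ?u * (\<Oplus>l. \<Oplus>q. gi l q ?u *
        (P p q ?u * C x a (\<lambda>i. C x b (\<lambda>j. weyl G k i l j ?u)))))"
    proof -
      have "(\<Oplus>k. v k ?u * (\<Oplus>l. \<Oplus>q. gi l q ?u * (P p q ?u * C x a (\<lambda>i. C x b (\<lambda>j. weyl G k i l j ?u))))) = 0" for p
      proof -
        have "(\<Oplus>k. v k ?u * (\<Oplus>l. \<Oplus>q. gi l q ?u * (P p q ?u * C x a (\<lambda>i. C x b (\<lambda>j. weyl G k i l j ?u))))) =
          (\<Oplus>l. \<Oplus>q. (gi l q ?u * P p q ?u) * (\<Oplus>k. v k ?u * C x a (\<lambda>i. C x b (\<lambda>j. weyl G k i l j ?u))))"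
        proof -
          define vv where "vv = (\<lambda>k. v k ?u)"
          have "(\<Oplus>k. vv k * (\<Oplus>l. \<Oplus>q. gi l q ?u * (P p q ?u * Q k l))) =
            (\<Oplus>l. \<Oplus>q. (gi l q ?u * P p q ?u) * (\<Oplus>k. vv k * Q k l))" for Q
          proof -
            have "(\<Oplus>k. vv k * (\<Oplus>l. \<Oplus>q. gi l q ?u * (P p q ?u * Q k l))) =
              (\<Oplus>k. \<Oplus>l. \<Oplus>q. (gi l q ?u * P p q ?u) * (vv k * Q k l))"
              by (simp only: sum_distrib_left mult_ac)
            also have "\<dots> = (\<Oplus>l. \<Oplus>q. \<Oplus>k. (gi l q ?u * P p q ?u) * (vv k * Q k l))"
              by (rule sum_rotate[symmetric])
            finally show ?thesis by (simp only: sum_distrib_left)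
          qed
          then show ?thesis unfolding vv_def .
        qed
        moreover have "(\<Oplus>k. v k ?u * C x a (\<lambda>i. C x b (\<lambda>j. weyl G k i l j ?u))) = 0" for l
          by ((rule wz)+, rule w1)
        ultimately show ?thesis by simp
      qed
      then have z: "(\<Oplus>k. \<Oplus>p. v k ?u * v p ?u * (\<Oplus>l. \<Oplus>q. gi l q ?u * (P p q ?u * C x a (\<lambda>i. C x b (\<lambda>j. weyl G k i l j ?u))))) = 0"
      proof -
        define vv Q where "vv = (\<lambda>k. v k ?u)" and "Q k p = (\<Oplus>l. \<Oplus>q. gi l q ?u * (P p q ?u * C x a (\<lambda>i. C x b (\<lambda>j. weyl G k i l j ?u))))" for k p
        assume "\<And>p. (\<Oplus>k. v k ?u * (\<Oplus>l. \<Oplus>q. gi l q ?u * (P p q ?u * C x a (\<lambda>i. C x b (\<lambda>j. weyl G k i l j ?u))))) = 0"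
        then have Q: "(\<Oplus>k. vv k * Q k p) = 0" for p unfolding vv_def Q_def .
        have "(\<Oplus>k. \<Oplus>p. vv k * vv p * Q k p) = (\<Oplus>p. \<Oplus>k. vv k * vv p * Q k p)"
          by (rule sum.swap)
        also have "\<dots> = (\<Oplus>p. vv p * (\<Oplus>k. vv k * Q k p))"
          by (simp only: sum_distrib_left mult_ac)
        finally have "(\<Oplus>k. \<Oplus>p. vv k * vv p * Q k p) = 0"
          by (simp add: Q)
        then show ?thesis unfolding vv_def Q_def .
      qed
      show ?thesis unfolding trace_tangential[OF x] z by simp
    qed
    also have "\<dots> = C x a (\<lambda>i. C x b (\<lambda>j. \<Oplus>k. \<Oplus>p. gi k p ?u * (\<Oplus>l. \<Oplus>q. gi l q ?u * (P p q ?u * weyl G k i l j ?u))))"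
      by (simp only: C_sum C_mult)
    also have "\<dots> = C x a (\<lambda>i. C x b (\<lambda>j. \<Oplus>k. \<Oplus>l. (\<Oplus>e. \<Oplus>f. gi k e ?u * gi l f ?u * P e f ?u) * weyl G k i l j ?u))"
    proof -
      have "(\<Oplus>p. gi k p ?u * (\<Oplus>l. \<Oplus>q. gi l q ?u * (P p q ?u * w l))) = (\<Oplus>l. (\<Oplus>e. \<Oplus>f. gi k e ?u * gi l f ?u * P e f ?u) * w l)" for k w
      proof -
        have "(\<Oplus>p. gi k p ?u * (\<Oplus>l. \<Oplus>q. gi l q ?u * (P p q ?u * w l))) = (\<Oplus>p. \<Oplus>l. \<Oplus>q. gi k p ?u * (gi l q ?u * (P p q ?u * w l)))"
          by (simp only: sum_distrib_left)
        also have "\<dots> = (\<Oplus>l. \<Oplus>p. \<Oplus>q. gi k p ?u * (gi l q ?u * (P p q ?u * w l)))"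
          by (rule sum.swap)
        finally show ?thesis by (simp only: sum_distrib_right mult.assoc)
      qed
      then show ?thesis by simp
    qed
    finally show ?thesis .
  qed
  have "bach H a b x = C x a (\<lambda>i. C x b (\<lambda>j. (\<Oplus>k. \<Oplus>l. gi k l ?u * cov3 G Cot k i l j ?u) + K i j ?u / N'
     + (\<Oplus>k. \<Oplus>l. (\<Oplus>e. \<Oplus>f. gi k e ?u * gi l f ?u * P e f ?u) * weyl G k i l j ?u)))"
    unfolding bach_def 1 2 by (simp only: C_add)
  moreover have "(\<Oplus>k. \<Oplus>l. gi k l ?u * cov3 G Cot k i l j ?u) + K i j ?u / N'
     + (\<Oplus>k. \<Oplus>l. (\<Oplus>e. \<Oplus>f. gi k e ?u * gi l f ?u * P e f ?u) * weyl G k i l j ?u) = 0" for i j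
  proof -
    define Bach' where "Bach' = Bach i j ?u"
    define K' where "K' = K i j ?u"
    have "N' * Bach' + K' = 0"
      using bach_zero_set[OF u zero, of i j] unfolding N'_def Bach'_def K'_def by simp
    then have "Bach' + K' / N' = 0"
      using N' by (simp add: field_simps)
    then show ?thesis
      unfolding schouten_weyl[OF u dim3] Bach'_def K'_def by (simp only: add_ac diff_conv_add_uminus)
  qed
  ultimately show ?thesis by (simp only: C_zero)
qed

end
end

section \<open>Conformal change\<close>

locale conformal_change = metric_region W G for W :: "(real^'n::finite) set" and G +
  fixes \<omega> :: "real^'n \<Rightarrow> real"
  assumes sm_\<omega> [simp]: "smooth_on W \<omega>"
begin

definition G' where "G' u = exp (2 * \<omega> u) *\<^sub>R G u"

abbreviation \<omega>d where "\<omega>d a \<equiv> pd a \<omega>"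
abbreviation \<omega>u where "\<omega>u a u \<equiv> (\<Oplus>b. gi a b u * \<omega>d b u)"
abbreviation \<omega>n where "\<omega>n u \<equiv> (\<Oplus>a. \<omega>d a u * \<omega>u a u)"
abbreviation H\<omega> where "H\<omega> \<equiv> hessian G \<omega>"
abbreviation \<Gamma>t where "\<Gamma>t a u \<equiv> (\<Oplus>k. \<Gamma> k k a u)"

text \<open>The difference tensor of the Levi-Civita connections of \<open>G'\<close> and
  \<open>G\<close>; see \<open>christoffel'\<close>.\<close>

definition U where "U c a b u = (if c = a then 1 else 0) * \<omega>d b u + (if c = b then 1 else 0) * \<omega>d a u - G u $ a $ b * \<omega>u c u"

lemma sm_exp [simp]: "sm h \<Longrightarrow> sm (\<lambda>x. exp (h x))"
  by (rule smooth_on_exp[OF open_W])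

lemma pd_exp_W: "u \<in> W \<Longrightarrow> sm h \<Longrightarrow> pd a (\<lambda>x. exp (h x)) u = exp (h u) * pd a h u"
  by (rule pd_exp(1)) (rule smooth_on_differentiable)

lemma sm_U [simp]: "sm (U c a b)"
  unfolding U_def[abs_def] by (cases "c = a"; cases "c = b") simp_all

sublocale C: metric_region W G'
proof
  show "sm (\<lambda>u. G' u $ a $ b)" for a b
    unfolding G'_def by simp
  show "G' u $ a $ b = G' u $ b $ a" if "u \<in> W" for u a b
    using G_sym[OF that] by (simp add: G'_def)
  show "invertible (G' u)" if "u \<in> W" for u
  proof (rule inj_imp_invertible, rule injI)
    fix y z assume "G' u *v y = G' u *v z"
    then have "G u *v y = G u *v z"
      by (simp add: G'_def scaleR_matrix_vector_assoc[symmetric])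
    then show "y = z"
      using invertible_imp_inj[OF G_inv[OF that]] by (simp add: inj_def)
  qed
qed

context
  fixes u assumes u: "u \<in> W"
begin

lemma gi': "C.gi a b u = exp (- 2 * \<omega> u) * gi a b u"
proof -
  define E where "E = exp (2 * \<omega> u)"
  have E: "exp (- 2 * \<omega> u) * E = 1" unfolding E_def by (simp add: exp_add[symmetric])
  have "gi a b u = (\<Oplus>c. (\<Oplus>d. C.gi a d u * G' u $ d $ c) * gi c b u)"
    unfolding C.gi_G[OF u] by simp
  also have "\<dots> = (\<Oplus>d. C.gi a d u * (E * (\<Oplus>c. G u $ d $ c * gi c b u)))"
    unfolding sum_assoc3[symmetric] by (simp add: G'_def E_def[symmetric] sum_distrib_left mult.assoc)
  also have "\<dots> = C.gi a b u * E"
    unfolding G_gi[OF u] by (simp add: if_distrib[of "\<lambda>x. _ * x"] cong: if_cong)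
  finally show ?thesis
    using E by (simp add: mult.left_commute)
qed

lemma \<omega>_lower: "(\<Oplus>b. G u $ a $ b * \<omega>u b u) = \<omega>d a u" "(\<Oplus>b. G u $ b $ a * \<omega>u b u) = \<omega>d a u"
  using lower_raise[OF u, of a] G_sym[OF u, of _ a] by simp_all

lemma christoffel': "C.\<Gamma> c a b u = \<Gamma> c a b u + U c a b u"
proof -
  define E where "E = exp (2 * \<omega> u)"
  have E: "exp (- 2 * \<omega> u) * E = 1" unfolding E_def by (simp add: exp_add[symmetric])
  have pdG': "pd a (\<lambda>v. G' v $ b $ e) u = E * (pd a (\<lambda>v. G v $ b $ e) u + 2 * \<omega>d a u * G u $ b $ e)" for a b e
    using u unfolding G'_def by (simp add: pd_exp_W E_def algebra_simps)
  have "C.\<Gamma> c a b u = 1/2 * (\<Oplus>e. (exp (- 2 * \<omega> u) * E) * (gi c e u * ((pd a (\<lambda>v. G v $ b $ e) u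
      + pd b (\<lambda>v. G v $ a $ e) u - pd e (\<lambda>v. G v $ a $ b) u)
      + 2 * \<omega>d a u * G u $ b $ e + 2 * \<omega>d b u * G u $ a $ e - 2 * \<omega>d e u * G u $ a $ b)))"
    unfolding christoffel_def[of G'] gi' pdG' by (simp add: algebra_simps)
  also have "\<dots> = 1/2 * (\<Oplus>e. gi c e u * (pd a (\<lambda>v. G v $ b $ e) u
      + pd b (\<lambda>v. G v $ a $ e) u - pd e (\<lambda>v. G v $ a $ b) u))
      + \<omega>d a u * (\<Oplus>e. gi c e u * G u $ b $ e) + \<omega>d b u * (\<Oplus>e. gi c e u * G u $ a $ e) - G u $ a $ b * \<omega>u c u"
    unfolding E by (simp add: algebra_simps sum.distrib sum_subtractf sum_distrib_left)
  finally have 1: "C.\<Gamma> c a b u = 1/2 * (\<Oplus>e. gi c e u * (pd a (\<lambda>v. G v $ b $ e) u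
      + pd b (\<lambda>v. G v $ a $ e) u - pd e (\<lambda>v. G v $ a $ b) u))
      + \<omega>d a u * (\<Oplus>e. gi c e u * G u $ b $ e) + \<omega>d b u * (\<Oplus>e. gi c e u * G u $ a $ e) - G u $ a $ b * \<omega>u c u" .
  have 2: "(\<Oplus>e. gi c e u * G u $ b $ e) = (if c = b then 1 else 0)" for b
    using gi_G[OF u, of c b] by (simp add: G_sym[OF u, of b])
  show ?thesis
    unfolding 1 2 christoffel_def[of G] U_def by (simp add: mult.commute)
qed

lemma pd_\<omega>u: "pd a (\<omega>u c) u = (\<Oplus>b. gi c b u * H\<omega> a b u) - (\<Oplus>e. \<Gamma> c a e u * \<omega>u e u)"
  unfolding hessian_def by (rule pd_raise[OF u]) simp

lemma U_trace: "(\<Oplus>a. U a a d u) = real CARD('n) * \<omega>d d u"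
  unfolding U_def sum.distrib sum_subtractf sum_delta_mult \<omega>_lower by simp

lemma pd_U: "(\<Oplus>a. pd a (U a b d) u) = pd b (\<omega>d d) u + pd d (\<omega>d b) u
    - (\<Oplus>a. (\<Gamma>l b a d u + \<Gamma>l d a b u) * \<omega>u a u)
    - G u $ b $ d * (trace_wrt G H\<omega> u - (\<Oplus>e. \<Gamma>t e u * \<omega>u e u))"
proof -
  have "pd a (U a b d) u = (if a = b then 1 else 0) * pd a (\<omega>d d) u + (if a = d then 1 else 0) * pd a (\<omega>d b) u
    - (\<Gamma>l b a d u + \<Gamma>l d a b u) * \<omega>u a u - G u $ b $ d * pd a (\<omega>u a) u" for a
    using u unfolding U_def by (cases "a = b"; cases "a = d") (simp_all add: pd_G[OF u] diff_diff_eq add.commute)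
  then have "(\<Oplus>a. pd a (U a b d) u) = pd b (\<omega>d d) u + pd d (\<omega>d b) u
    - (\<Oplus>a. (\<Gamma>l b a d u + \<Gamma>l d a b u) * \<omega>u a u) - G u $ b $ d * (\<Oplus>a. pd a (\<omega>u a) u)"
    by (simp only: sum.distrib sum_subtractf sum_delta_mult sum_distrib_left)
  moreover have "(\<Oplus>a. pd a (\<omega>u a) u) = trace_wrt G H\<omega> u - (\<Oplus>e. \<Gamma>t e u * \<omega>u e u)"
  proof -
    have "(\<Oplus>a. \<Oplus>e. \<Gamma> a a e u * \<omega>u e u) = (\<Oplus>e. \<Oplus>a. \<Gamma> a a e u * \<omega>u e u)"
      by (rule sum.swap)
    then show ?thesis
      unfolding pd_\<omega>u sum_subtractf trace_wrt_def by (simp only: sum_distrib_right)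
  qed
  ultimately show ?thesis by simp
qed

lemma \<Gamma>_U: "(\<Oplus>a. \<Oplus>e. \<Gamma> a a e u * U e b d u) =
    \<Gamma>t b u * \<omega>d d u + \<Gamma>t d u * \<omega>d b u - G u $ b $ d * (\<Oplus>e. \<Gamma>t e u * \<omega>u e u)"
proof -
  have "(\<Oplus>a. \<Oplus>e. \<Gamma> a a e u * U e b d u) = (\<Oplus>e. \<Gamma>t e u * U e b d u)"
    unfolding sum_distrib_right by (rule sum.swap)
  also have "\<dots> = (\<Oplus>e. (if e = b then 1 else 0) * (\<Gamma>t e u * \<omega>d d u) + (if e = d then 1 else 0) * (\<Gamma>t e u * \<omega>d b u)
      - G u $ b $ d * (\<Gamma>t e u * \<omega>u e u))"
    unfolding U_def by (simp only: ring_distribs mult_ac)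
  finally show ?thesis
    by (simp only: sum.distrib sum_subtractf sum_delta_mult sum_distrib_left)
qed

lemma \<Gamma>_U': "(\<Oplus>a. \<Oplus>e. \<Gamma> a b e u * U e a d u) =
    \<Gamma>t b u * \<omega>d d u + (\<Oplus>a. \<Gamma> a b d u * \<omega>d a u) - (\<Oplus>e. \<Gamma>l d b e u * \<omega>u e u)"
proof -
  have "(\<Oplus>e. \<Gamma> a b e u * U e a d u) = \<Gamma> a b a u * \<omega>d d u + \<Gamma> a b d u * \<omega>d a u - (\<Oplus>e. (G u $ d $ a * \<Gamma> a b e u) * \<omega>u e u)" for a
  proof -
    have "\<Gamma> a b e u * U e a d u = (if e = a then 1 else 0) * (\<Gamma> a b e u * \<omega>d d u)
      + (if e = d then 1 else 0) * (\<Gamma> a b e u * \<omega>d a u) - (G u $ d $ a * \<Gamma> a b e u) * \<omega>u e u" for e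
      unfolding U_def G_sym[OF u, of d a] by (simp only: ring_distribs mult_ac)
    then show ?thesis
      by (simp only: sum.distrib sum_subtractf sum_delta_mult)
  qed
  then have "(\<Oplus>a. \<Oplus>e. \<Gamma> a b e u * U e a d u) = (\<Oplus>a. \<Gamma> a b a u) * \<omega>d d u + (\<Oplus>a. \<Gamma> a b d u * \<omega>d a u)
      - (\<Oplus>a. \<Oplus>e. (G u $ d $ a * \<Gamma> a b e u) * \<omega>u e u)"
    by (simp only: sum.distrib sum_subtractf sum_distrib_right)
  also have "(\<Oplus>a. \<Oplus>e. (G u $ d $ a * \<Gamma> a b e u) * \<omega>u e u) = (\<Oplus>e. \<Gamma>l d b e u * \<omega>u e u)"
    unfolding sum_distrib_right by (rule sum.swap)
  also have "(\<Oplus>a. \<Gamma> a b a u) = \<Gamma>t b u"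
    by (intro sum.cong refl christoffel_sym[OF u])
  finally show ?thesis .
qed

lemma U_sym: "U c a b u = U c b a u"
  unfolding U_def using G_sym[OF u, of a b] by simp

lemma U_U: "(\<Oplus>a. \<Oplus>e. U a b e u * U e a d u) =
    (real CARD('n) + 2) * (\<omega>d b u * \<omega>d d u) - 2 * (\<omega>n u * G u $ b $ d)"
proof -
  have "(\<Oplus>e. U a b e u * U e a d u) = U a b a u * \<omega>d d u + U a b d u * \<omega>d a u - G u $ a $ d * (\<Oplus>e. U a b e u * \<omega>u e u)" for a
  proof -
    have "U a b e u * U e a d u = (if e = a then 1 else 0) * (U a b e u * \<omega>d d u)
      + (if e = d then 1 else 0) * (U a b e u * \<omega>d a u) - G u $ a $ d * (U a b e u * \<omega>u e u)" for e
      unfolding U_def[of e] by (simp only: ring_distribs mult_ac)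
    then show ?thesis
      by (simp only: sum.distrib sum_subtractf sum_delta_mult sum_distrib_left)
  qed
  moreover have "(\<Oplus>e. U a b e u * \<omega>u e u) = (if a = b then 1 else 0) * \<omega>n u" for a
  proof -
    have "(\<Oplus>e. U a b e u * y e) = (if a = b then 1 else 0) * (\<Oplus>e. \<omega>d e u * y e) + \<omega>d b u * y a
      - \<omega>u a u * (\<Oplus>e. G u $ b $ e * y e)" for y
    proof -
      have "U a b e u * y e = (if a = b then 1 else 0) * (\<omega>d e u * y e)
        + (if a = e then 1 else 0) * (\<omega>d b u * y e) - \<omega>u a u * (G u $ b $ e * y e)" for e
        unfolding U_def by (simp only: ring_distribs mult_ac)
      then show ?thesis
        by (simp only: sum.distrib sum_subtractf sum_delta_mult sum_distrib_left)
    qed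
    from this[of "\<lambda>e. \<omega>u e u"] show ?thesis unfolding \<omega>_lower by simp
  qed
  ultimately have "(\<Oplus>a. \<Oplus>e. U a b e u * U e a d u) = (\<Oplus>a. U a a b u * \<omega>d d u + U a b d u * \<omega>d a u
      - (if a = b then 1 else 0) * (G u $ a $ d * \<omega>n u))"
    by (simp only: mult_ac U_sym[of _ b])
  also have "\<dots> = (\<Oplus>a. U a a b u) * \<omega>d d u + (\<Oplus>a. U a b d u * \<omega>d a u) - G u $ b $ d * \<omega>n u"
    by (simp only: sum.distrib sum_subtractf sum_delta_mult sum_distrib_right)
  also have "(\<Oplus>a. U a b d u * \<omega>d a u) = 2 * (\<omega>d b u * \<omega>d d u) - G u $ b $ d * \<omega>n u"
  proof -
    have "U a b d u * \<omega>d a u = (if a = b then 1 else 0) * (\<omega>d d u * \<omega>d a u)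
      + (if a = d then 1 else 0) * (\<omega>d b u * \<omega>d a u) - G u $ b $ d * (\<omega>d a u * \<omega>u a u)" for a
      unfolding U_def by (simp only: ring_distribs mult_ac)
    then have "(\<Oplus>a. U a b d u * \<omega>d a u) = \<omega>d d u * \<omega>d b u + \<omega>d b u * \<omega>d d u - G u $ b $ d * \<omega>n u"
      by (simp only: sum.distrib sum_subtractf sum_delta_mult sum_distrib_left)
    then show ?thesis by simp
  qed
  finally show ?thesis unfolding U_trace by (simp only: ring_distribs mult_ac)
qed

end

context
  fixes u assumes u: "u \<in> W"
begin

text \<open>Curvature of the connection with Christoffel symbols \<Gamma> + U, traced. The partial
  derivatives of \<open>U\<close> and the products of \<Gamma> with \<open>U\<close> combine to
  Hessians of \<omega>, and \<open>U_U\<close> yields the terms quadratic in d\<omega>.\<close>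

lemma Ric': "C.Ric b d u = Ric b d u - (real CARD('n) - 2) * (H\<omega> b d u - \<omega>d b u * \<omega>d d u + \<omega>n u * G u $ b $ d)
    - trace_wrt G H\<omega> u * G u $ b $ d"
proof -
  have pd\<Gamma>': "pd k (C.\<Gamma> c a b) u = pd k (\<Gamma> c a b) u + pd k (U c a b) u" for k c a b
  proof -
    have "pd k (C.\<Gamma> c a b) u = pd k (\<lambda>x. \<Gamma> c a b x + U c a b x) u"
      by (rule pd_cong[OF u christoffel'])
    then show ?thesis using u by simp
  qed
  have pdtr: "(\<Oplus>a. pd b (U a a d) u) = real CARD('n) * pd b (\<omega>d d) u"
  proof -
    have "(\<Oplus>a. pd b (U a a d) u) = pd b (\<lambda>x. \<Oplus>a. U a a d x) u"
      using u by simp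
    also have "\<dots> = pd b (\<lambda>x. real CARD('n) * \<omega>d d x) u"
      by (rule pd_cong[OF u U_trace])
    finally show ?thesis using u by simp
  qed
  have UG: "(\<Oplus>a. \<Oplus>e. U a a e u * X e) = real CARD('n) * (\<Oplus>e. \<omega>d e u * X e)" for X
  proof -
    have "(\<Oplus>a. \<Oplus>e. U a a e u * X e) = (\<Oplus>e. (\<Oplus>a. U a a e u) * X e)"
      unfolding sum_distrib_right by (rule sum.swap)
    then show ?thesis unfolding U_trace[OF u] by (simp only: sum_distrib_left mult.assoc)
  qed
  have \<omega>U: "(\<Oplus>e. \<omega>d e u * U e b d u) = 2 * (\<omega>d b u * \<omega>d d u) - G u $ b $ d * \<omega>n u"
  proof -
    have "\<omega>d e u * U e b d u = (if e = b then 1 else 0) * (\<omega>d d u * \<omega>d e u)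
      + (if e = d then 1 else 0) * (\<omega>d b u * \<omega>d e u) - G u $ b $ d * (\<omega>d e u * \<omega>u e u)" for e
      unfolding U_def by (simp only: ring_distribs mult_ac)
    then have "(\<Oplus>e. \<omega>d e u * U e b d u) = \<omega>d d u * \<omega>d b u + \<omega>d b u * \<omega>d d u - G u $ b $ d * \<omega>n u"
      by (simp only: sum.distrib sum_subtractf sum_delta_mult sum_distrib_left)
    then show ?thesis by simp
  qed
  have U\<Gamma>: "(\<Oplus>a. \<Oplus>e. U a b e u * \<Gamma> e a d u) =
     (\<Oplus>e. \<Gamma> e b d u * \<omega>d e u) + \<Gamma>t d u * \<omega>d b u - (\<Oplus>e. \<Gamma>l b e d u * \<omega>u e u)"
  proof -
    have "(\<Oplus>a. \<Oplus>e. U a b e u * \<Gamma> e a d u) = (\<Oplus>e. \<Oplus>a. \<Gamma> e d a u * U a e b u)"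
      by (subst sum.swap) (simp only: U_sym[OF u, of _ b] christoffel_sym[OF u, of _ _ d] mult.commute)
    also have "\<dots> = \<Gamma>t d u * \<omega>d b u + (\<Oplus>a. \<Gamma> a d b u * \<omega>d a u) - (\<Oplus>e. \<Gamma>l b d e u * \<omega>u e u)"
      by (rule \<Gamma>_U'[OF u])
    finally show ?thesis by (simp only: christoffel_sym[OF u, of _ d] add.commute)
  qed
  have "C.Ric b d u = Ric b d u + (\<Oplus>a. pd a (U a b d) u) - (\<Oplus>a. pd b (U a a d) u)
    + (\<Oplus>a. \<Oplus>e. \<Gamma> a a e u * U e b d u) + (\<Oplus>a. \<Oplus>e. U a a e u * \<Gamma> e b d u) + (\<Oplus>a. \<Oplus>e. U a a e u * U e b d u)
    - (\<Oplus>a. \<Oplus>e. \<Gamma> a b e u * U e a d u) - (\<Oplus>a. \<Oplus>e. U a b e u * \<Gamma> e a d u) - (\<Oplus>a. \<Oplus>e. U a b e u * U e a d u)"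
    unfolding ricci_def riemann_up_def christoffel'[OF u] pd\<Gamma>'
    by (simp add: distrib_left distrib_right sum.distrib sum_subtractf)
  also have "\<dots> = Ric b d u - (real CARD('n) - 2) * (H\<omega> b d u - \<omega>d b u * \<omega>d d u + \<omega>n u * G u $ b $ d)
    - trace_wrt G H\<omega> u * G u $ b $ d"
  proof -
    \<comment> \<open>The contractions of Christoffel symbols with d\<omega> that occur.
      \<open>L1\<close>, \<open>L2\<close> and \<open>A2\<close> cancel, while \<open>A1\<close>
      completes the second derivatives of \<omega> to \<open>H\<omega>\<close>.\<close>
    define A1 A2 where "A1 = (\<Oplus>e. \<Gamma> e b d u * \<omega>d e u)" and "A2 = (\<Oplus>e. \<Gamma>t e u * \<omega>u e u)"
    define L1 L2 where "L1 = (\<Oplus>e. \<Gamma>l b e d u * \<omega>u e u)" and "L2 = (\<Oplus>e. \<Gamma>l d e b u * \<omega>u e u)"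
    define nn where "nn = \<omega>n u"
    have L2': "(\<Oplus>e. \<Gamma>l d b e u * \<omega>u e u) = L2"
      unfolding L2_def by (simp only: christoffel_sym[OF u, of _ b])
    have L12: "(\<Oplus>a. (\<Gamma>l b a d u + \<Gamma>l d a b u) * \<omega>u a u) = L1 + L2"
      unfolding L1_def L2_def by (simp only: distrib_right sum.distrib)
    have A1': "(\<Oplus>e. \<omega>d e u * \<Gamma> e b d u) = A1"
      unfolding A1_def by (simp only: mult.commute)
    have H: "H\<omega> b d u = pd b (\<omega>d d) u - A1"
      unfolding hessian_def A1_def by simp
    have s: "pd d (\<omega>d b) u = pd b (\<omega>d d) u"
      by (rule pd_swap[OF u sm_\<omega>])
    show ?thesis
      unfolding pd_U[OF u] pdtr \<Gamma>_U[OF u] \<Gamma>_U'[OF u] U\<Gamma> U_U[OF u] UG \<omega>U L12 L2' A1' H s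
      unfolding A1_def[symmetric] A2_def[symmetric] L1_def[symmetric] L2_def[symmetric] nn_def[symmetric]
      by (simp add: algebra_simps)
  qed
  finally show ?thesis .
qed

lemma J': 
  assumes "CARD('n) \<ge> 3"
  shows "C.J u = exp (- 2 * \<omega> u) * (J u - trace_wrt G H\<omega> u - (real CARD('n) - 2) / 2 * \<omega>n u)"
proof -
  define E nn t where "E = exp (- 2 * \<omega> u)" and "nn = \<omega>n u" and "t = trace_wrt G H\<omega> u"
  have tr\<omega>: "(\<Oplus>a. \<Oplus>b. gi a b u * (\<omega>d a u * \<omega>d b u)) = nn"
    unfolding nn_def by (simp only: sum_distrib_left mult.left_commute)
  have "C.gi a b u * C.Ric a b u = E * (gi a b u * Ric a b u - (real CARD('n) - 2) * (gi a b u * H\<omega> a b u)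
      + (real CARD('n) - 2) * (gi a b u * (\<omega>d a u * \<omega>d b u))
      - ((real CARD('n) - 2) * nn + t) * (gi a b u * G u $ a $ b))" for a b
    unfolding gi'[OF u] Ric' E_def[symmetric] nn_def[symmetric] t_def[symmetric] by (simp add: algebra_simps)
  then have "trace_wrt G' C.Ric u = E * (trace_wrt G Ric u - (real CARD('n) - 2) * t
      + (real CARD('n) - 2) * nn - ((real CARD('n) - 2) * nn + t) * real CARD('n))"
    unfolding trace_wrt_def t_def
    by (simp only: sum.distrib sum_subtractf sum_distrib_left[symmetric] tr\<omega> trace_G[OF u])
  moreover have "trace_wrt G Ric u = 2 * (real CARD('n) - 1) * J u"
    using assms by (simp add: schouten_trace_def)
  ultimately have "C.J u = E * (2 * (real CARD('n) - 1) * J u - (real CARD('n) - 2) * t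
      + (real CARD('n) - 2) * nn - ((real CARD('n) - 2) * nn + t) * real CARD('n)) / (2 * (real CARD('n) - 1))"
    unfolding schouten_trace_def[of G'] by simp
  also have "\<dots> = E * (J u - t - (real CARD('n) - 2) / 2 * nn)"
    using assms by (simp add: field_simps)
  finally show ?thesis unfolding E_def nn_def t_def .
qed

lemma P':
  assumes "CARD('n) \<ge> 3"
  shows "C.P a b u = P a b u - H\<omega> a b u + \<omega>d a u * \<omega>d b u - \<omega>n u / 2 * G u $ a $ b"
proof -
  define nn t where "nn = \<omega>n u" and "t = trace_wrt G H\<omega> u"
  have JG: "C.J u * G' u $ a $ b = (J u - t - (real CARD('n) - 2) / 2 * nn) * G u $ a $ b"
    unfolding J'[OF assms] t_def[symmetric] nn_def[symmetric] by (simp add: G'_def exp_minus)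
  show ?thesis
    unfolding schouten_def[of G'] JG Ric' schouten_def[of G] t_def[symmetric] nn_def[symmetric]
    using assms by (simp add: field_simps)
qed

lemma hessian':
  assumes "sm f"
  shows "hessian G' (\<lambda>x. exp (\<omega> x) * f x) a b u = exp (\<omega> u) * (hessian G f a b u + f u * H\<omega> a b u
    - f u * \<omega>d a u * \<omega>d b u + ((\<Oplus>c. \<omega>u c u * pd c f u) + f u * \<omega>n u) * G u $ a $ b)"
proof -
  define E where "E = exp (\<omega> u)"
  define h where "h c = pd c f u + \<omega>d c u * f u" for c
  have p1: "pd c (\<lambda>x. exp (\<omega> x) * f x) x = exp (\<omega> x) * (pd c f x + \<omega>d c x * f x)" if "x \<in> W" for c x
    using that assms by (simp add: pd_exp_W algebra_simps)
  have p2: "pd a (pd b (\<lambda>x. exp (\<omega> x) * f x)) u = E * (\<omega>d a u * h b + pd a (pd b f) u + pd a (\<omega>d b) u * f u + \<omega>d b u * pd a f u)"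
  proof -
    have "pd a (pd b (\<lambda>x. exp (\<omega> x) * f x)) u = pd a (\<lambda>x. exp (\<omega> x) * (pd b f x + \<omega>d b x * f x)) u"
      by (rule pd_cong[OF u p1])
    then show ?thesis using u assms by (simp add: pd_exp_W E_def h_def algebra_simps)
  qed
  have Uh: "(\<Oplus>c. U c a b u * h c) = \<omega>d b u * h a + \<omega>d a u * h b - G u $ a $ b * (\<Oplus>c. \<omega>u c u * h c)"
  proof -
    have "U c a b u * h c = (if c = a then 1 else 0) * (\<omega>d b u * h c)
      + (if c = b then 1 else 0) * (\<omega>d a u * h c) - G u $ a $ b * (\<omega>u c u * h c)" for c
      unfolding U_def by (simp only: ring_distribs mult_ac)
    then show ?thesis by (simp only: sum.distrib sum_subtractf sum_delta_mult sum_distrib_left)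
  qed
  have \<omega>h: "(\<Oplus>c. \<omega>u c u * h c) = (\<Oplus>c. \<omega>u c u * pd c f u) + f u * \<omega>n u"
  proof -
    have "\<omega>u c u * h c = \<omega>u c u * pd c f u + f u * (\<omega>d c u * \<omega>u c u)" for c
      unfolding h_def by (simp only: ring_distribs mult_ac)
    then show ?thesis by (simp only: sum.distrib sum_distrib_left)
  qed
  have "hessian G' (\<lambda>x. exp (\<omega> x) * f x) a b u =
    E * (\<omega>d a u * h b + pd a (pd b f) u + pd a (\<omega>d b) u * f u + \<omega>d b u * pd a f u
      - (\<Oplus>c. \<Gamma> c a b u * h c) - (\<Oplus>c. U c a b u * h c))"
    unfolding hessian_def[of G'] p2 p1[OF u] christoffel'[OF u] h_def[symmetric] E_def[symmetric]
    by (simp add: algebra_simps sum.distrib sum_distrib_left)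
  moreover have "(\<Oplus>c. \<Gamma> c a b u * h c) = (\<Oplus>c. \<Gamma> c a b u * pd c f u) + f u * (\<Oplus>c. \<Gamma> c a b u * \<omega>d c u)"
    unfolding h_def by (simp add: algebra_simps sum.distrib sum_distrib_left)
  ultimately show ?thesis
    unfolding Uh \<omega>h unfolding hessian_def E_def[symmetric] h_def by (simp add: algebra_simps)
qed

end
end

locale conformal_ae = almost_einstein_region W G f \<rho> + conformal_change W G \<omega> for W :: "(real^'n::finite) set" and G f \<rho> \<omega>
begin

definition f' where "f' x = exp (\<omega> x) * f x"
text \<open>Transformation law of the last slot of the standard tractor.\<close>

definition \<rho>' where "\<rho>' x = exp (- \<omega> x) * (\<rho> x - (\<Oplus>c. \<omega>u c x * pd c f x) - f x * \<omega>n x / 2)"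

text \<open>Conformal covariance of the equation: in the sum of the Hessian of \<open>f'\<close> and
  \<open>f'\<close> times the new Schouten tensor, the Hessian of \<omega> and d\<omega> d\<omega>
  cancel. What is left besides the old equation is a multiple of \<open>G\<close>, which
  \<open>\<rho>'\<close> absorbs.\<close>

sublocale C: almost_einstein_region W G' f' \<rho>'
proof
  show "sm f'" "sm \<rho>'" unfolding f'_def[abs_def] \<rho>'_def[abs_def] by simp_all
  show "CARD('n) \<ge> 3" by (rule dim3)
  show "hessian G' f' a b u = - f' u * schouten G' a b u - \<rho>' u * G' u $ a $ b" if u: "u \<in> W" for u a b
  proof -
    define nn q where "nn = \<omega>n u" and "q = (\<Oplus>c. \<omega>u c u * pd c f u)"
    define E where "E = exp (\<omega> u)"
    have E: "E * E = exp (2 * \<omega> u)" "exp (- \<omega> u) * (E * E) = E"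
      unfolding E_def by (simp_all add: exp_add[symmetric])
    have r: "\<rho>' u * G' u $ a $ b = (exp (- \<omega> u) * (E * E)) * ((\<rho> u - q - f u * nn / 2) * G u $ a $ b)"
      unfolding \<rho>'_def G'_def nn_def[symmetric] q_def[symmetric] E(1)[symmetric] by simp
    show ?thesis
      unfolding r E(2) f'_def[abs_def] hessian'[OF u sm_f] P'[OF u dim3] hess[OF u]
        nn_def[symmetric] q_def[symmetric] E_def[symmetric]
      by (simp add: algebra_simps)
  qed
qed

end

section \<open>The local theorem\<close>

lemma pullback_matrix_nth:
  fixes M :: "real^'m::finite^'m" and Q :: "real^'k::finite^'m"
  shows "(transpose Q ** M ** Q) $ a $ b = (\<Oplus>i. (\<Oplus>j. M $ i $ j * Q $ j $ b) * Q $ i $ a)"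
proof -
  have "(transpose Q ** M ** Q) $ a $ b = (\<Oplus>j. (\<Oplus>i. Q $ i $ a * M $ i $ j) * Q $ j $ b)"
    by (simp add: matrix_matrix_mult_def transpose_def)
  also have "\<dots> = (\<Oplus>i. Q $ i $ a * (\<Oplus>j. M $ i $ j * Q $ j $ b))"
    by (rule sum_assoc3[symmetric])
  finally show ?thesis by (simp add: mult.commute)
qed

text \<open>The conformal freedom is spent near \<open>x0\<close>: the value of \<omega> on the
  hypersurface is dictated by \<sigma>, its normal derivative by the demand that the new \<rho>
  vanish. \<open>umbilic_hypersurface\<close> then applies.\<close>

lemma bach_flat_local:
  fixes W :: "(real^'m::finite) set" and V :: "(real^'k::finite) set"
  assumes W: "metric_region W G" and V: "metric_region V H"
    and dims: "CARD('m) = 5" "CARD('k) = 4"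
    and f: "smooth_on W f"
    and ae: "\<And>u a b. u \<in> W \<Longrightarrow>
      trace_free_part G (\<lambda>a b u. hessian G f a b u + f u * schouten G a b u) a b u = 0"
    and \<phi>: "smooth_map_on V \<phi>" "\<And>x. x \<in> V \<Longrightarrow> \<phi> x \<in> W" "\<And>x. x \<in> V \<Longrightarrow> f (\<phi> x) = 0"
    and imm: "\<And>x. x \<in> V \<Longrightarrow> inj ((*v) (jacobian \<phi> (at x)))"
    and df: "\<And>x. x \<in> V \<Longrightarrow> trace_wrt G (\<lambda>a b u. pd a f u * pd b f u) (\<phi> x) \<noteq> 0"
    and \<sigma>: "smooth_on V \<sigma>"
    and H: "\<And>x. x \<in> V \<Longrightarrow> H x = exp (2 * \<sigma> x) *\<^sub>R
      (transpose (jacobian \<phi> (at x)) ** G (\<phi> x) ** jacobian \<phi> (at x))"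
    and x0: "x0 \<in> V"
  shows "bach H a b x0 = 0"
proof -
  interpret W0: metric_region W G by (rule W)
  interpret V0: metric_region V H by (rule V)
  define n2 where "n2 = trace_wrt G (\<lambda>a b u. pd a f u * pd b f u)"
  have smn2: "smooth_on W n2"
    unfolding n2_def by (rule W0.sm_trace) (simp add: f)
  have c: "CARD('m) = Suc CARD('k)" using dims by simp
  obtain V' L S where VLS: "open V'" "\<phi> x0 \<in> V'" "smooth_map_on V' L" "open S" "x0 \<in> S" "S \<subseteq> V"
    "\<And>x. x \<in> S \<Longrightarrow> \<phi> x \<in> V' \<and> L (\<phi> x) = x"
    using immersion_left_inverse[OF c V0.open_W \<phi>(1) x0 imm[OF x0]] by metis
  \<comment> \<open>On \<open>W1\<close> the retraction \<open>L\<close> lands in the domain of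
    \<sigma>, and |df|^2 may be divided by.\<close>
  define W1 where "W1 = {u \<in> W \<inter> V'. L u \<in> S \<and> n2 u \<noteq> 0}"
  have W1: "open W1" "W1 \<subseteq> W" "W1 \<subseteq> V'"
  proof -
    have o: "open (W \<inter> V')" using W0.open_W VLS(1) by blast
    have "continuous_on (W \<inter> V') L"
      using smooth_map_continuous_on[OF VLS(3)] continuous_on_subset by blast
    moreover have "continuous_on (W \<inter> V') n2"
    proof (intro continuous_at_imp_continuous_on ballI)
      show "isCont n2 x" if "x \<in> W \<inter> V'" for x
        using smooth_on_differentiable[OF smn2, of x] that differentiable_imp_continuous_within by blast
    qed
    ultimately have "open ((W \<inter> V') \<inter> L -` S)" "open ((W \<inter> V') \<inter> n2 -` (- {0}))"
      using continuous_open_preimage[OF _ o VLS(4)] continuous_open_preimage[OF _ o, of n2 "- {0}"] by auto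
    moreover have "W1 = ((W \<inter> V') \<inter> L -` S) \<inter> ((W \<inter> V') \<inter> n2 -` (- {0}))"
      unfolding W1_def by auto
    ultimately show "open W1" by auto
  qed (auto simp: W1_def)
  have \<phi>1: "\<phi> x \<in> W1" if "x \<in> S" for x
    using VLS(6,7) \<phi>(2) df that unfolding W1_def n2_def by auto
  interpret M: metric_region W1 G
    by unfold_locales (use W1 W0.G_sym W0.G_inv smooth_on_subset[OF W0.sm_G] in auto)
  have f1 [simp]: "smooth_on W1 f"
    using smooth_on_subset[OF f W1(2)] .
  \<comment> \<open>The equation says that the tensor equals its own trace part, and this is minus
    the coefficient of \<open>G\<close> in it.\<close>
  define \<rho> where "\<rho> u = - (trace_wrt G (\<lambda>a b u. hessian G f a b u + f u * schouten G a b u) u / real CARD('m))" for u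
  have sm_hess: "smooth_on W1 (hessian G f a b)" for a b
    unfolding hessian_def[abs_def] by simp
  have sm\<rho>: "smooth_on W1 \<rho>"
    unfolding \<rho>_def[abs_def] by (intro M.sm_minus M.sm_divide M.sm_trace) (simp add: sm_hess)
  interpret A: almost_einstein_region W1 G f \<rho>
  proof
    show "smooth_on W1 f" "smooth_on W1 \<rho>" "CARD('m) \<ge> 3"
      using sm\<rho> dims by simp_all
    show "hessian G f a b u = - f u * schouten G a b u - \<rho> u * G u $ a $ b" if "u \<in> W1" for u a b
      using ae[of u a b] that W1(2) unfolding trace_free_part_def \<rho>_def by (auto simp: algebra_simps)
  qed
  define \<sigma>' where "\<sigma>' u = \<sigma> (L u)" for u
  have sm\<sigma>': "smooth_on W1 \<sigma>'"
    unfolding \<sigma>'_def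
    by (rule smooth_on_compose[OF W1(1) V0.open_W _ smooth_map_on_subset[OF VLS(3) W1(3)] \<sigma>])
      (use VLS(6) W1_def in auto)
  \<comment> \<open>\<open>s\<close> is the inner product of d\<sigma>' and df. Where f = 0,
    \<open>\<rho>'\<close> vanishes iff the inner product of d\<omega> and df equals \<rho>; that
    inner product is s + |df|^2 \<tau>, which determines \<tau>.\<close>
  define s where "s u = (\<Oplus>c. (\<Oplus>b. ginv G c b u * pd b \<sigma>' u) * pd c f u)" for u
  have sms: "smooth_on W1 s"
    unfolding s_def[abs_def] using sm\<sigma>' by simp
  \<comment> \<open>\<open>\<sigma>'\<close> extends \<open>\<sigma>\<close> off the hypersurface; the multiple of \<open>f\<close> adjusts the normal derivative so
    that the new \<open>\<rho>\<close> vanishes there.\<close>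
  define \<tau> where "\<tau> u = (\<rho> u - s u) / n2 u" for u
  have sm\<tau>: "smooth_on W1 \<tau>"
    unfolding \<tau>_def[abs_def]
    by (rule smooth_on_divide[OF W1(1) M.sm_diff[OF sm\<rho> sms] smooth_on_subset[OF smn2 W1(2)]])
      (simp add: W1_def)
  define \<omega> where "\<omega> u = \<sigma>' u + f u * \<tau> u" for u
  have sm\<omega>: "smooth_on W1 \<omega>"
    unfolding \<omega>_def[abs_def] using sm\<sigma>' sm\<tau> by simp
  interpret E: conformal_ae W1 G f \<rho> \<omega>
    by unfold_locales (rule sm\<omega>)
  have zero: "f (\<phi> x) = 0" if "x \<in> S" for x
    using \<phi>(3) VLS(6) that by blast
  have pd\<omega>: "pd c \<omega> (\<phi> x) = pd c \<sigma>' (\<phi> x) + pd c f (\<phi> x) * \<tau> (\<phi> x)" if "x \<in> S" for x c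
    using \<phi>1[OF that] sm\<sigma>' sm\<tau> zero[OF that] unfolding \<omega>_def[abs_def] by simp
  have \<rho>'0: "E.\<rho>' (\<phi> x) = 0" if "x \<in> S" for x
  proof -
    have "n2 (\<phi> x) \<noteq> 0" using \<phi>1[OF that] by (simp add: W1_def)
    have n2: "n2 (\<phi> x) = (\<Oplus>c. (\<Oplus>b. ginv G c b (\<phi> x) * pd b f (\<phi> x)) * pd c f (\<phi> x))"
      unfolding n2_def trace_wrt_def by (simp add: sum_distrib_left sum_distrib_right mult_ac)
    have "(\<Oplus>c. (\<Oplus>b. ginv G c b (\<phi> x) * pd b \<omega> (\<phi> x)) * pd c f (\<phi> x)) = s (\<phi> x) + n2 (\<phi> x) * \<tau> (\<phi> x)"
    proof -
      have "(\<Oplus>b. ginv G c b (\<phi> x) * pd b \<omega> (\<phi> x)) * pd c f (\<phi> x) =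
        (\<Oplus>b. ginv G c b (\<phi> x) * pd b \<sigma>' (\<phi> x)) * pd c f (\<phi> x)
        + (\<Oplus>b. ginv G c b (\<phi> x) * pd b f (\<phi> x)) * pd c f (\<phi> x) * \<tau> (\<phi> x)" for c
        unfolding pd\<omega>[OF that] by (simp add: distrib_left sum.distrib sum_distrib_left sum_distrib_right mult_ac)
      then show ?thesis
        unfolding n2 s_def by (simp only: sum.distrib sum_distrib_right)
    qed
    also have "\<dots> = \<rho> (\<phi> x)"
      using \<open>n2 (\<phi> x) \<noteq> 0\<close> by (simp add: \<tau>_def)
    finally show ?thesis
      unfolding E.\<rho>'_def using zero[OF that] by simp
  qed
  \<comment> \<open>Where f = 0, |df|^2 is the same in every scale: the two factors exp \<omega>
    from the derivatives cancel against the inverse metric.\<close>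
  have N'0: "E.C.N (\<phi> x) \<noteq> 0" if "x \<in> S" for x
  proof -
    define e where "e = exp (\<omega> (\<phi> x))"
    have e: "exp (- 2 * \<omega> (\<phi> x)) * (e * e) = 1"
      unfolding e_def by (simp add: exp_add[symmetric])
    have pf: "pd c E.f' (\<phi> x) = e * pd c f (\<phi> x)" for c
      using \<phi>1[OF that] zero[OF that] sm\<omega> unfolding E.f'_def[abs_def] by (simp add: E.pd_exp_W e_def)
    have "E.C.N (\<phi> x) = (\<Oplus>a. \<Oplus>b. (exp (- 2 * \<omega> (\<phi> x)) * (e * e)) * (ginv G a b (\<phi> x) * (pd a f (\<phi> x) * pd b f (\<phi> x))))"
      unfolding pf E.gi'[OF \<phi>1[OF that]] by (simp add: sum_distrib_left sum_distrib_right mult_ac)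
    then have "E.C.N (\<phi> x) = n2 (\<phi> x)"
      unfolding e n2_def trace_wrt_def by simp
    then show ?thesis
      using \<phi>1[OF that] by (simp add: W1_def)
  qed
  interpret S: metric_region S H
    by unfold_locales (use VLS V0.G_sym V0.G_inv smooth_on_subset[OF V0.sm_G] in auto)
  have \<omega>\<phi>: "\<omega> (\<phi> x) = \<sigma> x" if "x \<in> S" for x
    using VLS(7)[OF that] zero[OF that] by (simp add: \<omega>_def \<sigma>'_def)
  interpret U: umbilic_hypersurface W1 E.G' E.f' E.\<rho>' S H \<phi>
  proof
    show "smooth_map_on S \<phi>"
      by (rule smooth_map_on_subset[OF \<phi>(1) VLS(6)])
    show "H x $ a $ b = (\<Oplus>i. (\<Oplus>j. E.G' (\<phi> x) $ i $ j * pd b (\<lambda>x. \<phi> x $ j) x) * pd a (\<lambda>x. \<phi> x $ i) x)"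
      if "x \<in> S" for x a b
    proof -
      have xV: "x \<in> V" using that VLS(6) by blast
      have "H x $ a $ b = exp (2 * \<sigma> x) * (\<Oplus>i. (\<Oplus>j. G (\<phi> x) $ i $ j * pd b (\<lambda>x. \<phi> x $ j) x) * pd a (\<lambda>x. \<phi> x $ i) x)"
        unfolding H[OF xV] vector_scaleR_component pullback_matrix_nth smooth_map_jacobian[OF \<phi>(1) xV] by simp
      then show ?thesis
        unfolding E.G'_def \<omega>\<phi>[OF that] by (simp add: sum_distrib_left mult_ac)
    qed
  qed (use \<phi>1 zero \<rho>'0 N'0 dims in \<open>auto simp: E.f'_def\<close>)
  show ?thesis
    by (rule U.bach_zero[OF VLS(5)])
qed

section \<open>Charts of the zero set\<close>

lemma is_chart_subset: "is_chart T C \<Longrightarrow> fst C \<subseteq> topspace T"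
  unfolding is_chart_def by (blast dest: openin_subset)

lemma is_chart_topspace: "is_chart T C \<Longrightarrow> topspace (subtopology T (fst C)) = fst C"
  using is_chart_subset[of T C] by auto

lemma is_chart_inj: "is_chart T C \<Longrightarrow> inj_on (snd C) (fst C)"
  using homeomorphic_imp_injective_map[of "subtopology T (fst C)"] is_chart_topspace[of T C]
  unfolding is_chart_def by auto

lemma is_chart_inv: "is_chart T C \<Longrightarrow> p \<in> fst C \<Longrightarrow> chart_inv C (snd C p) = p"
  by (simp add: inv_into_f_f is_chart_inj)

lemma is_chart_open_image:
  assumes "is_chart T C" "openin T U" "U \<subseteq> fst C"
  shows "open (snd C ` U)"
proof -
  have "openin (subtopology T (fst C)) U"
    using assms(2,3) by (metis inf.absorb_iff2 inf_commute openin_subtopology_Int)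
  then have "openin (top_of_set (chart_image C)) (snd C ` U)"
    using assms(1) homeomorphic_imp_open_map unfolding is_chart_def open_map_def by blast
  then show ?thesis
    using assms(1) unfolding is_chart_def by (meson openin_open_trans)
qed

lemma is_chart_continuous: "is_chart T C \<Longrightarrow> continuous_map (subtopology T (fst C)) euclidean (snd C)"
  using homeomorphic_imp_continuous_map continuous_map_into_fulltopology unfolding is_chart_def by blast

lemma is_chart_open_preimage:
  assumes "is_chart T C" "open V"
  shows "openin T {p \<in> fst C. snd C p \<in> V}"
proof -
  have "openin (subtopology T (fst C)) {p \<in> topspace (subtopology T (fst C)). snd C p \<in> V}"
    using openin_continuous_map_preimage[OF is_chart_continuous[OF assms(1)]] assms(2) by simp
  then show ?thesis
    unfolding is_chart_topspace[OF assms(1)] using assms(1) unfolding is_chart_def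
    by (blast intro: openin_trans_full)
qed

lemma is_chart_continuous_inv:
  assumes "is_chart T C"
  shows "continuous_map (top_of_set (chart_image C)) (subtopology T (fst C)) (chart_inv C)"
proof -
  obtain g where g: "homeomorphic_maps (subtopology T (fst C)) (top_of_set (chart_image C)) (snd C) g"
    using assms unfolding is_chart_def homeomorphic_map_maps by blast
  then have "continuous_map (top_of_set (chart_image C)) (subtopology T (fst C)) g"
    unfolding homeomorphic_maps_def by blast
  moreover have "g y = chart_inv C y" if "y \<in> topspace (top_of_set (chart_image C))" for y
  proof -
    obtain p where p: "p \<in> fst C" "y = snd C p" using \<open>y \<in> _\<close> by auto
    then have "g y = p"
      using g is_chart_topspace[OF assms] unfolding homeomorphic_maps_def by simp
    then show ?thesis using is_chart_inv[OF assms p(1)] p(2) by simp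
  qed
  ultimately show ?thesis by (rule continuous_map_eq)
qed

lemma transition_apply: "is_chart T C \<Longrightarrow> p \<in> fst C \<Longrightarrow> transition C D (snd C p) = snd D p"
  by (simp add: is_chart_inv)

lemma jacobian_transition:
  fixes X :: "('a, 'x::finite) chart" and Y :: "('a, 'y::finite) chart" and Z :: "('a, 'z::finite) chart"
  assumes inj: "inj_on (snd X) (fst X)" "inj_on (snd Y) (fst Y)"
    and o: "open (snd X ` (fst X \<inter> fst Y \<inter> fst Z))"
    and s: "smooth_map_on (snd X ` (fst X \<inter> fst Y)) (transition X Y)"
      "smooth_map_on (snd Y ` (fst Y \<inter> fst Z)) (transition Y Z)"
    and p: "p \<in> fst X" "p \<in> fst Y" "p \<in> fst Z"
  shows "jacobian (transition X Z) (at (snd X p)) =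
    jacobian (transition Y Z) (at (snd Y p)) ** jacobian (transition X Y) (at (snd X p))"
proof -
  have "jacobian (transition X Z) (at (snd X p)) = jacobian (\<lambda>x. transition Y Z (transition X Y x)) (at (snd X p))"
    by (rule jacobian_cong_open[OF o]) (use p inj in \<open>auto simp: inv_into_f_f\<close>)
  also have "\<dots> = jacobian (transition Y Z) (at (transition X Y (snd X p))) ** jacobian (transition X Y) (at (snd X p))"
    by (rule jacobian_compose[OF s(1) _ s(2)]) (use p inj in \<open>auto simp: inv_into_f_f\<close>)
  finally show ?thesis using p inj by (simp add: inv_into_f_f)
qed

lemma smooth_left_inverse_imp_inj:
  assumes "open S" "x \<in> S" "smooth_map_on S F" "smooth_map_on S' H" "\<And>y. y \<in> S \<Longrightarrow> F y \<in> S' \<and> H (F y) = y"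
  shows "inj ((*v) (jacobian F (at x)))"
proof -
  have "jacobian H (at (F x)) ** jacobian F (at x) = jacobian (\<lambda>y. H (F y)) (at x)"
    by (rule jacobian_compose[symmetric]) (use assms in auto)
  also have "\<dots> = jacobian (\<lambda>y. y) (at x)"
    by (rule jacobian_cong_open[OF assms(1,2)]) (use assms(5) in blast)
  finally have "jacobian H (at (F x)) ** jacobian F (at x) = mat 1"
    by (simp add: jacobian_ident)
  then show ?thesis
    by (metis (no_types, lifting) injI matrix_vector_mul_assoc matrix_vector_mul_lid)
qed

lemma positive_definite_invertible:
  fixes M :: "real^'n::finite^'n"
  assumes "\<And>v. v \<noteq> 0 \<Longrightarrow> v \<bullet> (M *v v) > 0"
  shows "invertible M"
proof (rule inj_imp_invertible, rule linear_injective_0[OF matrix_vector_mul_linear, THEN iffD2], intro allI impI)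
  show "v = 0" if "M *v v = 0" for v
    using assms[of v] that by (cases "v = 0") auto
qed

lemma riemannian_metric_transition:
  assumes "riemannian_metric A g" "C \<in> A" "D \<in> A" "p \<in> fst C" "p \<in> fst D"
  shows "g C (snd C p) = transpose (jacobian (transition C D) (at (snd C p))) ** g D (snd D p)
    ** jacobian (transition C D) (at (snd C p))"
proof -
  have "\<forall>C\<in>A. \<forall>D\<in>A. \<forall>p\<in>fst C \<inter> fst D.
        let J = jacobian (transition C D) (at (snd C p)) in
        g C (snd C p) = transpose J ** g D (snd D p) ** J"
    using assms(1) unfolding riemannian_metric_def by (rule conjunct2)
  from this[rule_format, OF assms(2,3)] show ?thesis
    using assms(4,5) unfolding Let_def by blast
qed

lemma riemannian_metric_region:
  assumes "is_chart T C" "riemannian_metric A g" "C \<in> A"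
  shows "metric_region (chart_image C) (g C)"
proof
  show "open (chart_image C)" using assms(1) unfolding is_chart_def by blast
  show "smooth_on (chart_image C) (\<lambda>u. g C u $ a $ b)" for a b
    using assms(2,3) unfolding riemannian_metric_def by blast
  show "g C u $ a $ b = g C u $ b $ a" if "u \<in> chart_image C" for u a b
  proof -
    have "transpose (g C u) = g C u"
      using assms(2,3) that unfolding riemannian_metric_def by blast
    then have "transpose (g C u) $ b $ a = g C u $ b $ a" by simp
    then show ?thesis by (simp add: transpose_def)
  qed
  show "invertible (g C u)" if "u \<in> chart_image C" for u
    by (rule positive_definite_invertible) (use assms(2,3) that in \<open>unfold riemannian_metric_def, blast\<close>)
qed

text \<open>The atlas \<open>B\<close> is compatible by construction, but nothing here ensures that
  it covers \<Sigma>. Covering is the premise of \<open>submanifold_smooth\<close> and is supplied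
  for regular zero sets by \<open>zero_set_chart\<close>.\<close>

locale submanifold_charts =
  fixes T :: "'a topology" and A :: "('a, 'm::finite) chart set" and \<Sigma> :: "'a set"
    and B :: "('a, 'k::finite) chart set"
  assumes mfd: "smooth_manifold T A"
    and B_def: "B = submanifold_atlas T A \<Sigma>"
    and codim: "CARD('m) = Suc CARD('k)"
begin

lemma chart_A: "C \<in> A \<Longrightarrow> is_chart T C"
  using mfd unfolding smooth_manifold_def by blast

lemma chart_B: "D \<in> B \<Longrightarrow> is_chart (subtopology T \<Sigma>) D"
  unfolding B_def submanifold_atlas_def by blast

lemma cover_A: "p \<in> topspace T \<Longrightarrow> \<exists>C\<in>A. p \<in> fst C"
  using mfd unfolding smooth_manifold_def by blast

lemma cover_BA: "D \<in> B \<Longrightarrow> p \<in> fst D \<Longrightarrow> \<exists>C\<in>A. p \<in> fst C"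
  using is_chart_subset[OF chart_B, of D] cover_A[of p] by auto

lemma smooth_BA: "D \<in> B \<Longrightarrow> C \<in> A \<Longrightarrow> smooth_map_on (snd D ` (fst D \<inter> fst C)) (transition D C)"
  unfolding B_def submanifold_atlas_def by blast

lemma immersion_BA: "D \<in> B \<Longrightarrow> C \<in> A \<Longrightarrow> p \<in> fst D \<inter> fst C \<Longrightarrow>
    inj ((*v) (jacobian (transition D C) (at (snd D p))))"
  unfolding B_def submanifold_atlas_def by blast

lemma smooth_AA: "C \<in> A \<Longrightarrow> C' \<in> A \<Longrightarrow> smooth_map_on (snd C ` (fst C \<inter> fst C')) (transition C C')"
  using mfd unfolding smooth_manifold_def by blast

lemma openin_A: "C \<in> A \<Longrightarrow> openin T (fst C)"
  using chart_A unfolding is_chart_def by blast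

lemma openin_B: "D \<in> B \<Longrightarrow> openin (subtopology T \<Sigma>) (fst D)"
  using chart_B unfolding is_chart_def by blast

lemma openin_sub_Int: "openin (subtopology T \<Sigma>) U \<Longrightarrow> openin T W \<Longrightarrow> openin (subtopology T \<Sigma>) (U \<inter> W)"
proof -
  assume U: "openin (subtopology T \<Sigma>) U" and "openin T W"
  then have "openin (subtopology T \<Sigma>) (\<Sigma> \<inter> W)"
    by (simp add: openin_subtopology_Int2)
  from openin_Int[OF U this] show ?thesis
    using openin_subset[OF U] by (simp add: Int_assoc[symmetric] inf.absorb1)
qed

lemma open_BA: "D \<in> B \<Longrightarrow> C \<in> A \<Longrightarrow> open (snd D ` (fst D \<inter> fst C))"
  by (rule is_chart_open_image[OF chart_B openin_sub_Int[OF openin_B openin_A]]) auto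

lemma open_BBA: "D \<in> B \<Longrightarrow> D' \<in> B \<Longrightarrow> C \<in> A \<Longrightarrow> open (snd D ` (fst D \<inter> fst D' \<inter> fst C))"
  by (rule is_chart_open_image[OF chart_B openin_sub_Int[OF openin_Int[OF openin_B openin_B] openin_A]]) auto

lemma open_BAA: "D \<in> B \<Longrightarrow> C \<in> A \<Longrightarrow> C' \<in> A \<Longrightarrow> open (snd D ` (fst D \<inter> fst C \<inter> fst C'))"
  by (rule is_chart_open_image[OF chart_B openin_sub_Int[OF openin_sub_Int[OF openin_B openin_A] openin_A]]) auto

text \<open>Charts of \<open>B\<close> are related only through ambient charts. Near a point, the
  transition from \<open>D\<close> to \<open>D'\<close> is the transition from \<open>D\<close> to
  an ambient chart followed by a smooth left inverse of the immersion belonging to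
  \<open>D'\<close>.\<close>

lemma smooth_BB:
  assumes D: "D \<in> B" and D': "D' \<in> B"
  shows "smooth_map_on (snd D ` (fst D \<inter> fst D')) (transition D D')"
proof (rule smooth_map_on_local)
  fix x assume "x \<in> snd D ` (fst D \<inter> fst D')"
  then obtain p where p: "p \<in> fst D" "p \<in> fst D'" "x = snd D p" by blast
  obtain C where C: "C \<in> A" "p \<in> fst C"
    using cover_BA[OF D p(1)] by blast
  let ?S = "snd D' ` (fst D' \<inter> fst C)"
  have pS: "snd D' p \<in> ?S" using p C by blast
  obtain V L S' where V: "open V" "transition D' C (snd D' p) \<in> V" "smooth_map_on V L"
    and S': "open S'" "snd D' p \<in> S'" "S' \<subseteq> ?S"
    and L: "\<And>y. y \<in> S' \<Longrightarrow> transition D' C y \<in> V \<and> L (transition D' C y) = y"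
    using immersion_left_inverse[OF codim open_BA[OF D' C(1)] smooth_BA[OF D' C(1)] pS immersion_BA[OF D' C(1)]]
      p C by (metis IntI)
  define Q where "Q = fst D \<inter> {q \<in> fst D'. snd D' q \<in> S'} \<inter> fst C"
  have oQ: "openin (subtopology T \<Sigma>) Q"
    unfolding Q_def
    by (intro openin_sub_Int openin_Int openin_B D openin_A C is_chart_open_preimage[OF chart_B[OF D'] S'(1)])
  have oDQ: "open (snd D ` Q)"
    by (rule is_chart_open_image[OF chart_B[OF D] oQ]) (auto simp: Q_def)
  have x: "x \<in> snd D ` Q"
    using p C S'(2) unfolding Q_def by blast
  have "smooth_map_on (snd D ` Q) (transition D D')"
  proof (rule smooth_map_on_cong[OF oDQ])
    have *: "transition D C y \<in> V" if y: "y \<in> snd D ` Q" for y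
    proof -
      obtain q where q: "q \<in> Q" "y = snd D q" using y by blast
      have "transition D C y = transition D' C (snd D' q)"
        using q by (simp add: Q_def is_chart_inv[OF chart_B[OF D]] is_chart_inv[OF chart_B[OF D']])
      then show ?thesis using L q by (auto simp: Q_def)
    qed
    show "smooth_map_on (snd D ` Q) (\<lambda>y. L (transition D C y))"
      by (rule smooth_map_on_compose[OF oDQ V(1) * smooth_map_on_subset[OF smooth_BA[OF D C(1)]] V(3)])
        (auto simp: Q_def)
    show "L (transition D C y) = transition D D' y" if y: "y \<in> snd D ` Q" for y
    proof -
      obtain q where q: "q \<in> Q" "y = snd D q" using y by blast
      have "transition D C y = transition D' C (snd D' q)" "transition D D' y = snd D' q"
        using q by (simp_all add: Q_def is_chart_inv[OF chart_B[OF D]] is_chart_inv[OF chart_B[OF D']])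
      then show ?thesis using L q by (auto simp: Q_def)
    qed
  qed
  with x show "\<exists>V. x \<in> V \<and> smooth_map_on V (transition D D')" by blast
qed

lemma submanifold_smooth:
  assumes cover: "\<And>p. p \<in> topspace T \<Longrightarrow> p \<in> \<Sigma> \<Longrightarrow> \<exists>D\<in>B. p \<in> fst D"
  shows "smooth_manifold (subtopology T \<Sigma>) B"
  unfolding smooth_manifold_def
proof (intro conjI ballI)
  show "Hausdorff_space (subtopology T \<Sigma>)" "second_countable (subtopology T \<Sigma>)"
    using mfd Hausdorff_space_subtopology second_countable_subtopology unfolding smooth_manifold_def by blast+
  show "(\<Union>C\<in>B. fst C) = topspace (subtopology T \<Sigma>)"
  proof (intro subset_antisym subsetI)
    show "p \<in> topspace (subtopology T \<Sigma>)" if "p \<in> (\<Union>C\<in>B. fst C)" for p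
      using that is_chart_subset[OF chart_B] by blast
    show "p \<in> (\<Union>C\<in>B. fst C)" if "p \<in> topspace (subtopology T \<Sigma>)" for p
      using cover[of p] that by auto
  qed
qed (use chart_B smooth_BB in auto)


section \<open>The induced conformal structure\<close>

text \<open>The components of the ambient metric are available only in charts of \<open>A\<close>,
  so one around the point is chosen; \<open>pullback_metric_apply\<close> shows that the choice is
  immaterial.\<close>

definition pullback_metric :: "('a, 'm) metric \<Rightarrow> ('a, 'k) metric" where
  "pullback_metric g D x = (let C = SOME C. C \<in> A \<and> chart_inv D x \<in> fst C; J = jacobian (transition D C) (at x)
     in transpose J ** g C (snd C (chart_inv D x)) ** J)"

lemma jacobian_BAA:
  assumes "D \<in> B" "C \<in> A" "C' \<in> A" "p \<in> fst D" "p \<in> fst C" "p \<in> fst C'"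
  shows "jacobian (transition D C') (at (snd D p)) =
    jacobian (transition C C') (at (snd C p)) ** jacobian (transition D C) (at (snd D p))"
  by (rule jacobian_transition[OF is_chart_inj[OF chart_B] is_chart_inj[OF chart_A] open_BAA smooth_BA smooth_AA])
    (use assms in auto)

lemma jacobian_BBA:
  assumes "D \<in> B" "D' \<in> B" "C \<in> A" "p \<in> fst D" "p \<in> fst D'" "p \<in> fst C"
  shows "jacobian (transition D C) (at (snd D p)) =
    jacobian (transition D' C) (at (snd D' p)) ** jacobian (transition D D') (at (snd D p))"
  by (rule jacobian_transition[OF is_chart_inj[OF chart_B] is_chart_inj[OF chart_B] open_BBA smooth_BB smooth_BA])
    (use assms in auto)

lemma pullback_metric_apply:
  assumes g: "riemannian_metric A g" and D: "D \<in> B" and C: "C \<in> A" and p: "p \<in> fst D" "p \<in> fst C"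
  shows "pullback_metric g D (snd D p) =
    transpose (jacobian (transition D C) (at (snd D p))) ** g C (snd C p) ** jacobian (transition D C) (at (snd D p))"
proof -
  define C' where "C' = (SOME C. C \<in> A \<and> p \<in> fst C)"
  have C': "C' \<in> A \<and> p \<in> fst C'"
    unfolding C'_def by (rule someI[of _ C]) (use C p(2) in blast)
  have inv: "chart_inv D (snd D p) = p" by (rule is_chart_inv[OF chart_B[OF D] p(1)])
  let ?J = "jacobian (transition C C') (at (snd C p))" and ?K = "jacobian (transition D C) (at (snd D p))"
  have "pullback_metric g D (snd D p) = transpose (?J ** ?K) ** g C' (snd C' p) ** (?J ** ?K)"
    unfolding pullback_metric_def Let_def inv C'_def[symmetric]
    using jacobian_BAA[OF D C _ p] C' by simp
  also have "\<dots> = transpose ?K ** (transpose ?J ** g C' (snd C' p) ** ?J) ** ?K"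
    by (simp add: matrix_transpose_mul matrix_mul_assoc)
  also have "transpose ?J ** g C' (snd C' p) ** ?J = g C (snd C p)"
    by (rule riemannian_metric_transition[OF g C _ p(2), symmetric]) (use C' in blast)+
  finally show ?thesis .
qed

lemma is_pullback_pullback_metric: "riemannian_metric A g \<Longrightarrow> is_pullback_metric A B g (pullback_metric g)"
  unfolding is_pullback_metric_def Let_def using pullback_metric_apply by blast

lemma riemannian_pullback_metric:
  assumes g: "riemannian_metric A g"
  shows "riemannian_metric B (pullback_metric g)"
  unfolding riemannian_metric_def
proof (intro conjI ballI allI impI)
  fix D i j assume D: "D \<in> B"
  show "smooth_on (chart_image D) (\<lambda>u. pullback_metric g D u $ i $ j)"
  proof (rule smooth_on_local)
    fix x assume "x \<in> chart_image D"
    then obtain p where p: "p \<in> fst D" "x = snd D p" by blast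
    obtain C where C: "C \<in> A" "p \<in> fst C"
      using cover_BA[OF D p(1)] by blast
    let ?S = "snd D ` (fst D \<inter> fst C)"
    interpret smooth_region ?S by unfold_locales (rule open_BA[OF D C(1)])
    interpret M: metric_region "chart_image C" "g C"
      by (rule riemannian_metric_region[OF chart_A[OF C(1)] g C(1)])
    have "smooth_on ?S (\<lambda>u. pullback_metric g D u $ i $ j)"
    proof (rule sm_cong)
      have s: "smooth_on ?S (\<lambda>y. transition D C y $ a)" for a
        using smooth_BA[OF D C(1)] unfolding smooth_map_on_def by blast
      have t: "smooth_on ?S (\<lambda>y. g C (transition D C y) $ a $ b)" for a b
        by (rule smooth_on_compose[OF open_W M.open_W _ smooth_BA[OF D C(1)] M.sm_G])
          (auto simp: is_chart_inv[OF chart_B[OF D]])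
      show "smooth_on ?S (\<lambda>y. \<Oplus>a. (\<Oplus>b. g C (transition D C y) $ a $ b * pd j (\<lambda>y. transition D C y $ b) y)
          * pd i (\<lambda>y. transition D C y $ a) y)"
        using s t by (intro sm_sum sm_mult smooth_on_pd)
      show "(\<Oplus>a. (\<Oplus>b. g C (transition D C y) $ a $ b * pd j (\<lambda>y. transition D C y $ b) y)
          * pd i (\<lambda>y. transition D C y $ a) y) = pullback_metric g D y $ i $ j" if y: "y \<in> ?S" for y
      proof -
        obtain q where q: "q \<in> fst D" "q \<in> fst C" "y = snd D q" using y by blast
        have "pullback_metric g D y $ i $ j = (transpose (jacobian (transition D C) (at y)) ** g C (transition D C y)
            ** jacobian (transition D C) (at y)) $ i $ j"
          unfolding q(3) pullback_metric_apply[OF g D C(1) q(1,2)] transition_apply[OF chart_B[OF D] q(1)] ..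
        then show ?thesis
          unfolding pullback_matrix_nth smooth_map_jacobian[OF smooth_BA[OF D C(1)] y] by simp
      qed
    qed
    then show "\<exists>V. x \<in> V \<and> smooth_on V (\<lambda>u. pullback_metric g D u $ i $ j)"
      by (intro exI[of _ ?S] conjI) (use p C in blast)
  qed
next
  fix D x assume D: "D \<in> B" and "x \<in> chart_image D"
  then obtain p where p: "p \<in> fst D" "x = snd D p" by blast
  obtain C where C: "C \<in> A" "p \<in> fst C"
    using cover_BA[OF D p(1)] by blast
  let ?J = "jacobian (transition D C) (at (snd D p))" and ?g = "g C (snd C p)"
  have gp: "transpose ?g = ?g" "\<And>v. v \<noteq> 0 \<Longrightarrow> v \<bullet> (?g *v v) > 0"
    using g C unfolding riemannian_metric_def by blast+
  have h: "pullback_metric g D x = transpose ?J ** ?g ** ?J"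
    unfolding p(2) by (rule pullback_metric_apply[OF g D C(1) p(1) C(2)])
  show "transpose (pullback_metric g D x) = pullback_metric g D x"
    unfolding h by (simp add: matrix_transpose_mul gp(1) matrix_mul_assoc)
  show "v \<bullet> (pullback_metric g D x *v v) > 0" if "v \<noteq> 0" for v
  proof -
    have "?J *v v \<noteq> 0"
      using immersion_BA[OF D C(1), of p] p C that
        linear_injective_0[OF matrix_vector_mul_linear[of ?J]] by blast
    moreover have "v \<bullet> (pullback_metric g D x *v v) = (?J *v v) \<bullet> (?g *v (?J *v v))"
    proof -
      have "v \<bullet> (transpose ?J *v w) = (?J *v v) \<bullet> w" for w
        unfolding transpose_matrix_vector inner_commute[of v] dot_lmul_matrix by (rule inner_commute)
      moreover have "pullback_metric g D x *v v = transpose ?J *v (?g *v (?J *v v))"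
        unfolding h by (simp only: matrix_vector_mul_assoc matrix_mul_assoc)
      ultimately show ?thesis by (simp only:)
    qed
    ultimately show ?thesis using gp(2) by simp
  qed
next
  fix D D' p assume D: "D \<in> B" and D': "D' \<in> B" and p: "p \<in> fst D \<inter> fst D'"
  obtain C where C: "C \<in> A" "p \<in> fst C"
    using cover_BA[OF D, of p] p by blast
  show "let J = jacobian (transition D D') (at (snd D p))
    in pullback_metric g D (snd D p) = transpose J ** pullback_metric g D' (snd D' p) ** J"
    unfolding Let_def using p C pullback_metric_apply[OF g D C(1), of p] pullback_metric_apply[OF g D' C(1), of p]
      jacobian_BBA[OF D D' C(1), of p] by (simp add: matrix_transpose_mul matrix_mul_assoc)
qed

lemma smooth_function_restrict:
  assumes "smooth_function A \<omega>"
  shows "smooth_function B \<omega>"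
  unfolding smooth_function_def
proof (intro ballI smooth_on_local)
  fix D x assume D: "D \<in> B" and "x \<in> chart_image D"
  then obtain p where p: "p \<in> fst D" "x = snd D p" by blast
  obtain C where C: "C \<in> A" "p \<in> fst C"
    using cover_BA[OF D p(1)] by blast
  let ?S = "snd D ` (fst D \<inter> fst C)"
  have "smooth_on ?S (\<omega> \<circ> chart_inv D)"
  proof (rule smooth_on_cong[OF open_BA[OF D C(1)]])
    have oC: "open (chart_image C)"
      using chart_A[OF C(1)] unfolding is_chart_def by blast
    have sC: "smooth_on (chart_image C) (\<omega> \<circ> chart_inv C)"
      using assms C(1) unfolding smooth_function_def by blast
    show "smooth_on ?S (\<lambda>y. (\<omega> \<circ> chart_inv C) (transition D C y))"
      by (rule smooth_on_compose[OF open_BA[OF D C(1)] oC _ smooth_BA[OF D C(1)] sC])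
        (auto simp: is_chart_inv[OF chart_B[OF D]])
  qed (auto simp: is_chart_inv[OF chart_B[OF D]] is_chart_inv[OF chart_A[OF C(1)]])
  then show "\<exists>V. x \<in> V \<and> smooth_on V (\<omega> \<circ> chart_inv D)"
    by (intro exI[of _ ?S] conjI) (use p C in blast)
qed

end

lemma smooth_function_lincomb:
  assumes "\<And>C. C \<in> A \<Longrightarrow> open (chart_image C)" "smooth_function A \<omega>" "smooth_function A \<omega>'"
  shows "smooth_function A (\<lambda>p. \<omega> p + \<omega>' p)" "smooth_function A (\<lambda>p. \<omega> p - \<omega>' p)"
proof -
  have "smooth_on (chart_image C) (\<lambda>x. (\<omega> \<circ> chart_inv C) x + (\<omega>' \<circ> chart_inv C) x)"
    "smooth_on (chart_image C) (\<lambda>x. (\<omega> \<circ> chart_inv C) x - (\<omega>' \<circ> chart_inv C) x)" if "C \<in> A" for C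
    using assms that unfolding smooth_function_def by (blast intro: smooth_on_add smooth_on_diff)+
  then show "smooth_function A (\<lambda>p. \<omega> p + \<omega>' p)" "smooth_function A (\<lambda>p. \<omega> p - \<omega>' p)"
    unfolding smooth_function_def by (auto simp: comp_def)
qed

context submanifold_charts
begin

text \<open>Pullback commutes with rescaling and conformal factors restrict smoothly, so the classes
  in the union defining \<open>induced_conformal_class\<close> are all the class of a single
  pullback.\<close>

lemma induced_conformal_class_eq:
  assumes "conformal_structure A c" and "g \<in> c"
  shows "riemannian_metric A g" and "induced_conformal_class A B c = conformal_class B (pullback_metric g)"
proof -
  obtain g0 where g0: "riemannian_metric A g0" "c = conformal_class A g0"
    using assms(1) unfolding conformal_structure_def by blast
  show g: "riemannian_metric A g"
    using assms(2) unfolding g0(2) conformal_class_def by blast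
  have oA: "open (chart_image C)" if "C \<in> A" for C
    using chart_A[OF that] unfolding is_chart_def by blast
  have oB: "open (chart_image D)" if "D \<in> B" for D
    using chart_B[OF that] unfolding is_chart_def by blast
  obtain \<omega>1 where \<omega>1: "smooth_function A \<omega>1"
    "\<And>C p. C \<in> A \<Longrightarrow> p \<in> fst C \<Longrightarrow> g C (snd C p) = exp (2 * \<omega>1 p) *\<^sub>R g0 C (snd C p)"
    using assms(2) unfolding g0(2) conformal_class_def conformally_related_def by blast
  show "induced_conformal_class A B c = conformal_class B (pullback_metric g)"
  proof (intro subset_antisym subsetI)
    fix h' assume "h' \<in> conformal_class B (pullback_metric g)"
    then show "h' \<in> induced_conformal_class A B c"
      unfolding induced_conformal_class_def
      using riemannian_pullback_metric[OF g] is_pullback_pullback_metric[OF g] assms(2) by blast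
  next
    fix h' assume "h' \<in> induced_conformal_class A B c"
    then obtain h g' where h: "h' \<in> conformal_class B h" "riemannian_metric B h" "g' \<in> c" "is_pullback_metric A B g' h"
      unfolding induced_conformal_class_def by blast
    obtain \<omega>2 where \<omega>2: "smooth_function A \<omega>2"
      "\<And>C p. C \<in> A \<Longrightarrow> p \<in> fst C \<Longrightarrow> g' C (snd C p) = exp (2 * \<omega>2 p) *\<^sub>R g0 C (snd C p)"
      using h(3) unfolding g0(2) conformal_class_def conformally_related_def by blast
    obtain \<omega>3 where \<omega>3: "smooth_function B \<omega>3"
      "\<And>D p. D \<in> B \<Longrightarrow> p \<in> fst D \<Longrightarrow> h' D (snd D p) = exp (2 * \<omega>3 p) *\<^sub>R h D (snd D p)"
      using h(1) unfolding conformal_class_def conformally_related_def by blast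
    \<comment> \<open>\<open>\<omega>2 p - \<omega>1 p\<close> leads from \<open>g\<close> to
      \<open>g'\<close>, and \<open>\<omega>3\<close> from the pullback \<open>h\<close> of
      \<open>g'\<close> to \<open>h'\<close>.\<close>
    define \<omega> where "\<omega> p = \<omega>3 p + (\<omega>2 p - \<omega>1 p)" for p
    have "smooth_function B \<omega>"
      unfolding \<omega>_def[abs_def]
      by (rule smooth_function_lincomb(1)[OF oB \<omega>3(1) smooth_function_restrict[OF smooth_function_lincomb(2)[OF oA \<omega>2(1) \<omega>1(1)]]])
    moreover have "h' D (snd D p) = exp (2 * \<omega> p) *\<^sub>R pullback_metric g D (snd D p)" if D: "D \<in> B" and p: "p \<in> fst D" for D p
    proof -
      obtain C where C: "C \<in> A" "p \<in> fst C"
        using cover_BA[OF D p] by blast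
      let ?J = "jacobian (transition D C) (at (snd D p))"
      have "g' C (snd C p) = exp (2 * (\<omega>2 p - \<omega>1 p)) *\<^sub>R g C (snd C p)"
        unfolding \<omega>2(2)[OF C] \<omega>1(2)[OF C] by (simp add: exp_add[symmetric] algebra_simps)
      moreover have "h D (snd D p) = transpose ?J ** g' C (snd C p) ** ?J"
        using h(4) D C p unfolding is_pullback_metric_def Let_def by blast
      moreover have "transpose ?J ** (r *\<^sub>R M) ** ?J = r *\<^sub>R (transpose ?J ** M ** ?J)" for r M
        by (simp add: matrix_matrix_mult_def vec_eq_iff sum_distrib_left sum_distrib_right mult_ac)
      ultimately have "h D (snd D p) = exp (2 * (\<omega>2 p - \<omega>1 p)) *\<^sub>R pullback_metric g D (snd D p)"
        unfolding pullback_metric_apply[OF g D C(1) p C(2)] by simp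
      then show ?thesis
        unfolding \<omega>3(2)[OF D p] \<omega>_def by (simp add: exp_add[symmetric] algebra_simps)
    qed
    moreover have "riemannian_metric B h'"
      using h(1) unfolding conformal_class_def by blast
    ultimately show "h' \<in> conformal_class B (pullback_metric g)"
      unfolding conformal_class_def conformally_related_def by blast
  qed
qed

end

section \<open>Existence of charts of a regular zero set\<close>

context submanifold_charts
begin

text \<open>The implicit function argument: by \<open>reg\<close>, replacing the coordinate
  \<open>z\<close> by the function itself gives a local diffeomorphism \<Psi>. On the zero set the
  new coordinate is 0, and the remaining ones form the chart.\<close>

lemma zero_set_chart:
  assumes s: "smooth_function A s" and \<Sigma>: "\<Sigma> = scale_singularity_set T s"
    and p0: "p0 \<in> \<Sigma>" and C: "C \<in> A" "p0 \<in> fst C"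
    and reg: "pd z (s \<circ> chart_inv C) (snd C p0) \<noteq> 0"
  shows "\<exists>D\<in>B. p0 \<in> fst D"
proof -
  note cC = chart_A[OF C(1)]
  define f where "f = s \<circ> chart_inv C"
  let ?U = "chart_image C"
  have oU: "open ?U" using cC unfolding is_chart_def by blast
  have smf: "smooth_on ?U f"
    using s C(1) unfolding smooth_function_def f_def by blast
  have f_s: "f (snd C r) = s r" if "r \<in> fst C" for r
    by (simp add: f_def is_chart_inv[OF cC that])
  obtain e :: "'k \<Rightarrow> 'm" where e: "inj e" "range e = - {z}"
    using obtain_complementary_index[OF codim, of z] by blast
  have ez: "e i \<noteq> z" for i using e(2) by auto
  define \<Psi> where "\<Psi> u = (\<chi> j. if j = z then f u else u $ j)" for u
  have sm\<Psi>: "smooth_map_on ?U \<Psi>"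
    unfolding smooth_map_on_def
  proof
    show "smooth_on ?U (\<lambda>u. \<Psi> u $ k)" for k
      using smf by (cases "k = z") (simp_all add: \<Psi>_def)
  qed
  have u0: "snd C p0 \<in> ?U" using C(2) by blast
  have Jac: "jacobian \<Psi> (at (snd C p0)) $ k $ i = (if k = z then pd i f (snd C p0) else if i = k then 1 else 0)" for k i
    unfolding smooth_map_jacobian[OF sm\<Psi> u0] by (cases "k = z") (simp_all add: \<Psi>_def)
  have "inj ((*v) (jacobian \<Psi> (at (snd C p0))))"
  proof (rule linear_injective_0[OF matrix_vector_mul_linear, THEN iffD2], intro allI impI)
    fix y assume "jacobian \<Psi> (at (snd C p0)) *v y = 0"
    then have y: "(\<Oplus>i. jacobian \<Psi> (at (snd C p0)) $ k $ i * y $ i) = 0" for k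
      by (simp add: matrix_vector_mult_def vec_eq_iff)
    have yk: "y $ k = 0" if "k \<noteq> z" for k
      using y[of k] that unfolding Jac by simp
    have "(\<Oplus>i. pd i f (snd C p0) * y $ i) = pd z f (snd C p0) * y $ z"
      using yk by (subst sum.remove[of _ z]) (auto intro!: sum.neutral)
    then have "y $ z = 0"
      using y[of z] reg unfolding Jac f_def by simp
    with yk show "y = 0" by (metis vec_eq_iff zero_index)
  qed
  from inverse_function_smooth[OF oU sm\<Psi> u0 inj_imp_invertible[OF this]]
  obtain U' V g where g: "open U'" "U' \<subseteq> ?U" "snd C p0 \<in> U'" "open V" "\<Psi> (snd C p0) \<in> V"
    "homeomorphism U' V \<Psi> g" "smooth_map_on V g" by blast
  have g\<Psi>: "\<And>u. u \<in> U' \<Longrightarrow> \<Psi> u \<in> V \<and> g (\<Psi> u) = u" and \<Psi>g: "\<And>y. y \<in> V \<Longrightarrow> g y \<in> U' \<and> \<Psi> (g y) = y"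
    using g(6) unfolding homeomorphism_def by auto
  \<comment> \<open>\<open>q\<close> forgets the coordinate \<open>z\<close> and
    \<open>\<iota>\<close> inserts zero there. They are mutually inverse between the slice, which is
    the zero set in the coordinates \<Psi>, and the smaller space.\<close>
  define q where "q y = (\<chi> i. y $ e i)" for y :: "real^'m"
  define \<iota> where "\<iota> x = (\<chi> j. if j = z then 0 else x $ inv e j)" for x :: "real^'k"
  have q\<iota>: "q (\<iota> x) = x" for x
    by (simp add: q_def \<iota>_def vec_eq_iff ez e(1))
  have \<iota>q: "\<iota> (q y) = y" if "y $ z = 0" for y
  proof (unfold vec_eq_iff, intro allI)
    fix j
    show "\<iota> (q y) $ j = y $ j"
    proof (cases "j = z")
      case False
      then obtain i where "j = e i" using e(2) by blast
      then show ?thesis by (simp add: \<iota>_def q_def ez e(1))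
    qed (simp add: \<iota>_def that)
  qed
  have q\<Psi>: "q (\<Psi> u) = q u" for u
    by (simp add: q_def \<Psi>_def ez)
  have lin: "linear q" "linear \<iota>"
    by (rule linearI; simp add: q_def \<iota>_def vec_eq_iff)+
  have cq: "continuous_on S q" and c\<iota>: "continuous_on S' \<iota>" for S S'
    using lin by (simp_all add: linear_continuous_on linear_conv_bounded_linear)
  define dom where "dom = {r \<in> fst C. snd C r \<in> U'} \<inter> \<Sigma>"
  define D where "D = (dom, q \<circ> snd C)"
  have D: "fst D = dom" "snd D = q \<circ> snd C" by (simp_all add: D_def)
  have \<Sigma>0: "r \<in> \<Sigma> \<longleftrightarrow> s r = 0" if "r \<in> fst C" for r
    using that is_chart_subset[OF cC] unfolding \<Sigma> scale_singularity_set_def by auto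
  have \<Psi>_dom: "\<Psi> (snd C r) = \<iota> (snd D r)" if "r \<in> dom" for r
  proof -
    have r: "r \<in> fst C" "s r = 0" using that \<Sigma>0 by (auto simp: dom_def)
    then have "\<Psi> (snd C r) $ z = 0" by (simp add: \<Psi>_def f_s)
    then show ?thesis
      using \<iota>q q\<Psi> by (metis D(2) comp_apply)
  qed
  define O' where "O' = \<iota> -` V"
  have oO: "open O'"
    unfolding O'_def using open_vimage[OF g(4) c\<iota>] .
  define k where "k x = chart_inv C (g (\<iota> x))" for x
  have k: "k x \<in> dom" "snd D (k x) = x" "snd C (k x) = g (\<iota> x)" if "x \<in> O'" for x
  proof -
    have V: "\<iota> x \<in> V" using that by (simp add: O'_def)
    then have gU: "g (\<iota> x) \<in> U'" "g (\<iota> x) \<in> ?U" using \<Psi>g g(2) by blast+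
    then have kC: "k x \<in> fst C" and C_k: "snd C (k x) = g (\<iota> x)"
      unfolding k_def by (auto intro: inv_into_into f_inv_into_f)
    show "snd C (k x) = g (\<iota> x)" by (rule C_k)
    have "s (k x) = \<Psi> (g (\<iota> x)) $ z"
      using f_s[OF kC] by (simp add: C_k \<Psi>_def)
    also have "\<dots> = 0"
      using \<Psi>g[OF V] by (simp add: \<iota>_def)
    finally show "k x \<in> dom"
      using kC gU C_k \<Sigma>0 by (simp add: dom_def)
    show "snd D (k x) = x"
      using q\<Psi>[of "g (\<iota> x)"] \<Psi>g[OF V] by (simp add: D C_k q\<iota>)
  qed
  have D_O: "snd D r \<in> O'" "k (snd D r) = r" if "r \<in> dom" for r
  proof -
    have r: "r \<in> fst C" "snd C r \<in> U'" using that by (auto simp: dom_def)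
    then have "\<Psi> (snd C r) \<in> V"
      using g\<Psi> by blast
    then show "snd D r \<in> O'"
      unfolding \<Psi>_dom[OF that] by (simp add: O'_def)
    have "g (\<iota> (snd D r)) = snd C r"
      using g\<Psi>[OF r(2)] \<Psi>_dom[OF that] by simp
    then show "k (snd D r) = r"
      by (simp add: k_def is_chart_inv[OF cC r(1)])
  qed
  have im: "chart_image D = O'"
    using k D_O unfolding D(1) by force
  have odom: "openin (subtopology T \<Sigma>) dom"
    unfolding dom_def openin_subtopology
    using is_chart_open_preimage[OF cC g(1)] by blast
  have sub: "subtopology (subtopology T \<Sigma>) dom = subtopology T dom"
    by (simp add: subtopology_subtopology dom_def Int_absorb1 inf_commute)
  have domC: "dom \<subseteq> fst C" by (auto simp: dom_def)
  have tdom: "topspace (subtopology T dom) = dom"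
    using domC is_chart_subset[OF cC] by auto
  have "homeomorphic_maps (subtopology T dom) (top_of_set O') (snd D) k"
    unfolding homeomorphic_maps_def
  proof (intro conjI ballI)
    have "continuous_map (subtopology T dom) euclidean (snd C)"
      by (rule continuous_map_from_subtopology_mono[OF is_chart_continuous[OF cC] domC])
    moreover have "continuous_map euclidean euclidean q" using cq by simp
    ultimately have "continuous_map (subtopology T dom) euclidean (snd D)"
      unfolding D(2) by (rule continuous_map_compose)
    then show "continuous_map (subtopology T dom) (top_of_set O') (snd D)"
      by (rule continuous_map_into_subtopology) (use D_O tdom in auto)
    have "continuous_on O' (\<lambda>x. g (\<iota> x))"
      by (rule continuous_on_compose2[OF smooth_map_continuous_on[OF g(7)] c\<iota>]) (auto simp: O'_def)
    then have "continuous_map (top_of_set O') (top_of_set ?U) (\<lambda>x. g (\<iota> x))"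
      by (intro continuous_map_into_subtopology) (use \<Psi>g g(2) in \<open>auto simp: O'_def\<close>)
    from continuous_map_compose[OF this is_chart_continuous_inv[OF cC]]
    have "continuous_map (top_of_set O') T k"
      unfolding k_def[abs_def] comp_def by (rule continuous_map_into_fulltopology)
    then show "continuous_map (top_of_set O') (subtopology T dom) k"
      by (rule continuous_map_into_subtopology) (use k in auto)
  qed (use k D_O tdom in auto)
  then have chart_D: "is_chart (subtopology T \<Sigma>) D"
    unfolding is_chart_def im unfolding D(1) sub homeomorphic_map_maps using odom oO by blast
  have inv_D: "chart_inv D x = k x" if "x \<in> O'" for x
  proof -
    have "chart_inv D (snd D (k x)) = k x"
      by (rule is_chart_inv[OF chart_D]) (use k[OF that] D in simp)
    then show ?thesis using k[OF that] by simp
  qed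
  have "D \<in> B"
    unfolding B_def submanifold_atlas_def
  proof (intro CollectI conjI ballI)
    show "is_chart (subtopology T \<Sigma>) D" by (rule chart_D)
    fix C' assume C': "C' \<in> A"
    let ?S = "snd D ` (fst D \<inter> fst C')"
    have "openin (subtopology T \<Sigma>) (fst D \<inter> fst C')"
      using odom openin_sub_Int[OF _ openin_A[OF C']] D by simp
    then have oS: "open ?S"
      by (rule is_chart_open_image[OF chart_D]) blast
    have SO: "y \<in> O'" "k y \<in> fst C'" "g (\<iota> y) \<in> snd C ` (fst C \<inter> fst C')" if "y \<in> ?S" for y
    proof -
      obtain r where r: "r \<in> dom" "r \<in> fst C'" "y = snd D r" using \<open>y \<in> ?S\<close> D by auto
      show "y \<in> O'" "k y \<in> fst C'" using r D_O by auto
      then show "g (\<iota> y) \<in> snd C ` (fst C \<inter> fst C')"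
        using k[of y] domC by (metis IntI imageI subsetD)
    qed
    have tr: "transition D C' y = transition C C' (g (\<iota> y))" if "y \<in> ?S" for y
      using inv_D[OF SO(1)[OF that]] by (simp add: k_def)
    have sm\<iota>: "smooth_map_on ?S \<iota>"
      unfolding smooth_map_on_def
    proof
      show "smooth_on ?S (\<lambda>x. \<iota> x $ j)" for j
        by (cases "j = z") (simp_all add: \<iota>_def)
    qed
    have smg: "smooth_map_on ?S (\<lambda>y. g (\<iota> y))"
      by (rule smooth_map_on_compose[OF oS g(4) _ sm\<iota> g(7)]) (use SO(1) O'_def in auto)
    have oCC': "open (snd C ` (fst C \<inter> fst C'))" if "C \<in> A" "C' \<in> A" for C C'
      by (rule is_chart_open_image[OF chart_A[OF that(1)] openin_Int[OF openin_A[OF that(1)] openin_A[OF that(2)]]]) blast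
    show sm: "smooth_map_on ?S (transition D C')"
    proof (rule smooth_map_on_cong[OF oS])
      show "smooth_map_on ?S (\<lambda>y. transition C C' (g (\<iota> y)))"
        by (rule smooth_map_on_compose[OF oS oCC'[OF C(1) C'] SO(3) smg smooth_AA[OF C(1) C']])
    qed (simp only: tr)
    fix r assume r: "r \<in> fst D \<inter> fst C'"
    \<comment> \<open>Immersivity follows from a smooth left inverse: passing from \<open>C'\<close>
      back to \<open>C\<close> and dropping the coordinate \<open>z\<close> recovers the coordinates
      of \<open>D\<close>.\<close>
    let ?S' = "snd C' ` (fst C' \<inter> fst C)"
    show "inj ((*v) (jacobian (transition D C') (at (snd D r))))"
    proof (rule smooth_left_inverse_imp_inj[OF oS _ sm, where H = "\<lambda>w. q (transition C' C w)" and S' = ?S'])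
      show "snd D r \<in> ?S" using r by blast
      show "smooth_map_on ?S' (\<lambda>w. q (transition C' C w))"
        using smooth_AA[OF C' C(1)] unfolding smooth_map_on_def q_def by simp
      show "transition D C' y \<in> ?S' \<and> q (transition C' C (transition D C' y)) = y" if y: "y \<in> ?S" for y
      proof -
        have ky: "k y \<in> dom" "k y \<in> fst C'" "k y \<in> fst C" "snd D (k y) = y"
          using k[OF SO(1)[OF y]] SO(2)[OF y] domC by auto
        have "transition D C' y = snd C' (k y)"
          by (simp add: inv_D[OF SO(1)[OF y]])
        then show ?thesis
          using ky by (auto simp: is_chart_inv[OF chart_A[OF C']] D)
      qed
    qed
  qed
  moreover have "p0 \<in> fst D"
    using p0 C(2) g(3) by (simp add: D dom_def)
  ultimately show ?thesis by blast
qed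

end

theorem corollary4p8:
  fixes T :: "'a topology" and A :: "('a, 5) chart set"
    and c :: "('a, 5) metric set" and g :: "('a, 5) metric" and s :: "'a \<Rightarrow> real"
    and \<Sigma> :: "'a set" and B :: "('a, 4) chart set"
  assumes "smooth_manifold T A" and "connected_space T"
    and "conformal_structure A c" and "g \<in> c"
    and "almost_einstein T A g s" and "scalar_negative A g s"
    and "\<Sigma> = scale_singularity_set T s" and "\<Sigma> \<noteq> {}"
    and "B = submanifold_atlas T A \<Sigma>"
  shows "smooth_manifold (subtopology T \<Sigma>) B \<and>
         conformal_structure B (induced_conformal_class A B c) \<and>
         bach_flat B (induced_conformal_class A B c)"
proof -
  interpret submanifold_charts T A \<Sigma> B
    by unfold_locales (use assms in simp_all)
  have g: "riemannian_metric A g" and ind: "induced_conformal_class A B c = conformal_class B (pullback_metric g)"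
    using induced_conformal_class_eq[OF assms(3,4)] by blast+
  have sms: "smooth_function A s"
    using assms(5) unfolding almost_einstein_def by blast
  have s0: "s p = 0" if "p \<in> \<Sigma>" for p
    using that unfolding assms(7) scale_singularity_set_def by blast
  \<comment> \<open>Where s = 0, the function S reduces to -|ds|^2, so scalar negativity makes the
    zero set regular.\<close>
  have grad: "trace_wrt (g C) (\<lambda>a b u. pd a (s \<circ> chart_inv C) u * pd b (s \<circ> chart_inv C) u) (snd C p) > 0"
    if "C \<in> A" "p \<in> fst C" "p \<in> \<Sigma>" for C p
  proof -
    have "S_local (g C) (s \<circ> chart_inv C) (snd C p) < 0"
      using assms(6) that unfolding scalar_negative_def by blast
    moreover have "(s \<circ> chart_inv C) (snd C p) = 0"
      using s0[OF that(3)] by (simp add: is_chart_inv[OF chart_A[OF that(1)] that(2)])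
    ultimately show ?thesis
      unfolding S_local_def by (simp only: mult_zero_right mult_zero_left)
  qed
  have cover: "\<exists>D\<in>B. p \<in> fst D" if "p \<in> topspace T" "p \<in> \<Sigma>" for p
  proof -
    obtain C where C: "C \<in> A" "p \<in> fst C" using cover_A[OF \<open>p \<in> topspace T\<close>] by blast
    obtain z where z: "pd z (s \<circ> chart_inv C) (snd C p) \<noteq> 0"
    proof (rule ccontr)
      assume "\<not> thesis"
      then have "pd z (s \<circ> chart_inv C) (snd C p) = 0" for z
        using that by blast
      then show False
        using grad[OF C \<open>p \<in> \<Sigma>\<close>] unfolding trace_wrt_def by simp
    qed
    show ?thesis
      by (rule zero_set_chart[OF sms assms(7) \<open>p \<in> \<Sigma>\<close> C z])
  qed
  have "bach_flat B (conformal_class B (pullback_metric g))"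
    unfolding bach_flat_def
  proof (intro ballI allI)
    fix h D x a b
    assume h: "h \<in> conformal_class B (pullback_metric g)" and D: "D \<in> B" and "x \<in> chart_image D"
    then obtain p where p: "p \<in> fst D" "x = snd D p" by blast
    obtain C where C: "C \<in> A" "p \<in> fst C" using cover_BA[OF D p(1)] by blast
    obtain \<omega> where \<omega>: "smooth_function B \<omega>"
      "\<And>D p. D \<in> B \<Longrightarrow> p \<in> fst D \<Longrightarrow> h D (snd D p) = exp (2 * \<omega> p) *\<^sub>R pullback_metric g D (snd D p)"
      using h unfolding conformal_class_def conformally_related_def by blast
    have hR: "riemannian_metric B h"
      using h unfolding conformal_class_def by blast
    \<comment> \<open>The part of \<open>D\<close> inside a single ambient chart, where the
      inclusion has a coordinate expression; it is a neighbourhood of \<open>x\<close>, which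
      suffices for the local statement.\<close>
    let ?V = "snd D ` (fst D \<inter> fst C)"
    let ?f = "s \<circ> chart_inv C"
    interpret H: metric_region "chart_image D" "h D"
      by (rule riemannian_metric_region[OF chart_B[OF D] hR D])
    have VD: "?V \<subseteq> chart_image D" by blast
    have D\<Sigma>: "q \<in> \<Sigma>" if "q \<in> fst D" for q
      using that is_chart_subset[OF chart_B[OF D]] by auto
    have trans: "transition D C (snd D q) = snd C q" if "q \<in> fst D" for q
      by (simp add: is_chart_inv[OF chart_B[OF D] that])
    show "bach (h D) a b x = 0"
    proof (rule bach_flat_local[where W = "chart_image C" and G = "g C" and f = ?f and V = ?V
          and \<phi> = "transition D C" and \<sigma> = "\<omega> \<circ> chart_inv D"])
      show "metric_region (chart_image C) (g C)"
        by (rule riemannian_metric_region[OF chart_A[OF C(1)] g C(1)])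
      show "metric_region ?V (h D)"
        by unfold_locales (use open_BA[OF D C(1)] H.G_sym H.G_inv smooth_on_subset[OF H.sm_G VD] in auto)
      show "CARD(5) = 5" "CARD(4) = 4" by simp_all
      show "smooth_on (chart_image C) ?f"
        using sms C(1) unfolding smooth_function_def by blast
      show "trace_free_part (g C) (\<lambda>a b u. hessian (g C) ?f a b u + ?f u * schouten (g C) a b u) a b u = 0"
        if "u \<in> chart_image C" for u a b
        using assms(5) C(1) that unfolding almost_einstein_def Let_def by blast
      show "smooth_map_on ?V (transition D C)"
        by (rule smooth_BA[OF D C(1)])
      show "smooth_on ?V (\<omega> \<circ> chart_inv D)"
        using smooth_on_subset[OF _ VD] \<omega>(1) D unfolding smooth_function_def by blast
      show "x \<in> ?V" using p C by blast
      fix y assume "y \<in> ?V"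
      then obtain q where q: "q \<in> fst D" "q \<in> fst C" "y = snd D q" by blast
      show "transition D C y \<in> chart_image C"
        using q trans by auto
      show "?f (transition D C y) = 0"
        unfolding q(3) trans[OF q(1)] using s0[OF D\<Sigma>[OF q(1)]] by (simp add: is_chart_inv[OF chart_A[OF C(1)] q(2)])
      show "inj ((*v) (jacobian (transition D C) (at y)))"
        using immersion_BA[OF D C(1), of q] q by blast
      show "trace_wrt (g C) (\<lambda>a b u. pd a ?f u * pd b ?f u) (transition D C y) \<noteq> 0"
        unfolding q(3) trans[OF q(1)] using grad[OF C(1) q(2) D\<Sigma>[OF q(1)]] by simp
      show "h D y = exp (2 * (\<omega> \<circ> chart_inv D) y) *\<^sub>R
          (transpose (jacobian (transition D C) (at y)) ** g C (transition D C y) ** jacobian (transition D C) (at y))"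
        unfolding q(3) trans[OF q(1)] \<omega>(2)[OF D q(1)] pullback_metric_apply[OF g D C(1) q(1,2)]
        by (simp add: is_chart_inv[OF chart_B[OF D] q(1)])
    qed
  qed
  moreover have "conformal_structure B (induced_conformal_class A B c)"
    unfolding conformal_structure_def ind using riemannian_pullback_metric[OF g] by blast
  ultimately show ?thesis
    using submanifold_smooth[OF cover] ind by simp
qed

end
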